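(* Let $\Omega\subset\mathbb{R}^N$, $N\ge1$, be a bounded smooth domain, let $g:\Omega\times\mathbb{R}\to\mathbb{R}$ be a function and set $G(x,t):=\int_0^t g(x,s)\,ds$. Suppose there exists $p\in(1,2)$ such that: for every $x\in\Omega$ the function $t\mapsto G(x,t^{1/p})$ is concave on $[0,\infty)$; and the map $u\mapsto\int_\Omega G(x,u)\,dx$ is Fréchet differentiable in $W^{1,p}_0(\Omega)$, its derivative (at $u$) evaluated at $v\in W^{1,p}_0(\Omega)$ being $\int_\Omega g(x,u)v\,dx$. Then there exists at most one positive solution of $$-\operatorname{div}\left(\frac{\nabla u}{\sqrt{1+|\nabla u|^2}}\right)=g(x,u)\ \text{ in }\Omega,\qquad u=0\ \text{ on }\partial\Omega,$$ in the set $$Z:=\left\{u\in W^{1,\infty}_0(\Omega):\ \|\nabla u\|_{L^\infty(\Omega)}<\left(\frac{2-p}{p-1}\right)^{1/2}\right\}.$$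
   Context: Positive means $u>0$ in $\Omega$. Solutions in $Z$ are understood in the weak sense; equivalently they are the critical points lying in $Z$ of the Fréchet differentiable functional $I:W^{1,p}_0(\Omega)\to\mathbb{R}$, $I(u)=\int_\Omega\left(\sqrt{1+|\nabla u|^2}-G(x,u)\right)dx$, i.e. $\int_\Omega\frac{\nabla u\cdot\nabla\varphi}{\sqrt{1+|\nabla u|^2}}\,dx=\int_\Omega g(x,u)\varphi\,dx$ for all $\varphi\in W^{1,p}_0(\Omega)$. *)

theory Defs
  imports "HOL-Analysis.Analysis" "HOL-Probability.Essential_Supremum"
begin

section \<open>Smooth functions and bounded smooth domains\<close>

fun Ck_on :: "nat \<Rightarrow> 'a::euclidean_space set \<Rightarrow> ('a \<Rightarrow> real) \<Rightarrow> bool" where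
  "Ck_on 0 U f \<longleftrightarrow> continuous_on U f"
| "Ck_on (Suc k) U f \<longleftrightarrow>
     (\<forall>x\<in>U. f differentiable (at x)) \<and>
     (\<forall>b\<in>Basis. Ck_on k U (\<lambda>x. frechet_derivative f (at x) b))"

definition smooth_on :: "'a::euclidean_space set \<Rightarrow> ('a \<Rightarrow> real) \<Rightarrow> bool" where
  "smooth_on U f \<longleftrightarrow> (\<forall>k. Ck_on k U f)"

text \<open>Near each boundary point, in the direction of some unit vector \<open>e\<close>, the set is the region
  above the graph of a smooth function \<open>\<gamma>\<close> of the remaining coordinates; \<open>\<gamma>\<close> is
  evaluated at the projection of \<open>x\<close> to the orthogonal complement of \<open>e\<close> only.\<close>

definition smooth_boundary :: "'a::euclidean_space set \<Rightarrow> bool" where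
  "smooth_boundary \<Omega> \<longleftrightarrow>
     (\<forall>x0\<in>frontier \<Omega>. \<exists>r>0. \<exists>e. norm e = 1 \<and> (\<exists>\<gamma>. smooth_on UNIV \<gamma> \<and>
        \<Omega> \<inter> ball x0 r = {x \<in> ball x0 r. x \<bullet> e > \<gamma> (x - (x \<bullet> e) *\<^sub>R e)}))"

definition bounded_smooth_domain :: "'a::euclidean_space set \<Rightarrow> bool" where
  "bounded_smooth_domain \<Omega> \<longleftrightarrow>
     \<Omega> \<noteq> {} \<and> open \<Omega> \<and> connected \<Omega> \<and> bounded \<Omega> \<and> smooth_boundary \<Omega>"

section \<open>Sobolev spaces\<close>

text \<open>Sobolev functions are represented by functions on the whole space of which only the values on
  \<open>\<Omega>\<close>, up to Lebesgue null sets, matter.\<close>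

definition test_functions :: "'a::euclidean_space set \<Rightarrow> ('a \<Rightarrow> real) set" where
  "test_functions \<Omega> =
     {\<phi>. smooth_on UNIV \<phi> \<and> compact (closure {x. \<phi> x \<noteq> 0}) \<and> closure {x. \<phi> x \<noteq> 0} \<subseteq> \<Omega>}"

definition locally_integrable ::
  "'a::euclidean_space set \<Rightarrow> ('a \<Rightarrow> 'b::euclidean_space) \<Rightarrow> bool" where
  "locally_integrable \<Omega> f \<longleftrightarrow> (\<forall>K. compact K \<and> K \<subseteq> \<Omega> \<longrightarrow> f absolutely_integrable_on K)"

definition has_weak_gradient ::
  "'a::euclidean_space set \<Rightarrow> ('a \<Rightarrow> real) \<Rightarrow> ('a \<Rightarrow> 'a) \<Rightarrow> bool" where
  "has_weak_gradient \<Omega> u D \<longleftrightarrow>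
     locally_integrable \<Omega> u \<and> locally_integrable \<Omega> D \<and>
     (\<forall>\<phi>\<in>test_functions \<Omega>. \<forall>b\<in>Basis.
        (LINT x|lebesgue_on \<Omega>. u x * frechet_derivative \<phi> (at x) b) =
        - (LINT x|lebesgue_on \<Omega>. (D x \<bullet> b) * \<phi> x))"

text \<open>The weak gradient is unique almost everywhere on an open set; an arbitrary representative is
  chosen.\<close>

definition weak_gradient :: "'a::euclidean_space set \<Rightarrow> ('a \<Rightarrow> real) \<Rightarrow> 'a \<Rightarrow> 'a" where
  "weak_gradient \<Omega> u = (SOME D. has_weak_gradient \<Omega> u D)"

definition mem_Lp ::
  "real \<Rightarrow> 'a::euclidean_space set \<Rightarrow> ('a \<Rightarrow> 'b::euclidean_space) \<Rightarrow> bool" where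
  "mem_Lp p \<Omega> f \<longleftrightarrow> f \<in> borel_measurable (lebesgue_on \<Omega>) \<and>
     integrable (lebesgue_on \<Omega>) (\<lambda>x. norm (f x) powr p)"

definition Linf_norm ::
  "'a::euclidean_space set \<Rightarrow> ('a \<Rightarrow> 'b::euclidean_space) \<Rightarrow> ereal" where
  "Linf_norm \<Omega> f = esssup (lebesgue_on \<Omega>) (\<lambda>x. ereal (norm (f x)))"

definition mem_Linf :: "'a::euclidean_space set \<Rightarrow> ('a \<Rightarrow> 'b::euclidean_space) \<Rightarrow> bool" where
  "mem_Linf \<Omega> f \<longleftrightarrow> f \<in> borel_measurable (lebesgue_on \<Omega>) \<and> Linf_norm \<Omega> f < \<infinity>"

definition W1p :: "real \<Rightarrow> 'a::euclidean_space set \<Rightarrow> ('a \<Rightarrow> real) set" where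
  "W1p p \<Omega> = {u. mem_Lp p \<Omega> u \<and> (\<exists>D. has_weak_gradient \<Omega> u D \<and> mem_Lp p \<Omega> D)}"

definition W1p_norm :: "real \<Rightarrow> 'a::euclidean_space set \<Rightarrow> ('a \<Rightarrow> real) \<Rightarrow> real" where
  "W1p_norm p \<Omega> u =
     ((LINT x|lebesgue_on \<Omega>. \<bar>u x\<bar> powr p) +
      (LINT x|lebesgue_on \<Omega>. norm (weak_gradient \<Omega> u x) powr p)) powr (1 / p)"

definition W1p0 :: "real \<Rightarrow> 'a::euclidean_space set \<Rightarrow> ('a \<Rightarrow> real) set" where
  "W1p0 p \<Omega> =
     {u \<in> W1p p \<Omega>. \<forall>\<epsilon>>0. \<exists>\<phi>\<in>test_functions \<Omega>. W1p_norm p \<Omega> (\<lambda>x. u x - \<phi> x) < \<epsilon>}"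

definition W1inf :: "'a::euclidean_space set \<Rightarrow> ('a \<Rightarrow> real) set" where
  "W1inf \<Omega> = {u. mem_Linf \<Omega> u \<and> (\<exists>D. has_weak_gradient \<Omega> u D \<and> mem_Linf \<Omega> D)}"

text \<open>The closure of the test functions in the \<open>W\<^sup>1\<^sup>,\<^sup>\<infinity>\<close> norm would contain continuously
  differentiable functions only; the usual convention for exponent \<open>\<infinity>\<close> is the following.\<close>

definition W1inf0 :: "'a::euclidean_space set \<Rightarrow> ('a \<Rightarrow> real) set" where
  "W1inf0 \<Omega> = W1inf \<Omega> \<inter> W1p0 1 \<Omega>"

text \<open>\<open>L\<close> is the Frechet derivative at \<open>u\<close> of the functional \<open>J\<close> on the normed space
  \<open>W1p0 p \<Omega>\<close>. The space is not a type, so that \<open>has_derivative\<close> does not apply.\<close>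

definition has_W1p0_derivative ::
  "real \<Rightarrow> 'a::euclidean_space set \<Rightarrow> (('a \<Rightarrow> real) \<Rightarrow> real) \<Rightarrow> (('a \<Rightarrow> real) \<Rightarrow> real)
    \<Rightarrow> ('a \<Rightarrow> real) \<Rightarrow> bool" where
  "has_W1p0_derivative p \<Omega> J L u \<longleftrightarrow>
     (\<forall>v\<in>W1p0 p \<Omega>. \<forall>w\<in>W1p0 p \<Omega>. \<forall>a b. L (\<lambda>x. a * v x + b * w x) = a * L v + b * L w) \<and>
     (\<exists>C. \<forall>v\<in>W1p0 p \<Omega>. \<bar>L v\<bar> \<le> C * W1p_norm p \<Omega> v) \<and>
     (\<forall>\<epsilon>>0. \<exists>\<delta>>0. \<forall>v\<in>W1p0 p \<Omega>. W1p_norm p \<Omega> v < \<delta> \<longrightarrow>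
        \<bar>J (\<lambda>x. u x + v x) - J u - L v\<bar> \<le> \<epsilon> * W1p_norm p \<Omega> v)"

section \<open>The mean curvature problem\<close>

definition primitive :: "('a \<Rightarrow> real \<Rightarrow> real) \<Rightarrow> 'a \<Rightarrow> real \<Rightarrow> real" where
  "primitive g x t = interval_lebesgue_integral lebesgue (ereal 0) (ereal t) (g x)"

definition Z_set :: "real \<Rightarrow> 'a::euclidean_space set \<Rightarrow> ('a \<Rightarrow> real) set" where
  "Z_set p \<Omega> =
     {u \<in> W1inf0 \<Omega>. Linf_norm \<Omega> (weak_gradient \<Omega> u) < ereal (((2 - p) / (p - 1)) powr (1 / 2))}"

definition weak_solution ::
  "real \<Rightarrow> 'a::euclidean_space set \<Rightarrow> ('a \<Rightarrow> real \<Rightarrow> real) \<Rightarrow> ('a \<Rightarrow> real) \<Rightarrow> bool" where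
  "weak_solution p \<Omega> g u \<longleftrightarrow>
     (\<forall>\<phi>\<in>W1p0 p \<Omega>.
        (LINT x|lebesgue_on \<Omega>. (weak_gradient \<Omega> u x \<bullet> weak_gradient \<Omega> \<phi> x)
            / sqrt (1 + (norm (weak_gradient \<Omega> u x))\<^sup>2)) =
        (LINT x|lebesgue_on \<Omega>. g x (u x) * \<phi> x))"

definition positive_on :: "'a::euclidean_space set \<Rightarrow> ('a \<Rightarrow> real) \<Rightarrow> bool" where
  "positive_on \<Omega> u \<longleftrightarrow> (AE x in lebesgue_on \<Omega>. u x > 0)"

end

theory Submission
  imports Defs "HOL-Real_Asymp.Real_Asymp"
begin

text \<open>Let \<open>u\<close>, \<open>v\<close> be two positive solutions in \<open>Z\<close>, and put \<open>U = u + \<epsilon>\<close>, \<open>V = v + \<epsilon>\<close> for \<open>\<epsilon> > 0\<close>. Following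
  Diaz and Saa, test the equation of \<open>u\<close> with \<open>(U\<^sup>p - V\<^sup>p) / U\<^sup>p\<^sup>-\<^sup>1\<close>, that of \<open>v\<close> with
  \<open>(V\<^sup>p - U\<^sup>p) / V\<^sup>p\<^sup>-\<^sup>1\<close>, and add. By Young's inequality, and because \<open>s\<^sup>2\<^sup>-\<^sup>p / sqrt (1 + s\<^sup>2)\<close> is strictly
  increasing for \<open>s\<^sup>2 < (2 - p) / (p - 1)\<close>, the integrand on the left is nonnegative and vanishes only
  where the two gradients agree. By concavity of \<open>G (x, t\<^bsup>1/p\<^esup>)\<close>, the integrand on the right is bounded
  above, uniformly in \<open>\<epsilon>\<close>, by an integrable multiple of \<open>(\<bar>g (x, u)\<bar> + \<bar>g (x, v)\<bar>) \<bar>u - v\<bar>\<close>, and it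
  becomes nonpositive as \<open>\<epsilon> \<rightarrow> 0\<close>. Fatou's lemma then gives \<open>\<nabla>u = \<nabla>v\<close>, hence \<open>u = v\<close>. This one-sided
  bound replaces the comparability of \<open>u\<close> and \<open>v\<close> that is usually derived from Hopf's lemma.

  The test functions have to lie in \<open>W\<^sub>0\<^sup>1\<^sup>,\<^sup>p\<close>. Smoothness of the boundary is used only here: every
  boundary point is a limit of exterior points, so mollifications of a Lipschitz function with zero
  trace are uniformly small outside the domain, and truncating them gives compactly supported
  approximants with uniformly bounded gradients.\<close>

section \<open>Calculus of smooth functions\<close>

text \<open>The hypotheses do not make \<open>g\<close> a pointwise derivative of its primitive;
  they speak only of integrals along functions of \<open>W1p0 p\<close>. That
  \<open>g x s * s powr (1 - p)\<close> decreases in \<open>s\<close>, as concavity suggests, can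
  therefore be recovered only at the two values \<open>u x\<close> and \<open>v x\<close> and only
  almost everywhere: concavity is integrated against test functions, compared there with the Frechet
  derivative, and localised again. The shift by \<epsilon> is forced by the boundary, where both
  solutions may tend to zero at unrelated rates, so that negative powers of them would make the test
  quotients inadmissible. The shift spoils the exact sign of the right-hand side, because
  \<open>g\<close> is still evaluated at the unshifted values; the sign returns only in the limit.
  The left-hand integrands have a sign but no evident bound uniform in \<epsilon>, which rules out
  dominated convergence.\<close>

lemma Ck_on_cong:
  assumes "open U" "\<And>x. x \<in> U \<Longrightarrow> g x = h x" "Ck_on k U g"
  shows "Ck_on k U h"
  using assms(2,3)
proof (induction k arbitrary: g h)
  case 0
  then show ?case using continuous_on_cong[of U U g h] by simp
next
  case (Suc k)
  have der: "(h has_derivative frechet_derivative g (at x)) (at x)" if "x \<in> U" for x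
    using Suc.prems that assms(1)
    by (metis (no_types, lifting) Ck_on.simps(2) frechet_derivative_works has_derivative_transform_within_open)
  have eq: "frechet_derivative g (at x) = frechet_derivative h (at x)" if "x \<in> U" for x
    by (rule frechet_derivative_at[OF der[OF that]])
  have "Ck_on k U (\<lambda>x. frechet_derivative h (at x) b)" if "b \<in> Basis" for b
    by (rule Suc.IH[where g = "\<lambda>x. frechet_derivative g (at x) b"])
      (use eq Suc.prems(2) that in auto)
  moreover have "h differentiable (at x)" if "x \<in> U" for x
    using der[OF that] by (rule differentiableI)
  ultimately show ?case by simp
qed

text \<open>The working form of the recursive clause: any explicit derivative may stand in for the
  choice \<open>frechet_derivative\<close>. Openness of \<open>U\<close> makes agreement on
  \<open>U\<close> enough for the further derivatives.\<close>

lemma Ck_on_SucI: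
  assumes "open U" "\<And>x. x \<in> U \<Longrightarrow> (f has_derivative f' x) (at x)"
    and "\<And>b. b \<in> Basis \<Longrightarrow> Ck_on k U (\<lambda>x. f' x b)"
  shows "Ck_on (Suc k) U f"
proof -
  have eq: "f' x = frechet_derivative f (at x)" if "x \<in> U" for x
    by (rule frechet_derivative_at[OF assms(2)[OF that]])
  have "Ck_on k U (\<lambda>x. frechet_derivative f (at x) b)" if "b \<in> Basis" for b
    by (rule Ck_on_cong[OF assms(1) _ assms(3)[OF that]]) (simp add: eq)
  moreover have "f differentiable (at x)" if "x \<in> U" for x
    using assms(2)[OF that] by (rule differentiableI)
  ultimately show ?thesis by simp
qed

lemma Ck_on_SucD:
  "Ck_on (Suc k) U f \<Longrightarrow> Ck_on k U f"
proof (induction k arbitrary: f)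
  case 0
  then show ?case
    by (auto intro!: continuous_at_imp_continuous_on differentiable_imp_continuous_within)
next
  case (Suc k)
  then show ?case by (metis Ck_on.simps(2))
qed

lemma Ck_on_differentiable:
  assumes "Ck_on (Suc k) U f" "x \<in> U"
  shows "(f has_derivative frechet_derivative f (at x)) (at x)"
  using assms by (simp add: frechet_derivative_works)

lemma Ck_on_subset: "Ck_on k U f \<Longrightarrow> V \<subseteq> U \<Longrightarrow> Ck_on k V f"
  by (induction k arbitrary: f) (auto intro: continuous_on_subset)

lemma Ck_on_const [simp]: "Ck_on k U (\<lambda>x. c)"
  by (induction k arbitrary: c) auto

lemma Ck_on_add:
  assumes "open U" "Ck_on k U f" "Ck_on k U g"
  shows "Ck_on k U (\<lambda>x. f x + g x)"
  using assms(2,3)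
proof (induction k arbitrary: f g)
  case 0
  then show ?case by (auto intro: continuous_intros)
next
  case (Suc k)
  show ?case
    by (rule Ck_on_SucI[OF assms(1) has_derivative_add[OF Ck_on_differentiable Ck_on_differentiable]])
      (use Suc in auto)
qed

lemma Ck_on_mult:
  assumes "open U" "Ck_on k U f" "Ck_on k U g"
  shows "Ck_on k U (\<lambda>x. f x * g x)"
  using assms(2,3)
proof (induction k arbitrary: f g)
  case 0
  then show ?case by (auto intro: continuous_intros)
next
  case (Suc k)
  show ?case
    by (rule Ck_on_SucI[OF assms(1) has_derivative_mult[OF Ck_on_differentiable Ck_on_differentiable]])
      (use Suc Ck_on_SucD[OF Suc.prems(1)] Ck_on_SucD[OF Suc.prems(2)] in
        \<open>auto intro!: Ck_on_add[OF assms(1)]\<close>)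
qed

lemma Ck_on_inner [simp]:
  shows "Ck_on k U (\<lambda>x. x \<bullet> i)"
proof (cases k)
  case 0
  then show ?thesis by (auto intro: continuous_intros)
next
  case (Suc l)
  have "Ck_on (Suc l) UNIV (\<lambda>x. x \<bullet> i)"
    by (rule Ck_on_SucI[where f' = "\<lambda>x h. h \<bullet> i"]) (auto intro!: derivative_eq_intros)
  then show ?thesis using Suc Ck_on_subset by blast
qed

text \<open>By the chain rule a partial derivative is the derivative of \<open>h\<close> at
  \<open>f x\<close> times a partial derivative of \<open>f\<close>. The induction therefore keeps
  \<open>f\<close> and replaces \<open>h\<close> by its derivative. The domain \<open>S\<close> is
  needed for real powers, which are smooth only on the positive half line.\<close>

lemma Ck_on_compose:
  fixes h :: "real \<Rightarrow> real"
  assumes "open U" "open S" "Ck_on k S h" "Ck_on k U f" "f ` U \<subseteq> S"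
  shows "Ck_on k U (\<lambda>x. h (f x))"
  using assms(3,4)
proof (induction k arbitrary: h)
  case 0
  then show ?case using assms(5) by (auto intro: continuous_on_compose2)
next
  case (Suc k)
  have 1: "((\<lambda>x. h (f x)) has_derivative (\<lambda>v. frechet_derivative h (at (f x)) 1 * frechet_derivative f (at x) v)) (at x)"
    if "x \<in> U" for x
  proof -
    have hd: "(h has_derivative frechet_derivative h (at (f x))) (at (f x))"
      using Suc.prems(1) assms(5) that Ck_on_differentiable by blast
    have eq: "frechet_derivative h (at (f x)) r = frechet_derivative h (at (f x)) 1 * r" for r
      using linear_cmul[OF has_derivative_linear[OF hd], of r 1] by (simp add: mult.commute)
    show ?thesis
    proof (rule has_derivative_eq_rhs)
      show "((\<lambda>x. h (f x)) has_derivative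
        frechet_derivative h (at (f x)) \<circ> frechet_derivative f (at x)) (at x)"
        using diff_chain_at[OF Ck_on_differentiable[OF Suc.prems(2) that] hd] by (simp add: o_def)
      show "frechet_derivative h (at (f x)) \<circ> frechet_derivative f (at x) =
        (\<lambda>v. frechet_derivative h (at (f x)) 1 * frechet_derivative f (at x) v)"
        unfolding o_def by (rule ext) (rule eq)
    qed
  qed
  have 2: "Ck_on k U (\<lambda>x. frechet_derivative h (at (f x)) 1)"
  proof (rule Suc.IH)
    show "Ck_on k S (\<lambda>s. frechet_derivative h (at s) 1)"
      using Suc.prems(1) by simp
    show "Ck_on k U f"
      using Suc.prems(2) by (rule Ck_on_SucD)
  qed
  have 3: "Ck_on k U (\<lambda>x. frechet_derivative f (at x) b)" if "b \<in> Basis" for b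
    using Suc.prems(2) that by simp
  show ?case
    by (rule Ck_on_SucI[OF assms(1) 1]) (assumption, rule Ck_on_mult[OF assms(1) 2 3])
qed

lemma Ck_on_real_SucI:
  fixes f :: "real \<Rightarrow> real"
  assumes "open U" "\<And>x. x \<in> U \<Longrightarrow> (f has_real_derivative f' x) (at x)" "Ck_on k U f'"
  shows "Ck_on (Suc k) U f"
  by (rule Ck_on_SucI[OF assms(1), where f' = "\<lambda>x h. f' x * h"])
    (use assms in \<open>auto simp: has_field_derivative_def\<close>)

lemma smooth_on_const [simp]: "smooth_on U (\<lambda>x. c)"
  by (simp add: smooth_on_def)

lemma smooth_on_inner [simp]: "smooth_on U (\<lambda>x. x \<bullet> i)"
  by (simp add: smooth_on_def)

lemma smooth_on_add:
  "open U \<Longrightarrow> smooth_on U f \<Longrightarrow> smooth_on U g \<Longrightarrow> smooth_on U (\<lambda>x. f x + g x)"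
  by (simp add: smooth_on_def Ck_on_add)

lemma smooth_on_mult:
  "open U \<Longrightarrow> smooth_on U f \<Longrightarrow> smooth_on U g \<Longrightarrow> smooth_on U (\<lambda>x. f x * g x)"
  by (simp add: smooth_on_def Ck_on_mult)

lemma smooth_on_diff:
  assumes "open U" "smooth_on U f" "smooth_on U g"
  shows "smooth_on U (\<lambda>x. f x - g x)"
  using smooth_on_add[OF assms(1,2) smooth_on_mult[OF assms(1) smooth_on_const[of U "-1"] assms(3)]]
  by simp

lemma smooth_on_compose:
  fixes h :: "real \<Rightarrow> real"
  assumes "open U" "open S" "smooth_on S h" "smooth_on U f" "f ` U \<subseteq> S"
  shows "smooth_on U (\<lambda>x. h (f x))"
  using assms by (simp add: smooth_on_def Ck_on_compose)

lemma smooth_on_prod: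
  assumes "open U" "finite A" "\<And>i. i \<in> A \<Longrightarrow> smooth_on U (f i)"
  shows "smooth_on U (\<lambda>x. \<Prod>i\<in>A. f i x)"
  using assms(2,3) by (induction A) (auto intro: smooth_on_mult[OF assms(1)])

lemma smooth_on_has_derivative:
  "smooth_on U f \<Longrightarrow> x \<in> U \<Longrightarrow> (f has_derivative frechet_derivative f (at x)) (at x)"
  unfolding smooth_on_def using Ck_on_differentiable by blast

lemma smooth_on_continuous: "smooth_on U f \<Longrightarrow> continuous_on U f"
  unfolding smooth_on_def using Ck_on.simps(1) by blast

lemma smooth_on_partial:
  "smooth_on U f \<Longrightarrow> b \<in> Basis \<Longrightarrow> smooth_on U (\<lambda>x. frechet_derivative f (at x) b)"
  unfolding smooth_on_def using Ck_on.simps(2) by blast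

section \<open>Real powers and functions that are flat at the origin\<close>

lemma Ck_on_powr: "Ck_on k {0<..} (\<lambda>s::real. s powr c)"
proof (induction k arbitrary: c)
  case 0
  then show ?case by (auto intro!: continuous_intros)
next
  case (Suc k)
  show ?case
    by (rule Ck_on_real_SucI[where f' = "\<lambda>s. c * s powr (c - 1)"])
      (auto intro!: Ck_on_mult Suc has_real_derivative_powr)
qed

lemma smooth_on_powr: "smooth_on {0<..} (\<lambda>s::real. s powr c)"
  by (simp add: smooth_on_def Ck_on_powr)

text \<open>\<open>s\<^sup>c exp (- 1 / s)\<close>, extended by zero to \<open>s \<le> 0\<close>. Allowing all real exponents \<open>c\<close> makes the
  family closed under differentiation up to linear combinations.\<close>

definition flat :: "real \<Rightarrow> real \<Rightarrow> real" where
  "flat c s = (if s > 0 then s powr c * exp (- 1 / s) else 0)"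

lemma flat_tendsto_0: "(flat c \<longlongrightarrow> 0) (at_right 0)"
proof -
  have "((\<lambda>s. s powr c * exp (- 1 / s)) \<longlongrightarrow> 0) (at_right (0::real))"
    by real_asymp
  moreover have "\<forall>\<^sub>F s in at_right 0. s powr c * exp (- 1 / s) = flat c s"
    by (auto simp: flat_def eventually_at_right_less intro: eventually_mono[OF eventually_at_right_less])
  ultimately show ?thesis by (rule Lim_transform_eventually)
qed

lemma flat_has_derivative:
  "(flat c has_real_derivative (c * flat (c - 1) s + flat (c - 2) s)) (at s)"
proof -
  consider "s > 0" | "s < 0" | "s = 0" by linarith
  then show ?thesis
  proof cases
    case 1
    have "((\<lambda>s. s powr c * exp (- 1 / s)) has_real_derivative
      c * s powr (c - 1) * exp (- 1 / s) + s powr c * (exp (- 1 / s) * (1 / (s * s)))) (at s)"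
      using 1 by (auto intro!: derivative_eq_intros simp: field_simps power2_eq_square)
    moreover have "s powr c * (exp (- 1 / s) * (1 / (s * s))) = s powr (c - 2) * exp (- 1 / s)"
      using 1 by (simp add: powr_diff power2_eq_square)
    ultimately have "((\<lambda>s. s powr c * exp (- 1 / s)) has_real_derivative
      (c * flat (c - 1) s + flat (c - 2) s)) (at s)"
      using 1 by (simp add: flat_def mult.assoc)
    then show ?thesis
      by (rule has_field_derivative_transform_within_open[where S = "{0<..}"]) (use 1 in \<open>auto simp: flat_def\<close>)
  next
    case 2
    have "((\<lambda>s. 0) has_real_derivative 0) (at s)" by simp
    then have "(flat c has_real_derivative 0) (at s)"
      by (rule has_field_derivative_transform_within_open[where S = "{..<0}"]) (use 2 in \<open>auto simp: flat_def\<close>)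
    then show ?thesis using 2 by (simp add: flat_def)
  next
    case 3
    have "((\<lambda>h. flat c h / h) \<longlongrightarrow> 0) (at_right 0)"
    \<comment> \<open>The difference quotient at the origin is again a member of the family, with
      exponent lowered by one.\<close>
    proof (rule Lim_transform_eventually[OF flat_tendsto_0[of "c - 1"]])
      show "\<forall>\<^sub>F h in at_right 0. flat (c - 1) h = flat c h / h"
        by (rule eventually_mono[OF eventually_at_right_less]) (auto simp: flat_def powr_diff)
    qed
    moreover have "((\<lambda>h. flat c h / h) \<longlongrightarrow> 0) (at_left 0)"
      by (rule tendsto_eventually)
        (auto simp: flat_def eventually_at_left_field intro!: exI[of _ "-1"])
    ultimately have "((\<lambda>h. flat c h / h) \<longlongrightarrow> 0) (at 0)"
      by (simp add: filterlim_split_at)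
    then show ?thesis
      using 3 by (simp add: DERIV_def flat_def)
  qed
qed

lemma smooth_on_flat: "smooth_on UNIV (flat c)"
proof -
  have "Ck_on k UNIV (flat c)" for k
  proof (induction k arbitrary: c)
    case 0
    have "isCont (flat c) x" for x
      using flat_has_derivative DERIV_isCont by blast
    then show ?case by (simp add: continuous_at_imp_continuous_on)
  next
    case (Suc k)
    show ?case
      by (rule Ck_on_real_SucI[OF _ flat_has_derivative]) (auto intro!: Ck_on_add Ck_on_mult Suc)
  qed
  then show ?thesis by (simp add: smooth_on_def)
qed

section \<open>Test functions\<close>

definition grad :: "('a::euclidean_space \<Rightarrow> real) \<Rightarrow> 'a \<Rightarrow> 'a" where
  "grad f x = (\<Sum>b\<in>Basis. frechet_derivative f (at x) b *\<^sub>R b)"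

lemma inner_grad: "b \<in> Basis \<Longrightarrow> grad f x \<bullet> b = frechet_derivative f (at x) b"
  by (simp add: grad_def inner_sum_left inner_Basis if_distrib cong: if_cong)

lemma has_derivative_grad:
  assumes "smooth_on UNIV f"
  shows "(f has_derivative (\<lambda>h. grad f x \<bullet> h)) (at x)"
proof -
  have d: "(f has_derivative frechet_derivative f (at x)) (at x)"
    using smooth_on_has_derivative[OF assms] by simp
  have "frechet_derivative f (at x) h = grad f x \<bullet> h" for h
  proof -
    have "frechet_derivative f (at x) h = frechet_derivative f (at x) (\<Sum>b\<in>Basis. (h \<bullet> b) *\<^sub>R b)"
      by (simp add: euclidean_representation)
    also have "\<dots> = (\<Sum>b\<in>Basis. (h \<bullet> b) * frechet_derivative f (at x) b)"
      using has_derivative_linear[OF d] by (simp add: linear_sum linear_cmul)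
    also have "\<dots> = grad f x \<bullet> h"
      by (simp add: grad_def inner_sum_right inner_commute[of _ h] mult.commute)
    finally show ?thesis .
  qed
  then have "frechet_derivative f (at x) = (\<lambda>h. grad f x \<bullet> h)" by auto
  then show ?thesis using d by simp
qed

lemma grad_unique:
  assumes "(f has_derivative (\<lambda>h. D \<bullet> h)) (at x)"
  shows "grad f x = D"
proof -
  have "frechet_derivative f (at x) b = D \<bullet> b" for b
    by (simp flip: frechet_derivative_at[OF assms])
  then show ?thesis by (simp add: grad_def euclidean_representation)
qed

lemma continuous_grad:
  assumes "smooth_on UNIV f"
  shows "continuous_on UNIV (grad f)"
  unfolding grad_def[abs_def]
  by (intro continuous_intros smooth_on_continuous smooth_on_partial assms)

lemma test_functions_smooth: "\<phi> \<in> test_functions \<Omega> \<Longrightarrow> smooth_on UNIV \<phi>"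
  by (simp add: test_functions_def)

lemma test_functions_mono: "\<Omega> \<subseteq> \<Omega>' \<Longrightarrow> \<phi> \<in> test_functions \<Omega> \<Longrightarrow> \<phi> \<in> test_functions \<Omega>'"
  by (auto simp: test_functions_def)

lemma test_functionsI:
  assumes "smooth_on UNIV \<phi>" "compact K" "K \<subseteq> \<Omega>" "\<And>x. x \<notin> K \<Longrightarrow> \<phi> x = 0"
  shows "\<phi> \<in> test_functions \<Omega>"
proof -
  have "closure {x. \<phi> x \<noteq> 0} \<subseteq> K"
    using assms by (intro closure_minimal compact_imp_closed) auto
  then show ?thesis
    using assms(1-3) compact_Int_closed[OF assms(2) closed_closure, of "{x. \<phi> x \<noteq> 0}"]
    unfolding test_functions_def by (auto simp: Int_absorb1)
qed

text \<open>The set \<open>K\<close> is the closed support, not just any set outside which the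
  function is zero: its complement is open, so the gradient vanishes there as well.\<close>

lemma test_functionsE:
  assumes "\<phi> \<in> test_functions \<Omega>"
  obtains K where "compact K" "K \<subseteq> \<Omega>" "\<And>x. x \<notin> K \<Longrightarrow> \<phi> x = 0" "\<And>x. x \<notin> K \<Longrightarrow> grad \<phi> x = 0"
proof (rule that[of "closure {x. \<phi> x \<noteq> 0}"])
  show "compact (closure {x. \<phi> x \<noteq> 0})" "closure {x. \<phi> x \<noteq> 0} \<subseteq> \<Omega>"
    using assms by (auto simp: test_functions_def)
  show z: "\<phi> x = 0" if "x \<notin> closure {x. \<phi> x \<noteq> 0}" for x
    using that closure_subset[of "{x. \<phi> x \<noteq> 0}"] by (metis (mono_tags, lifting) mem_Collect_eq subsetD)
  show "grad \<phi> x = 0" if "x \<notin> closure {x. \<phi> x \<noteq> 0}" for x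
  proof (rule grad_unique)
    have "((\<lambda>x. 0) has_derivative (\<lambda>h. 0 \<bullet> h)) (at x)" by simp
    moreover have "open (- closure {x. \<phi> x \<noteq> 0})" by (rule open_Compl) simp
    ultimately show "(\<phi> has_derivative (\<lambda>h. 0 \<bullet> h)) (at x)"
    proof (rule has_derivative_transform_within_open)
      show "x \<in> - closure {x. \<phi> x \<noteq> 0}" using that by simp
      show "0 = \<phi> y" if "y \<in> - closure {x. \<phi> x \<noteq> 0}" for y
        using z[of y] that by (metis ComplD)
    qed
  qed
qed

lemma test_functions_mult:
  assumes "\<phi> \<in> test_functions \<Omega>" "smooth_on UNIV \<zeta>"
  shows "(\<lambda>x. \<phi> x * \<zeta> x) \<in> test_functions \<Omega>"
proof -
  obtain K where "compact K" "K \<subseteq> \<Omega>" "\<And>x. x \<notin> K \<Longrightarrow> \<phi> x = 0"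
    using test_functionsE[OF assms(1)] by metis
  then show ?thesis
    using assms by (intro test_functionsI[where K = K] smooth_on_mult) (auto dest: test_functions_smooth)
qed

lemma test_functions_partial:
  assumes "\<phi> \<in> test_functions \<Omega>" "b \<in> Basis"
  shows "(\<lambda>x. frechet_derivative \<phi> (at x) b) \<in> test_functions \<Omega>"
proof -
  obtain K where "compact K" "K \<subseteq> \<Omega>" "\<And>x. x \<notin> K \<Longrightarrow> grad \<phi> x = 0"
    using test_functionsE[OF assms(1)] by metis
  then show ?thesis
    using assms by (intro test_functionsI[where K = K] smooth_on_partial)
      (auto simp flip: inner_grad dest: test_functions_smooth)
qed

lemma test_functions_continuous:
  "\<phi> \<in> test_functions \<Omega> \<Longrightarrow> continuous_on UNIV \<phi>"
  using smooth_on_continuous test_functions_smooth by blast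

lemma test_functions_bounded:
  assumes "\<phi> \<in> test_functions \<Omega>"
  obtains B where "\<And>x. \<bar>\<phi> x\<bar> \<le> B"
proof -
  obtain K where K: "compact K" "\<And>x. x \<notin> K \<Longrightarrow> \<phi> x = 0"
    using test_functionsE[OF assms(1)] by metis
  have "compact (\<phi> ` K)"
    using K(1) test_functions_continuous[OF assms]
    by (intro compact_continuous_image) (auto intro: continuous_on_subset)
  then obtain B where B: "\<And>y. y \<in> \<phi> ` K \<Longrightarrow> norm y \<le> B"
    using compact_imp_bounded bounded_iff by metis
  have "\<bar>\<phi> x\<bar> \<le> max B 0" for x
    using B[of "\<phi> x"] K(2)[of x] by (cases "x \<in> K") auto
  then show ?thesis using that by blast
qed

lemma test_functions_grad_bounded:
  assumes "\<phi> \<in> test_functions \<Omega>"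
  obtains B where "\<And>x. norm (grad \<phi> x) \<le> B"
proof -
  have "\<exists>B. \<forall>x. \<bar>frechet_derivative \<phi> (at x) b\<bar> \<le> B" if "b \<in> Basis" for b
    using test_functions_bounded[OF test_functions_partial[OF assms that]] by metis
  then obtain B where B: "\<And>b x. b \<in> Basis \<Longrightarrow> \<bar>frechet_derivative \<phi> (at x) b\<bar> \<le> B b"
    by metis
  have "norm (grad \<phi> x) \<le> (\<Sum>b\<in>Basis. B b)" for x
    unfolding grad_def by (rule order_trans[OF norm_sum]) (auto intro!: sum_mono B)
  then show ?thesis using that by blast
qed

lemma grad_bound_imp_Lipschitz:
  assumes "smooth_on UNIV f" "\<And>x. norm (grad f x) \<le> B"
  shows "\<bar>f x - f y\<bar> \<le> B * norm (x - y)"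
proof -
  have "norm (f x - f y) \<le> B * norm (x - y)"
  proof (rule differentiable_bound[where S = UNIV and f' = "\<lambda>x h. grad f x \<bullet> h"])
    show "onorm ((\<bullet>) (grad f x)) \<le> B" for x
      using assms(2)[of x] by (auto intro!: onorm_le order_trans[OF Cauchy_Schwarz_ineq2] mult_right_mono)
  qed (use has_derivative_grad[OF assms(1)] in auto)
  then show ?thesis by simp
qed

section \<open>Smooth bumps on boxes and the fundamental lemma\<close>

text \<open>For positive \<open>t\<close> each coordinate contributes a factor that is positive
  exactly between the two faces of the box. Raising \<open>t\<close> steepens the factors without
  changing the support, so the bumps tend to the indicator of the open box; this leads from test
  functions to integrals over boxes.\<close>

definition box_bump :: "real \<Rightarrow> 'a::euclidean_space \<Rightarrow> 'a \<Rightarrow> 'a \<Rightarrow> real" where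
  "box_bump t a b x = (\<Prod>i\<in>Basis. flat 0 (t * (x \<bullet> i - a \<bullet> i)) * flat 0 (t * (b \<bullet> i - x \<bullet> i)))"

lemma flat0_bounds: "0 \<le> flat 0 s" "flat 0 s \<le> 1"
  by (auto simp: flat_def)

lemma smooth_on_box_bump: "smooth_on UNIV (box_bump t a b)"
proof -
  have f: "smooth_on UNIV (\<lambda>x. flat 0 (g x))" if "smooth_on UNIV g" for g :: "'a \<Rightarrow> real"
    by (rule smooth_on_compose[OF _ _ smooth_on_flat that]) auto
  show ?thesis
    unfolding box_bump_def[abs_def]
    by (rule smooth_on_prod, simp, simp, rule smooth_on_mult, simp)
      (rule f, rule smooth_on_mult, simp, rule smooth_on_const, rule smooth_on_diff, simp_all)+
qed

lemma box_bump_bounds: "0 \<le> box_bump t a b x" "box_bump t a b x \<le> 1"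
  unfolding box_bump_def
  by (auto intro!: prod_nonneg prod_le_1 mult_nonneg_nonneg mult_le_one flat0_bounds)

lemma box_bump_pos: "t > 0 \<Longrightarrow> x \<in> box a b \<Longrightarrow> box_bump t a b x > 0"
  unfolding box_bump_def by (intro prod_pos) (auto simp: mem_box flat_def)

lemma box_bump_outside: "t > 0 \<Longrightarrow> x \<notin> box a b \<Longrightarrow> box_bump t a b x = 0"
proof -
  assume t: "t > 0" and "x \<notin> box a b"
  then obtain i where i: "i \<in> Basis" "x \<bullet> i \<le> a \<bullet> i \<or> b \<bullet> i \<le> x \<bullet> i"
    by (auto simp: mem_box not_less)
  then have "flat 0 (t * (x \<bullet> i - a \<bullet> i)) * flat 0 (t * (b \<bullet> i - x \<bullet> i)) = 0"
    using t by (auto simp: flat_def zero_less_mult_iff)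
  then show "box_bump t a b x = 0"
    unfolding box_bump_def using i(1) by (intro prod_zero) auto
qed

lemma box_bump_test:
  assumes "t > 0" "cbox a b \<subseteq> \<Omega>"
  shows "box_bump t a b \<in> test_functions \<Omega>"
  using assms box_subset_cbox[of a b]
  by (intro test_functionsI[where K = "cbox a b"] smooth_on_box_bump compact_cbox box_bump_outside) auto

lemma box_bump_tendsto:
  "(\<lambda>n. box_bump (real (Suc n)) a b x) \<longlonglongrightarrow> indicator (box a b) x"
proof (cases "x \<in> box a b")
  case True
  have "(\<lambda>n. flat 0 (real (Suc n) * r)) \<longlonglongrightarrow> 1" if "r > 0" for r :: real
  proof -
    have "(\<lambda>n. exp (- 1 / (real (Suc n) * r))) \<longlonglongrightarrow> 1" using that by real_asymp
    then show ?thesis using that by (simp add: flat_def)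
  qed
  note lim = this
  have "(\<lambda>n. box_bump (real (Suc n)) a b x) \<longlonglongrightarrow> (\<Prod>i\<in>(Basis::'a set). 1 * 1)"
    unfolding box_bump_def
    by (rule Limits.tendsto_prod[where L = "\<lambda>_. 1 * 1"], rule tendsto_mult; rule lim) (use True in \<open>auto simp: mem_box\<close>)
  then show ?thesis using True by simp
next
  case False
  then show ?thesis by (simp add: box_bump_outside)
qed

section \<open>Passage between Lebesgue and Borel integrals; the fundamental lemma\<close>

lemma AE_lebesgue_on_negligibleI:
  assumes "S \<in> sets lebesgue" "negligible N" "\<And>x. x \<in> S \<Longrightarrow> x \<notin> N \<Longrightarrow> P x"
  shows "AE x in lebesgue_on S. P x"
proof -
  have "AE x in lebesgue. x \<in> S \<longrightarrow> P x"
    using assms by (intro AE_I'[of N]) (auto simp: negligible_iff_null_sets)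
  then show ?thesis using assms(1) by (subst AE_restrict_space_iff) auto
qed

text \<open>The definitions integrate with respect to \<open>lebesgue_on\<close>, whereas
  translations and reflections are carried out with \<open>lborel\<close>; this is the
  bridge.\<close>

lemma integral_lebesgue_on_eq_lborel:
  fixes f :: "'a::euclidean_space \<Rightarrow> 'b::euclidean_space"
  assumes "S \<in> sets lebesgue" "f \<in> borel_measurable borel" "\<And>x. x \<notin> S \<Longrightarrow> f x = 0"
  shows "integral\<^sup>L (lebesgue_on S) f = integral\<^sup>L lborel f"
proof -
  have "(\<lambda>x. indicator S x *\<^sub>R f x) = f" using assms(3) by (auto simp: indicator_def)
  then show ?thesis using assms by (simp add: integral_restrict_space integral_completion)
qed

lemma continuous_imp_lebesgue_measurable:
  fixes f :: "'a::euclidean_space \<Rightarrow> 'b::euclidean_space"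
  assumes "continuous_on UNIV f"
  shows "f \<in> borel_measurable lebesgue"
  using borel_measurable_continuous_onI[OF assms] by (intro measurable_completion) simp

lemma locally_integrable_mult_integrable:
  fixes f :: "'a::euclidean_space \<Rightarrow> real"
  assumes "locally_integrable \<Omega> f" "\<Omega> \<in> sets lebesgue" "\<theta> \<in> test_functions \<Omega>"
  shows "integrable (lebesgue_on \<Omega>) (\<lambda>x. f x * \<theta> x)"
proof -
  obtain K where K: "compact K" "K \<subseteq> \<Omega>" "\<And>x. x \<notin> K \<Longrightarrow> \<theta> x = 0"
    using test_functionsE[OF assms(3)] by metis
  obtain B where B: "\<And>x. \<bar>\<theta> x\<bar> \<le> B" using test_functions_bounded[OF assms(3)] by metis
  have i: "integrable lebesgue (\<lambda>x. indicator K x * f x)"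
    using assms(1) K unfolding locally_integrable_def set_integrable_def by auto
  have [measurable]: "\<theta> \<in> borel_measurable lebesgue"
    using test_functions_continuous[OF assms(3)]
    by (rule continuous_imp_lebesgue_measurable)
  have "integrable lebesgue (\<lambda>x. (indicator K x * f x) * \<theta> x)"
  proof (rule Bochner_Integration.integrable_bound)
    show "integrable lebesgue (\<lambda>x. B * (indicator K x * f x))" using i by simp
    show "(\<lambda>x. (indicator K x * f x) * \<theta> x) \<in> borel_measurable lebesgue"
      using borel_measurable_integrable[OF i] by measurable
    show "AE x in lebesgue. norm ((indicator K x * f x) * \<theta> x) \<le> norm (B * (indicator K x * f x))"
    proof (intro AE_I2)
      fix x
      have "\<bar>f x\<bar> * \<bar>\<theta> x\<bar> \<le> \<bar>f x\<bar> * \<bar>B\<bar>" using B[of x] by (intro mult_left_mono) auto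
      then show "norm ((indicator K x * f x) * \<theta> x) \<le> norm (B * (indicator K x * f x))"
        by (auto simp: abs_mult indicator_def mult.commute)
    qed
  qed
  also have "(\<lambda>x. (indicator K x * f x) * \<theta> x) = (\<lambda>x. indicator \<Omega> x *\<^sub>R (f x * \<theta> x))"
    using K(2,3) by (auto simp: indicator_def fun_eq_iff)
  finally show ?thesis using assms(2) by (simp add: integrable_restrict_space)
qed

text \<open>A one-sided fundamental lemma of the calculus of variations. Bumps converging to
  indicators give nonnegative integrals over all boxes in \<Omega>, and Lebesgue differentiation
  returns to points. The one-sided form is what the supergradient inequality requires; equalities
  follow by using it with both signs.\<close>

lemma AE_nonneg_of_test_functions:
  fixes f :: "'a::euclidean_space \<Rightarrow> real"
  assumes "open \<Omega>" "locally_integrable \<Omega> f"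
    and nonneg: "\<And>\<theta>. \<theta> \<in> test_functions \<Omega> \<Longrightarrow> (\<And>x. 0 \<le> \<theta> x) \<Longrightarrow> 0 \<le> (LINT x|lebesgue_on \<Omega>. f x * \<theta> x)"
  shows "AE x in lebesgue_on \<Omega>. 0 \<le> f x"
proof -
  have \<Omega>: "\<Omega> \<in> sets lebesgue" using assms(1) by auto
  have int: "f absolutely_integrable_on cbox a b" if "cbox a b \<subseteq> \<Omega>" for a b
    using assms(2) that by (auto simp: locally_integrable_def)
  have box: "0 \<le> integral (cbox a b) f" if sub: "cbox a b \<subseteq> \<Omega>" for a b
  proof -
    have i: "integrable lebesgue (\<lambda>x. indicator (cbox a b) x * f x)"
      using int[OF sub] unfolding set_integrable_def by simp
    have "(\<lambda>n. LINT x|lebesgue. (indicator (cbox a b) x * f x) * box_bump (real (Suc n)) a b x) \<longlonglongrightarrow>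
      (LINT x|lebesgue. (indicator (cbox a b) x * f x) * indicator (box a b) x)"
    proof (rule integral_dominated_convergence)
      show "integrable lebesgue (\<lambda>x. norm (indicator (cbox a b) x * f x))"
        using i by (rule integrable_norm)
      show "(\<lambda>x. (indicator (cbox a b) x * f x) * box_bump (real (Suc n)) a b x) \<in> borel_measurable lebesgue" for n
        by (rule borel_measurable_times[OF borel_measurable_integrable[OF i]
              continuous_imp_lebesgue_measurable[OF smooth_on_continuous[OF smooth_on_box_bump]]])
      show "AE x in lebesgue. norm ((indicator (cbox a b) x * f x) * box_bump (real (Suc n)) a b x)
          \<le> norm (indicator (cbox a b) x * f x)" for n
        using box_bump_bounds[of "real (Suc n)" a b]
        by (intro AE_I2) (auto simp: abs_mult abs_le_iff intro!: mult_left_le order_trans[OF _ box_bump_bounds(1)])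
      show "(\<lambda>x. (indicator (cbox a b) x * f x) * indicator (box a b) x) \<in> borel_measurable lebesgue"
        by (rule borel_measurable_times[OF borel_measurable_integrable[OF i] borel_measurable_indicator]) simp
    qed (intro AE_I2 tendsto_mult_left box_bump_tendsto)
    moreover have "0 \<le> (LINT x|lebesgue. (indicator (cbox a b) x * f x) * box_bump (real (Suc n)) a b x)" for n
    proof -
      have "0 \<le> (LINT x|lebesgue_on \<Omega>. f x * box_bump (real (Suc n)) a b x)"
        using box_bump_bounds sub by (intro nonneg box_bump_test) auto
      also have "\<dots> = (LINT x|lebesgue. indicator \<Omega> x *\<^sub>R (f x * box_bump (real (Suc n)) a b x))"
        using \<Omega> by (simp add: integral_restrict_space)
      also have "\<dots> = (LINT x|lebesgue. (indicator (cbox a b) x * f x) * box_bump (real (Suc n)) a b x)"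
        using sub box_subset_cbox[of a b] box_bump_outside[of "real (Suc n)" _ a b]
        by (intro Bochner_Integration.integral_cong) (auto simp: indicator_def)
      finally show ?thesis .
    qed
    ultimately have "0 \<le> (LINT x|lebesgue. (indicator (cbox a b) x * f x) * indicator (box a b) x)"
      by (meson LIMSEQ_le_const)
    also have "\<dots> = (LINT x|lebesgue_on (box a b). f x)"
      using box_subset_cbox[of a b]
      by (subst integral_restrict_space) (auto intro!: Bochner_Integration.integral_cong simp: indicator_def)
    also have "\<dots> = integral (box a b) f"
    proof (rule lebesgue_integral_eq_integral)
      show "integrable (lebesgue_on (box a b)) f"
        using set_integrable_subset[OF int[OF sub], of "box a b"]
          box_subset_cbox[of a b] by (simp add: integrable_restrict_space set_integrable_def)
    qed auto
    finally show ?thesis by (simp add: integral_open_interval)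
  qed
  have cb: "\<exists>N. negligible N \<and> (\<forall>x\<in>cbox a b. x \<notin> N \<longrightarrow> 0 \<le> f x)" if sub: "cbox a b \<subseteq> \<Omega>" for a b
  proof -
    \<comment> \<open>Extension by zero allows cubes that leave the box: the intersection of two
      boxes is a box inside \<Omega>, so the preceding fact still covers the integral of
      \<open>h\<close>.\<close>
    define h where "h x = (if x \<in> cbox a b then f x else 0)" for x
    have hint: "integral (cbox c d) h = integral (cbox c d \<inter> cbox a b) f" for c d
      unfolding h_def by (subst Int_commute) (rule Henstock_Kurzweil_Integration.integral_restrict_Int)
    have "f integrable_on cbox a b" using int[OF sub] set_lebesgue_integral_eq_integral(1) by blast
    then have "h integrable_on cbox c d" for c d
      unfolding h_def
      by (metis integrable_on_subcbox integrable_restrict_UNIV subset_UNIV)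
    \<comment> \<open>Lebesgue differentiation along cubes with lower corner \<open>x\<close>: off a
      negligible set their averages tend to \<open>h x\<close>.\<close>
    then obtain N where N: "negligible N" "\<And>x e. x \<notin> N \<Longrightarrow> 0 < e \<Longrightarrow>
       \<exists>d>0. \<forall>t. 0 < t \<and> t < d \<longrightarrow> norm (integral (cbox x (x + t *\<^sub>R One)) h /\<^sub>R t ^ DIM('a) - h x) < e"
      using integrable_ccontinuous_explicit[of h] by blast
    have "0 \<le> f x" if x: "x \<in> cbox a b" "x \<notin> N" for x
    proof (rule ccontr)
      assume "\<not> 0 \<le> f x"
      then obtain d where d: "d > 0" "\<And>t. 0 < t \<and> t < d \<Longrightarrow>
        norm (integral (cbox x (x + t *\<^sub>R One)) h /\<^sub>R t ^ DIM('a) - h x) < - f x"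
        using N(2)[OF x(2), of "- f x"] by auto
      have "0 \<le> integral (cbox x (x + (d/2) *\<^sub>R One)) h"
        unfolding hint Int_interval by (rule box) (use sub in \<open>auto simp flip: Int_interval\<close>)
      then have "0 \<le> integral (cbox x (x + (d/2) *\<^sub>R One)) h /\<^sub>R (d/2) ^ DIM('a)"
        using d(1) by simp
      then show False using d(2)[of "d/2"] d(1) x(1) by (simp add: h_def)
    qed
    then show ?thesis using N(1) by blast
  qed
  obtain \<D> where D: "countable \<D>" "\<D> \<subseteq> Pow \<Omega>" "\<And>X. X \<in> \<D> \<Longrightarrow> \<exists>a b. X = cbox a b" "\<Union>\<D> = \<Omega>"
    using open_countable_Union_open_cbox[OF assms(1)] by metis
  have "\<exists>N. negligible N \<and> (\<forall>x\<in>X. x \<notin> N \<longrightarrow> 0 \<le> f x)" if X: "X \<in> \<D>" for X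
  proof -
    obtain a b where "X = cbox a b" using D(3)[OF X] by auto
    moreover have "X \<subseteq> \<Omega>" using X D(2) by auto
    ultimately show ?thesis using cb[of a b] by simp
  qed
  then obtain N where N: "\<And>X. X \<in> \<D> \<Longrightarrow> negligible (N X)"
    "\<And>X x. X \<in> \<D> \<Longrightarrow> x \<in> X \<Longrightarrow> x \<notin> N X \<Longrightarrow> 0 \<le> f x" by metis
  have "negligible (\<Union>(N ` \<D>))"
    using N(1) D(1) by (intro negligible_countable_Union) auto
  then show ?thesis
  proof (rule AE_lebesgue_on_negligibleI[OF \<Omega>])
    fix x assume "x \<in> \<Omega>" and x: "x \<notin> \<Union>(N ` \<D>)"
    then obtain X where "X \<in> \<D>" "x \<in> X" using D(4) by auto
    then show "0 \<le> f x" using N(2)[of X x] x by auto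
  qed
qed

section \<open>Weak gradients\<close>

lemma locally_integrable_add_scaled:
  assumes "locally_integrable \<Omega> f" "locally_integrable \<Omega> g"
  shows "locally_integrable \<Omega> (\<lambda>x. c *\<^sub>R f x + d *\<^sub>R g x)"
  unfolding locally_integrable_def set_integrable_def
proof (intro allI impI)
  fix K assume K: "compact K \<and> K \<subseteq> \<Omega>"
  then have "integrable lebesgue (\<lambda>x. c *\<^sub>R (indicator K x *\<^sub>R f x) + d *\<^sub>R (indicator K x *\<^sub>R g x))"
    using assms unfolding locally_integrable_def set_integrable_def
    by (intro Bochner_Integration.integrable_add integrable_scaleR_right) auto
  then show "integrable lebesgue (\<lambda>x. indicator K x *\<^sub>R (c *\<^sub>R f x + d *\<^sub>R g x))"
    by (simp add: scaleR_add_right mult.commute)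
qed

lemma locally_integrable_inner:
  assumes "locally_integrable \<Omega> f"
  shows "locally_integrable \<Omega> (\<lambda>x. f x \<bullet> b)"
  using assms unfolding locally_integrable_def set_integrable_def
  by (auto simp flip: inner_scaleR_left)

lemma has_weak_gradient_add_scaled:
  assumes \<Omega>: "\<Omega> \<in> sets lebesgue"
    and u: "has_weak_gradient \<Omega> u D" and v: "has_weak_gradient \<Omega> v E"
  shows "has_weak_gradient \<Omega> (\<lambda>x. c * u x + d * v x) (\<lambda>x. c *\<^sub>R D x + d *\<^sub>R E x)"
  unfolding has_weak_gradient_def
proof (intro conjI ballI)
  show "locally_integrable \<Omega> (\<lambda>x. c * u x + d * v x)"
    using locally_integrable_add_scaled[of \<Omega> u v c d] u v by (simp add: has_weak_gradient_def)
  show "locally_integrable \<Omega> (\<lambda>x. c *\<^sub>R D x + d *\<^sub>R E x)"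
    using u v by (intro locally_integrable_add_scaled) (auto simp: has_weak_gradient_def)
  fix \<phi> and b :: 'a assume \<phi>: "\<phi> \<in> test_functions \<Omega>" and b: "b \<in> Basis"
  note i = locally_integrable_mult_integrable[OF _ \<Omega> test_functions_partial[OF \<phi> b]]
    locally_integrable_mult_integrable[OF locally_integrable_inner \<Omega> \<phi>, of _ b]
  have iu: "integrable (lebesgue_on \<Omega>) (\<lambda>x. u x * frechet_derivative \<phi> (at x) b)"
    "integrable (lebesgue_on \<Omega>) (\<lambda>x. v x * frechet_derivative \<phi> (at x) b)"
    "integrable (lebesgue_on \<Omega>) (\<lambda>x. (D x \<bullet> b) * \<phi> x)"
    "integrable (lebesgue_on \<Omega>) (\<lambda>x. (E x \<bullet> b) * \<phi> x)"
    using i u v by (auto simp: has_weak_gradient_def)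
  have "(LINT x|lebesgue_on \<Omega>. (c * u x + d * v x) * frechet_derivative \<phi> (at x) b)
    = c * (LINT x|lebesgue_on \<Omega>. u x * frechet_derivative \<phi> (at x) b)
      + d * (LINT x|lebesgue_on \<Omega>. v x * frechet_derivative \<phi> (at x) b)"
    using iu by (simp add: distrib_right mult.assoc)
  also have "\<dots> = c * - (LINT x|lebesgue_on \<Omega>. (D x \<bullet> b) * \<phi> x) + d * - (LINT x|lebesgue_on \<Omega>. (E x \<bullet> b) * \<phi> x)"
    using u v \<phi> b by (simp add: has_weak_gradient_def)
  also have "\<dots> = - (LINT x|lebesgue_on \<Omega>. ((c *\<^sub>R D x + d *\<^sub>R E x) \<bullet> b) * \<phi> x)"
    using iu by (simp add: inner_add_left distrib_right mult.assoc)
  finally show "(LINT x|lebesgue_on \<Omega>. (c * u x + d * v x) * frechet_derivative \<phi> (at x) b)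
    = - (LINT x|lebesgue_on \<Omega>. ((c *\<^sub>R D x + d *\<^sub>R E x) \<bullet> b) * \<phi> x)" .
qed

text \<open>Both candidates have the same integrals against test functions, so the one-sided
  fundamental lemma applies to every component of their difference with both signs.\<close>

lemma has_weak_gradient_unique:
  assumes "open \<Omega>" "has_weak_gradient \<Omega> u D" "has_weak_gradient \<Omega> u E"
  shows "AE x in lebesgue_on \<Omega>. D x = E x"
proof -
  have \<Omega>: "\<Omega> \<in> sets lebesgue" using assms(1) by auto
  have le: "AE x in lebesgue_on \<Omega>. 0 \<le> (D x - E x) \<bullet> b"
    if "b \<in> Basis" and D: "has_weak_gradient \<Omega> u D" and E: "has_weak_gradient \<Omega> u E" for D E and b :: 'a
  proof (rule AE_nonneg_of_test_functions[OF assms(1)])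
    show "locally_integrable \<Omega> (\<lambda>x. (D x - E x) \<bullet> b)"
      using locally_integrable_add_scaled[of \<Omega> D E 1 "-1"] D E
      by (intro locally_integrable_inner) (simp add: has_weak_gradient_def)
    fix \<theta> assume \<theta>: "\<theta> \<in> test_functions \<Omega>"
    have i: "integrable (lebesgue_on \<Omega>) (\<lambda>x. (D x \<bullet> b) * \<theta> x)"
      "integrable (lebesgue_on \<Omega>) (\<lambda>x. (E x \<bullet> b) * \<theta> x)"
      by (intro locally_integrable_mult_integrable[OF locally_integrable_inner \<Omega> \<theta>],
          use D E has_weak_gradient_def in metis)+
    have "(LINT x|lebesgue_on \<Omega>. (D x \<bullet> b) * \<theta> x) = (LINT x|lebesgue_on \<Omega>. (E x \<bullet> b) * \<theta> x)"
    proof -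
      have "- (LINT x|lebesgue_on \<Omega>. (F x \<bullet> b) * \<theta> x) =
          (LINT x|lebesgue_on \<Omega>. u x * frechet_derivative \<theta> (at x) b)"
        if "has_weak_gradient \<Omega> u F" for F
        using that \<theta> \<open>b \<in> Basis\<close> by (simp add: has_weak_gradient_def)
      from this[OF D] this[OF E] show ?thesis by linarith
    qed
    then show "0 \<le> (LINT x|lebesgue_on \<Omega>. ((D x - E x) \<bullet> b) * \<theta> x)"
      using i by (simp add: inner_diff_left left_diff_distrib)
  qed
  have "AE x in lebesgue_on \<Omega>. \<forall>b\<in>Basis. D x \<bullet> b = E x \<bullet> b"
  proof (rule AE_finite_allI)
    fix b :: 'a assume b: "b \<in> Basis"
    show "AE x in lebesgue_on \<Omega>. D x \<bullet> b = E x \<bullet> b"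
      using le[OF b assms(2,3)] le[OF b assms(3,2)]
      by eventually_elim (simp add: inner_diff_left)
  qed simp
  then show ?thesis by eventually_elim (simp add: euclidean_eq_iff[where 'a = 'a])
qed

text \<open>\<open>weak_gradient\<close> is a choice with no computation rules of its own. This fact
  lets every integral that contains it be evaluated with an explicit representative.\<close>

lemma weak_gradient_AE_eq:
  assumes "open \<Omega>" "has_weak_gradient \<Omega> u D"
  shows "AE x in lebesgue_on \<Omega>. weak_gradient \<Omega> u x = D x"
  using has_weak_gradient_unique[OF assms(1) _ assms(2)] someI[of "has_weak_gradient \<Omega> u" D] assms(2)
  unfolding weak_gradient_def by blast

section \<open>Integration by parts for test functions\<close>

lemma integral_lborel_translate:
  fixes f :: "'a::euclidean_space \<Rightarrow> 'b::euclidean_space"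
  assumes "f \<in> borel_measurable borel"
  shows "integral\<^sup>L lborel (\<lambda>x. f (c + x)) = integral\<^sup>L lborel f"
  using integral_distr[of "(+) c" lborel borel f] assms by (simp add: lborel_distr_plus)

lemma integrable_continuous_compact_support:
  fixes f :: "'a::euclidean_space \<Rightarrow> 'b::euclidean_space"
  assumes "continuous_on UNIV f" "compact K" "\<And>x. x \<notin> K \<Longrightarrow> f x = 0"
  shows "integrable lborel f"
proof -
  have "set_integrable lborel K f"
    using assms(1,2) unfolding set_integrable_def
    by (intro borel_integrable_compact continuous_on_subset[OF assms(1)]) auto
  moreover have "(\<lambda>x. indicator K x *\<^sub>R f x) = f" using assms(3) by (auto simp: indicator_def)
  ultimately show ?thesis by (simp add: set_integrable_def)
qed

lemma test_functions_integrable: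
  "\<phi> \<in> test_functions \<Omega> \<Longrightarrow> integrable lborel \<phi>"
  by (metis integrable_continuous_compact_support test_functionsE test_functions_continuous)

lemma test_functions_grad_integrable:
  assumes "\<phi> \<in> test_functions \<Omega>"
  shows "integrable lborel (grad \<phi>)"
proof -
  obtain K where "compact K" "\<And>x. x \<notin> K \<Longrightarrow> grad \<phi> x = 0"
    using test_functionsE[OF assms] by metis
  then show ?thesis
    by (rule integrable_continuous_compact_support[OF continuous_grad[OF test_functions_smooth[OF assms]]])
qed

text \<open>Every difference quotient has integral zero by translation invariance. The Lipschitz
  bound dominates the quotients, so the integral of their limit is zero too.\<close>

lemma integral_partial_test_function:
  fixes \<psi> :: "'a::euclidean_space \<Rightarrow> real"
  assumes \<psi>: "\<psi> \<in> test_functions UNIV" and b: "b \<in> Basis"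
  shows "(LINT x|lborel. frechet_derivative \<psi> (at x) b) = 0"
proof -
  obtain K where K: "compact K" "\<And>x. x \<notin> K \<Longrightarrow> \<psi> x = 0"
    using test_functionsE[OF \<psi>] by metis
  obtain R where R: "\<And>x. x \<in> K \<Longrightarrow> norm x \<le> R"
    using compact_imp_bounded[OF K(1)] bounded_iff by metis
  obtain C where C: "\<And>x. norm (grad \<psi> x) \<le> C" using test_functions_grad_bounded[OF \<psi>] by metis
  note lip = grad_bound_imp_Lipschitz[OF test_functions_smooth[OF \<psi>] C]
  define h where "h n = 1 / real (Suc n)" for n
  have h: "0 < h n" "h n \<le> 1" for n by (auto simp: h_def)
  have h0: "filterlim h (at 0) sequentially"
    unfolding h_def by real_asymp
  have [measurable]: "\<psi> \<in> borel_measurable borel"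
    using test_functions_continuous[OF \<psi>] by (rule borel_measurable_continuous_onI)
  have [measurable]: "(\<lambda>x. frechet_derivative \<psi> (at x) b) \<in> borel_measurable borel"
    using test_functions_continuous[OF test_functions_partial[OF \<psi> b]] by (rule borel_measurable_continuous_onI)
  have i1: "integrable lborel (\<lambda>x. \<psi> (c + x))" for c
    using test_functions_integrable[OF \<psi>] integrable_distr[of "(+) c" lborel borel \<psi>]
    by (simp add: lborel_distr_plus)
  have "(\<lambda>n. LINT x|lborel. (\<psi> (h n *\<^sub>R b + x) - \<psi> x) / h n) \<longlonglongrightarrow> (LINT x|lborel. frechet_derivative \<psi> (at x) b)"
  proof (rule integral_dominated_convergence)
    \<comment> \<open>The increments are at most 1, so for \<open>x\<close> outside the ball of
      radius \<open>R + 1\<close> both \<open>x\<close> and its translate miss the support.\<close>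
    show "integrable lborel (\<lambda>x::'a. C * indicator (cball 0 (R + 1)) x)"
      by (intro integrable_mult_right integrable_real_indicator) (use emeasure_bounded_finite[OF bounded_cball] in auto)
    show "AE x in lborel. norm ((\<psi> (h n *\<^sub>R b + x) - \<psi> x) / h n) \<le> C * indicator (cball 0 (R + 1)) x" for n
    proof (intro AE_I2)
      fix x
      show "norm ((\<psi> (h n *\<^sub>R b + x) - \<psi> x) / h n) \<le> C * indicator (cball 0 (R + 1)) x"
      proof (cases "norm x \<le> R + 1")
        case True
        then show ?thesis
          using lip[of "h n *\<^sub>R b + x" x] h[of n] b by (simp add: divide_simps)
      next
        case False
        have "norm x \<le> norm (h n *\<^sub>R b + x) + norm (h n *\<^sub>R b)"
          by (metis add_diff_cancel_left' norm_triangle_sub norm_minus_commute add.commute norm_triangle_ineq4)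
        then have "\<not> norm (h n *\<^sub>R b + x) \<le> R" using False h[of n] b by auto
        moreover have "\<not> norm x \<le> R" using False by auto
        ultimately have "\<psi> (h n *\<^sub>R b + x) = 0" "\<psi> x = 0" using K(2) R by blast+
        then show ?thesis using order_trans[OF norm_ge_zero C] by simp
      qed
    qed
    show "AE x in lborel. (\<lambda>n. (\<psi> (h n *\<^sub>R b + x) - \<psi> x) / h n) \<longlonglongrightarrow> frechet_derivative \<psi> (at x) b"
    proof (intro AE_I2)
      fix x
      have "((\<lambda>t. \<psi> (x + t *\<^sub>R b)) has_derivative (\<lambda>t. grad \<psi> x \<bullet> (t *\<^sub>R b))) (at 0)"
        by (rule has_derivative_compose[where g = \<psi>, of "\<lambda>t. x + t *\<^sub>R b" "\<lambda>t. t *\<^sub>R b", simplified])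
          (auto intro!: derivative_eq_intros has_derivative_grad[OF test_functions_smooth[OF \<psi>]])
      then have "((\<lambda>t. \<psi> (x + t *\<^sub>R b)) has_real_derivative (frechet_derivative \<psi> (at x) b)) (at 0)"
        unfolding has_field_derivative_def
        by (rule has_derivative_eq_rhs) (simp add: fun_eq_iff inner_grad[OF b])
      then have "((\<lambda>t. (\<psi> (x + t *\<^sub>R b) - \<psi> x) / t) \<longlongrightarrow> frechet_derivative \<psi> (at x) b) (at 0)"
        by (simp add: DERIV_def)
      from filterlim_compose[OF this h0]
      show "(\<lambda>n. (\<psi> (h n *\<^sub>R b + x) - \<psi> x) / h n) \<longlonglongrightarrow> frechet_derivative \<psi> (at x) b"
        by (simp add: add.commute)
    qed
  qed measurable
  moreover have z: "(LINT x|lborel. (\<psi> (h n *\<^sub>R b + x) - \<psi> x) / h n) = 0" for n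
    using i1[of "h n *\<^sub>R b"] i1[of 0] integral_lborel_translate[of \<psi> "h n *\<^sub>R b"] by simp
  ultimately have "(\<lambda>n::nat. 0) \<longlonglongrightarrow> (LINT x|lborel. frechet_derivative \<psi> (at x) b)"
    by (simp only: z)
  then show ?thesis by (simp add: LIMSEQ_const_iff)
qed

lemma frechet_derivative_mult_smooth:
  assumes "smooth_on UNIV f" "smooth_on UNIV g"
  shows "frechet_derivative (\<lambda>x. f x * g x) (at x) b =
    f x * frechet_derivative g (at x) b + frechet_derivative f (at x) b * g x"
proof -
  have "((\<lambda>x. f x * g x) has_derivative
    (\<lambda>h. f x * frechet_derivative g (at x) h + frechet_derivative f (at x) h * g x)) (at x)"
    using assms smooth_on_has_derivative by (intro has_derivative_mult) auto
  from frechet_derivative_at[OF this] show ?thesis by metis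
qed

text \<open>The integral of a partial derivative of the product \<phi> \<zeta> vanishes. Compact
  support is asked of \<phi> alone, so that \<zeta> can be a coordinate function or a test function
  of the whole space.\<close>

lemma integration_by_parts_test_function:
  fixes \<phi> \<zeta> :: "'a::euclidean_space \<Rightarrow> real"
  assumes \<phi>: "\<phi> \<in> test_functions \<Omega>" and \<zeta>: "smooth_on UNIV \<zeta>" and b: "b \<in> Basis"
    and \<Omega>: "\<Omega> \<in> sets lebesgue"
  shows "(LINT x|lebesgue_on \<Omega>. \<phi> x * frechet_derivative \<zeta> (at x) b) =
    - (LINT x|lebesgue_on \<Omega>. (grad \<phi> x \<bullet> b) * \<zeta> x)"
proof -
  have \<phi>': "\<phi> \<in> test_functions UNIV" using \<phi> test_functions_mono by blast
  obtain K where K: "compact K" "K \<subseteq> \<Omega>" "\<And>x. x \<notin> K \<Longrightarrow> \<phi> x = 0" "\<And>x. x \<notin> K \<Longrightarrow> grad \<phi> x = 0"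
    using test_functionsE[OF \<phi>] by metis
  have 1: "(\<lambda>x. \<phi> x * frechet_derivative \<zeta> (at x) b) \<in> test_functions \<Omega>"
    by (intro test_functions_mult[OF \<phi>] smooth_on_partial \<zeta> b)
  have 2: "(\<lambda>x. frechet_derivative \<phi> (at x) b * \<zeta> x) \<in> test_functions \<Omega>"
    by (intro test_functions_mult[OF test_functions_partial[OF \<phi> b]] \<zeta>)
  have "0 = (LINT x|lborel. \<phi> x * frechet_derivative \<zeta> (at x) b + frechet_derivative \<phi> (at x) b * \<zeta> x)"
    using integral_partial_test_function[OF test_functions_mult[OF \<phi>' \<zeta>] b]
      frechet_derivative_mult_smooth[OF test_functions_smooth[OF \<phi>] \<zeta>] by simp
  also have "\<dots> = (LINT x|lborel. \<phi> x * frechet_derivative \<zeta> (at x) b) + (LINT x|lborel. frechet_derivative \<phi> (at x) b * \<zeta> x)"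
    by (rule Bochner_Integration.integral_add[OF test_functions_integrable[OF 1] test_functions_integrable[OF 2]])
  also have "(LINT x|lborel. \<phi> x * frechet_derivative \<zeta> (at x) b) = (LINT x|lebesgue_on \<Omega>. \<phi> x * frechet_derivative \<zeta> (at x) b)"
    using K by (intro integral_lebesgue_on_eq_lborel[symmetric] \<Omega>
        borel_measurable_continuous_onI test_functions_continuous[OF 1]) auto
  also have "(LINT x|lborel. frechet_derivative \<phi> (at x) b * \<zeta> x) = (LINT x|lebesgue_on \<Omega>. frechet_derivative \<phi> (at x) b * \<zeta> x)"
    using K inner_grad[OF b, of \<phi>] by (intro integral_lebesgue_on_eq_lborel[symmetric] \<Omega>
        borel_measurable_continuous_onI test_functions_continuous[OF 2]) (metis inner_zero_left mult_zero_left subsetD)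
  finally show ?thesis by (simp add: inner_grad[OF b])
qed

lemma locally_integrable_continuous:
  fixes f :: "'a::euclidean_space \<Rightarrow> 'b::euclidean_space"
  assumes "continuous_on UNIV f"
  shows "locally_integrable \<Omega> f"
  unfolding locally_integrable_def
proof (intro allI impI)
  fix K :: "'a set" assume K: "compact K \<and> K \<subseteq> \<Omega>"
  then have i: "integrable lborel (\<lambda>x. indicator K x *\<^sub>R f x)"
    by (intro borel_integrable_compact continuous_on_subset[OF assms]) auto
  then show "f absolutely_integrable_on K"
    unfolding set_integrable_def using integrable_completion[OF borel_measurable_integrable[OF i]] by simp
qed

lemma test_function_has_weak_gradient:
  assumes "\<phi> \<in> test_functions \<Omega>" "\<Omega> \<in> sets lebesgue"
  shows "has_weak_gradient \<Omega> \<phi> (grad \<phi>)"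
  unfolding has_weak_gradient_def
  using integration_by_parts_test_function[OF assms(1) test_functions_smooth _ assms(2)]
  by (auto intro!: locally_integrable_continuous continuous_grad test_functions_continuous[OF assms(1)]
      test_functions_smooth[OF assms(1)])

text \<open>A weak gradient comes with local integrability only. Measurability on all of \<Omega>,
  needed whenever representatives are exchanged under an integral, is glued from countably many
  boxes.\<close>

lemma locally_integrable_measurable:
  fixes f :: "'a::euclidean_space \<Rightarrow> 'b::euclidean_space"
  assumes "open \<Omega>" "locally_integrable \<Omega> f"
  shows "f \<in> borel_measurable (lebesgue_on \<Omega>)"
proof -
  obtain \<D> where D: "countable \<D>" "\<D> \<subseteq> Pow \<Omega>" "\<And>X. X \<in> \<D> \<Longrightarrow> \<exists>a b. X = cbox a b" "\<Union>\<D> = \<Omega>"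
    using open_countable_Union_open_cbox[OF assms(1)] by metis
  have \<Omega>: "\<Omega> \<in> sets lebesgue" using assms(1) by auto
  show ?thesis
  proof (rule measurable_piecewise_restrict[OF D(1)])
    fix X assume X: "X \<in> \<D>"
    obtain a b where ab: "X = cbox a b" using D(3)[OF X] by auto
    have sub: "X \<subseteq> \<Omega>" using X D(2) by auto
    have XL: "X \<in> sets lebesgue" by (simp add: ab)
    then show "X \<inter> space (lebesgue_on \<Omega>) \<in> sets (lebesgue_on \<Omega>)"
      using sub by (simp add: sets_restrict_space_iff[of \<Omega>] \<Omega> Int_absorb2)
    have "f absolutely_integrable_on X"
      using assms(2) sub by (simp add: locally_integrable_def ab)
    then have "f \<in> borel_measurable (lebesgue_on X)"
      using XL absolutely_integrable_measurable by blast
    then show "f \<in> borel_measurable (restrict_space (lebesgue_on \<Omega>) X)"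
      using sub by (simp add: restrict_restrict_space[of \<Omega> lebesgue X] \<Omega> XL Int_absorb1)
  qed (use D(4) in auto)
qed

section \<open>Functions of zero trace as limits of test functions\<close>

lemma continuous_imp_lebesgue_on_measurable:
  fixes f :: "'a::euclidean_space \<Rightarrow> 'b::euclidean_space"
  assumes "continuous_on UNIV f"
  shows "f \<in> borel_measurable (lebesgue_on S)"
  by (rule measurable_restrict_space1[OF continuous_imp_lebesgue_measurable[OF assms]])

lemma integrable_bounded_scaleR:
  fixes f :: "'a \<Rightarrow> 'b::{banach, second_countable_topology}"
  assumes "integrable M f" "g \<in> borel_measurable M" "\<And>x. \<bar>g x\<bar> \<le> B"
  shows "integrable M (\<lambda>x. g x *\<^sub>R f x)"
proof (rule Bochner_Integration.integrable_bound)
  show "integrable M (\<lambda>x. B * norm (f x))" using assms(1) by simp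
  show "AE x in M. norm (g x *\<^sub>R f x) \<le> norm (B * norm (f x))"
    using assms(3) by (intro AE_I2) (auto simp: abs_mult intro!: mult_right_mono intro: order_trans[OF _ abs_ge_self])
qed (use assms borel_measurable_integrable in measurable)

lemma integral_tendsto_of_L1:
  fixes f :: "'a \<Rightarrow> real"
  assumes f: "integrable M f" and f_n: "\<And>n. integrable M (f_n n)"
    and lim: "(\<lambda>n. LINT x|M. norm (f x - f_n n x)) \<longlonglongrightarrow> 0"
    and g: "g \<in> borel_measurable M" "\<And>x. \<bar>g x\<bar> \<le> B"
  shows "(\<lambda>n. LINT x|M. g x * f_n n x) \<longlonglongrightarrow> (LINT x|M. g x * f x)"
proof -
  have i: "integrable M (\<lambda>x. g x * f x)" "integrable M (\<lambda>x. g x * f_n n x)" for n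
    using integrable_bounded_scaleR[OF f g] integrable_bounded_scaleR[OF f_n g] by auto
  have "norm ((LINT x|M. g x * f x) - (LINT x|M. g x * f_n n x)) \<le> B * (LINT x|M. norm (f x - f_n n x))" for n
  proof -
    have "norm ((LINT x|M. g x * f x) - (LINT x|M. g x * f_n n x)) = norm (LINT x|M. g x * f x - g x * f_n n x)"
      using i by simp
    also have "\<dots> \<le> (LINT x|M. B * norm (f x - f_n n x))"
    proof (rule order_trans[OF integral_norm_bound integral_mono])
      show "norm (g x * f x - g x * f_n n x) \<le> B * norm (f x - f_n n x)" for x
        using g(2)[of x] by (simp add: abs_mult mult_right_mono flip: right_diff_distrib)
    qed (use i f f_n in auto)
    finally show ?thesis by simp
  qed
  then have "(\<lambda>n. (LINT x|M. g x * f x) - (LINT x|M. g x * f_n n x)) \<longlonglongrightarrow> 0"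
    by (intro Lim_null_comparison[OF _ tendsto_mult_right_zero[OF lim, of B]] always_eventually allI)
  then show ?thesis
    using tendsto_diff[OF tendsto_const[of "LINT x|M. g x * f x"]] by fastforce
qed

lemma integrable_lebesgue_on_of_lborel:
  fixes f :: "'a::euclidean_space \<Rightarrow> 'b::euclidean_space"
  assumes "\<Omega> \<in> sets lebesgue" "integrable lborel f"
  shows "integrable (lebesgue_on \<Omega>) f"
proof -
  have "integrable lebesgue f"
    using assms(2) integrable_completion[OF borel_measurable_integrable[OF assms(2)]] by simp
  then show ?thesis using integrable_mult_indicator[OF assms(1), of f] assms(1)
    by (simp add: integrable_restrict_space)
qed

lemma has_weak_gradient_weak_gradient:
  "has_weak_gradient \<Omega> u D \<Longrightarrow> has_weak_gradient \<Omega> u (weak_gradient \<Omega> u)"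
  unfolding weak_gradient_def by (rule someI[where P = "has_weak_gradient \<Omega> u"])

lemma has_weak_gradient_measurable:
  assumes "open \<Omega>" "has_weak_gradient \<Omega> u D"
  shows "u \<in> borel_measurable (lebesgue_on \<Omega>)" "D \<in> borel_measurable (lebesgue_on \<Omega>)"
  using assms locally_integrable_measurable[of \<Omega> u] locally_integrable_measurable[of \<Omega> D]
  by (auto simp: has_weak_gradient_def)

text \<open>For exponent 1 the norm is the plain sum of two \<open>L\<^sup>1\<close> norms, each of
  which is therefore small separately. By uniqueness, the chosen gradient in the norm may be
  replaced by the given \<open>D\<close>.\<close>

lemma W1p0_1_approx:
  assumes \<Omega>: "open \<Omega>" and u: "u \<in> W1p0 1 \<Omega>" and D: "has_weak_gradient \<Omega> u D"
  obtains \<phi> where "integrable (lebesgue_on \<Omega>) u" "integrable (lebesgue_on \<Omega>) D"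
    "\<And>n::nat. \<phi> n \<in> test_functions \<Omega>"
    "(\<lambda>n. LINT x|lebesgue_on \<Omega>. norm (u x - \<phi> n x)) \<longlonglongrightarrow> 0"
    "(\<lambda>n. LINT x|lebesgue_on \<Omega>. norm (D x - grad (\<phi> n) x)) \<longlonglongrightarrow> 0"
proof -
  have \<Omega>': "\<Omega> \<in> sets lebesgue" using \<Omega> by auto
  have iu: "integrable (lebesgue_on \<Omega>) u"
    using u integrable_norm_iff[of u "lebesgue_on \<Omega>"] by (auto simp: W1p0_def W1p_def mem_Lp_def)
  obtain D' where D': "has_weak_gradient \<Omega> u D'" "mem_Lp 1 \<Omega> D'"
    using u by (auto simp: W1p0_def W1p_def)
  have mD: "D \<in> borel_measurable (lebesgue_on \<Omega>)"
    using D locally_integrable_measurable[OF \<Omega>] by (auto simp: has_weak_gradient_def)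
  have iD: "integrable (lebesgue_on \<Omega>) D"
  proof -
    have "integrable (lebesgue_on \<Omega>) D'"
      using D'(2) by (auto simp: mem_Lp_def integrable_norm_iff)
    then show ?thesis
      using integrable_cong_AE[OF mD _ has_weak_gradient_unique[OF \<Omega> D D'(1)]] D'(2)
      by (auto simp: mem_Lp_def)
  qed
  have "\<exists>\<phi>\<in>test_functions \<Omega>. W1p_norm 1 \<Omega> (\<lambda>x. u x - \<phi> x) < 1 / real (Suc n)" for n
    using u by (auto simp: W1p0_def)
  then obtain \<phi> where \<phi>: "\<And>n. \<phi> n \<in> test_functions \<Omega>"
    "\<And>n. W1p_norm 1 \<Omega> (\<lambda>x. u x - \<phi> n x) < 1 / real (Suc n)"
    by metis
  have lt: "(LINT x|lebesgue_on \<Omega>. norm (u x - \<phi> n x)) + (LINT x|lebesgue_on \<Omega>. norm (D x - grad (\<phi> n) x))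
    < 1 / real (Suc n)" for n
  proof -
    have hw: "has_weak_gradient \<Omega> (\<lambda>x. u x - \<phi> n x) (\<lambda>x. D x - grad (\<phi> n) x)"
      using has_weak_gradient_add_scaled[OF \<Omega>' D test_function_has_weak_gradient[OF \<phi>(1) \<Omega>'], of 1 "-1" n] by simp
    note hw' = has_weak_gradient_weak_gradient[OF hw]
    have "(LINT x|lebesgue_on \<Omega>. norm (weak_gradient \<Omega> (\<lambda>x. u x - \<phi> n x) x))
      = (LINT x|lebesgue_on \<Omega>. norm (D x - grad (\<phi> n) x))"
    proof (rule integral_cong_AE)
      show "AE x in lebesgue_on \<Omega>. norm (weak_gradient \<Omega> (\<lambda>x. u x - \<phi> n x) x) = norm (D x - grad (\<phi> n) x)"
        using has_weak_gradient_unique[OF \<Omega> hw' hw] by eventually_elim simp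
    qed (rule measurable_compose[OF has_weak_gradient_measurable(2)[OF \<Omega> hw'] borel_measurable_norm]
        measurable_compose[OF has_weak_gradient_measurable(2)[OF \<Omega> hw] borel_measurable_norm])+
    then show ?thesis using \<phi>(2)[of n] by (simp add: W1p_norm_def)
  qed
  have z: "(\<lambda>n. 1 / real (Suc n)) \<longlonglongrightarrow> 0" by real_asymp
  show ?thesis
  proof (rule that[OF iu iD \<phi>(1)])
    have "0 \<le> (LINT x|lebesgue_on \<Omega>. norm (u x - \<phi> n x))" "0 \<le> (LINT x|lebesgue_on \<Omega>. norm (D x - grad (\<phi> n) x))" for n
      by (rule Bochner_Integration.integral_nonneg, simp)+
    then have le: "(LINT x|lebesgue_on \<Omega>. norm (u x - \<phi> n x)) \<le> 1 / real (Suc n)"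
      "(LINT x|lebesgue_on \<Omega>. norm (D x - grad (\<phi> n) x)) \<le> 1 / real (Suc n)" for n
      using lt[of n] by (meson add_increasing add_increasing2 less_imp_le order_refl order_trans)+
    show "(\<lambda>n. LINT x|lebesgue_on \<Omega>. norm (u x - \<phi> n x)) \<longlonglongrightarrow> 0"
      by (rule tendsto_sandwich[OF _ _ tendsto_const z]; intro always_eventually allI)
        (simp, rule le)
    show "(\<lambda>n. LINT x|lebesgue_on \<Omega>. norm (D x - grad (\<phi> n) x)) \<longlonglongrightarrow> 0"
      by (rule tendsto_sandwich[OF _ _ tendsto_const z]; intro always_eventually allI)
        (simp, rule le)
  qed
qed

lemma W1p0_1_integrable:
  assumes "open \<Omega>" "u \<in> W1p0 1 \<Omega>" "has_weak_gradient \<Omega> u D"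
  shows "integrable (lebesgue_on \<Omega>) u" "integrable (lebesgue_on \<Omega>) D"
  by (rule W1p0_1_approx[OF assms], assumption)+

text \<open>Here the zero trace enters: \<zeta> may be nonzero on the boundary. In other words,
  \<open>u\<close> extended by zero has \<open>D\<close> extended by zero as its weak gradient on
  the whole space. The identity holds for test functions in place of \<open>u\<close> and survives
  the \<open>L\<^sup>1\<close> limit because \<zeta> and its derivative are bounded.\<close>

lemma W1p0_1_integration_by_parts:
  assumes \<Omega>: "open \<Omega>" and u: "u \<in> W1p0 1 \<Omega>" and D: "has_weak_gradient \<Omega> u D"
    and \<zeta>: "\<zeta> \<in> test_functions UNIV" and b: "b \<in> Basis"
  shows "(LINT x|lebesgue_on \<Omega>. frechet_derivative \<zeta> (at x) b * u x) = - (LINT x|lebesgue_on \<Omega>. \<zeta> x * (D x \<bullet> b))"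
proof -
  have \<Omega>': "\<Omega> \<in> sets lebesgue" using \<Omega> by auto
  obtain \<phi> where iu: "integrable (lebesgue_on \<Omega>) u" and iD: "integrable (lebesgue_on \<Omega>) D"
    and \<phi>: "\<And>n::nat. \<phi> n \<in> test_functions \<Omega>"
    and l1: "(\<lambda>n. LINT x|lebesgue_on \<Omega>. norm (u x - \<phi> n x)) \<longlonglongrightarrow> 0"
    and l2: "(\<lambda>n. LINT x|lebesgue_on \<Omega>. norm (D x - grad (\<phi> n) x)) \<longlonglongrightarrow> 0"
    by (rule W1p0_1_approx[OF \<Omega> u D]) (rule that)
  obtain B where B: "\<And>x. \<bar>\<zeta> x\<bar> \<le> B" using test_functions_bounded[OF \<zeta>] by metis
  note \<zeta>' = test_functions_partial[OF \<zeta> b]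
  obtain B' where B': "\<And>x. \<bar>frechet_derivative \<zeta> (at x) b\<bar> \<le> B'" using test_functions_bounded[OF \<zeta>'] by metis
  note i\<phi> = integrable_lebesgue_on_of_lborel[OF \<Omega>' test_functions_integrable[OF \<phi>]]
    integrable_lebesgue_on_of_lborel[OF \<Omega>' test_functions_grad_integrable[OF \<phi>]]
  have l2': "(\<lambda>n. LINT x|lebesgue_on \<Omega>. norm (D x \<bullet> b - grad (\<phi> n) x \<bullet> b)) \<longlonglongrightarrow> 0"
  proof (rule tendsto_sandwich[OF _ _ tendsto_const l2]; intro always_eventually allI)
    show "(LINT x|lebesgue_on \<Omega>. norm (D x \<bullet> b - grad (\<phi> n) x \<bullet> b)) \<le> (LINT x|lebesgue_on \<Omega>. norm (D x - grad (\<phi> n) x))" for n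
      using iD i\<phi> Basis_le_norm[OF b] by (intro integral_mono) (auto simp flip: inner_diff_left)
  qed auto
  have 1: "(\<lambda>n. LINT x|lebesgue_on \<Omega>. frechet_derivative \<zeta> (at x) b * \<phi> n x)
    \<longlonglongrightarrow> (LINT x|lebesgue_on \<Omega>. frechet_derivative \<zeta> (at x) b * u x)"
    by (rule integral_tendsto_of_L1[OF iu i\<phi>(1) l1 continuous_imp_lebesgue_on_measurable[OF test_functions_continuous[OF \<zeta>']] B'])
  have 2: "(\<lambda>n. LINT x|lebesgue_on \<Omega>. \<zeta> x * (grad (\<phi> n) x \<bullet> b)) \<longlonglongrightarrow> (LINT x|lebesgue_on \<Omega>. \<zeta> x * (D x \<bullet> b))"
    by (rule integral_tendsto_of_L1[OF _ _ l2' continuous_imp_lebesgue_on_measurable[OF test_functions_continuous[OF \<zeta>]] B])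
      (use iD i\<phi> in auto)
  have eq: "(LINT x|lebesgue_on \<Omega>. frechet_derivative \<zeta> (at x) b * \<phi> n x) = - (LINT x|lebesgue_on \<Omega>. \<zeta> x * (grad (\<phi> n) x \<bullet> b))" for n
    using integration_by_parts_test_function[OF \<phi> test_functions_smooth[OF \<zeta>] b \<Omega>'] by (simp add: mult.commute)
  show ?thesis
    by (rule LIMSEQ_unique[OF 1]) (use tendsto_minus[OF 2] eq in simp)
qed

section \<open>Mollification\<close>

definition mollifier :: "real \<Rightarrow> ('a::euclidean_space \<Rightarrow> real) \<Rightarrow> bool" where
  "mollifier r k \<longleftrightarrow> k \<in> test_functions UNIV \<and> (\<forall>x. 0 \<le> k x) \<and> (\<forall>x. r \<le> norm x \<longrightarrow> k x = 0) \<and>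
    (LINT x|lborel. k x) = 1"

text \<open>Convolution with \<open>k\<close> of the extension of \<open>f\<close> by zero.
  Integrating over \<Omega> alone keeps the extension implicit, and the result is defined at every
  point of the space.\<close>

definition mollify :: "('a::euclidean_space \<Rightarrow> real) \<Rightarrow> 'a set \<Rightarrow> ('a \<Rightarrow> 'b::euclidean_space) \<Rightarrow> 'a \<Rightarrow> 'b" where
  "mollify k \<Omega> f x = (LINT y|lebesgue_on \<Omega>. k (x - y) *\<^sub>R f y)"

lemma mollifier_exists:
  assumes "r > 0"
  obtains k :: "'a::euclidean_space \<Rightarrow> real" where "mollifier r k"
proof -
  \<comment> \<open>The Euclidean norm is at most the sum of the absolute coordinates, so the box of
    half side \<open>r / DIM('a)\<close> lies in the ball of radius \<open>r\<close>.\<close>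
  define c where "c = r / DIM('a)"
  have c: "c > 0" using assms by (simp add: c_def)
  define k0 :: "'a \<Rightarrow> real" where "k0 = box_bump 1 (- c *\<^sub>R One) (c *\<^sub>R One)"
  have test: "k0 \<in> test_functions UNIV" unfolding k0_def by (rule box_bump_test) auto
  have k0: "0 \<le> k0 x" for x by (simp add: k0_def box_bump_bounds)
  have "0 < (LINT x|lborel. k0 x)"
  proof (rule ccontr)
    assume "\<not> 0 < (LINT x|lborel. k0 x)"
    moreover have "0 \<le> (LINT x|lborel. k0 x)"
      using k0 by (rule Bochner_Integration.integral_nonneg)
    ultimately have "(LINT x|lborel. k0 x) = 0" by linarith
    then have "AE x in lborel. k0 x = 0"
      using integral_nonneg_eq_0_iff_AE[OF test_functions_integrable[OF test]] k0 by simp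
    then have "AE x in lborel. x \<notin> box (- c *\<^sub>R One) (c *\<^sub>R One :: 'a)"
      by eventually_elim (use box_bump_pos[of 1] k0_def in fastforce)
    then have "emeasure lborel (box (- c *\<^sub>R One) (c *\<^sub>R One :: 'a)) = 0"
      by (subst (asm) AE_iff_measurable[OF _ refl]) auto
    moreover have "0 < (\<Prod>i\<in>(Basis::'a set). (c *\<^sub>R One - - c *\<^sub>R One) \<bullet> i)"
      using c by (intro prod_pos) (simp add: inner_add_left)
    moreover have "emeasure lborel (box (- c *\<^sub>R One) (c *\<^sub>R One :: 'a)) =
        (\<Prod>i\<in>(Basis::'a set). (c *\<^sub>R One - - c *\<^sub>R One) \<bullet> i)"
      by (rule emeasure_lborel_box) (use c in simp)
    ultimately show False by (simp add: ennreal_eq_0_iff)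
  qed
  moreover have "k0 x = 0" if "r \<le> norm x" for x
    unfolding k0_def
  proof (rule box_bump_outside)
    show "x \<notin> box (- c *\<^sub>R One) (c *\<^sub>R One)"
    proof
      assume "x \<in> box (- c *\<^sub>R One) (c *\<^sub>R One)"
      then have "\<bar>x \<bullet> i\<bar> < c" if "i \<in> Basis" for i using that by (auto simp: mem_box)
      then have "(\<Sum>i\<in>Basis. \<bar>x \<bullet> i\<bar>) < (\<Sum>i\<in>(Basis::'a set). c)" by (intro sum_strict_mono) auto
      then show False using norm_le_l1[of x] that by (simp add: c_def)
    qed
  qed simp
  ultimately have "mollifier r (\<lambda>x. k0 x * (1 / (LINT x|lborel. k0 x)))"
    unfolding mollifier_def
    using k0 test_functions_mult[OF test smooth_on_const[of UNIV "1 / (LINT x|lborel. k0 x)"]]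
    by (auto intro!: divide_nonneg_nonneg less_imp_le)
  then show ?thesis by (rule that)
qed

lemma lborel_distr_reflect: "distr lborel borel (\<lambda>y. c - y) = (lborel :: 'a::euclidean_space measure)"
  using lborel_affine[of "-1" c] by (simp add: density_1)

lemma integral_lborel_reflect:
  fixes f :: "'a::euclidean_space \<Rightarrow> 'b::euclidean_space"
  assumes "f \<in> borel_measurable borel"
  shows "(LINT y|lborel. f (c - y)) = (LINT y|lborel. f y)"
  using integral_distr[of "\<lambda>y. c - y" lborel borel f] assms by (simp add: lborel_distr_reflect)

lemma test_functions_grad_Lipschitz:
  assumes \<phi>: "\<phi> \<in> test_functions \<Omega>"
  obtains C where "\<And>x y. norm (grad \<phi> x - grad \<phi> y) \<le> C * norm (x - y)"
proof -
  have "\<exists>C. \<forall>x y. \<bar>frechet_derivative \<phi> (at x) b - frechet_derivative \<phi> (at y) b\<bar> \<le> C * norm (x - y)"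
    if b: "b \<in> Basis" for b
  proof -
    obtain C where "\<And>x. norm (grad (\<lambda>x. frechet_derivative \<phi> (at x) b) x) \<le> C"
      using test_functions_grad_bounded[OF test_functions_partial[OF \<phi> b]] by metis
    from grad_bound_imp_Lipschitz[OF test_functions_smooth[OF test_functions_partial[OF \<phi> b]] this]
    show ?thesis by blast
  qed
  then obtain C where C: "\<And>b x y. b \<in> Basis \<Longrightarrow>
      \<bar>frechet_derivative \<phi> (at x) b - frechet_derivative \<phi> (at y) b\<bar> \<le> C b * norm (x - y)"
    by metis
  have "norm (grad \<phi> x - grad \<phi> y) \<le> (\<Sum>b\<in>Basis. C b) * norm (x - y)" for x y
  proof -
    have "grad \<phi> x - grad \<phi> y = (\<Sum>b\<in>Basis. (frechet_derivative \<phi> (at x) b - frechet_derivative \<phi> (at y) b) *\<^sub>R b)"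
      by (simp add: grad_def sum_subtractf scaleR_diff_left)
    also have "norm \<dots> \<le> (\<Sum>b\<in>Basis. C b * norm (x - y))"
      by (rule order_trans[OF norm_sum sum_mono]) (use C in auto)
    finally show ?thesis by (simp add: sum_distrib_right)
  qed
  then show ?thesis using that by blast
qed

text \<open>The gradient is Lipschitz because the second derivatives are bounded. The point of the
  estimate is that \<open>C\<close> does not depend on \<open>z\<close>, so that it can be
  integrated against any integrable function.\<close>

lemma test_functions_Taylor:
  assumes k: "k \<in> test_functions \<Omega>"
  obtains C where "\<And>z h. \<bar>k (z + h) - k z - grad k z \<bullet> h\<bar> \<le> C * (norm h)\<^sup>2"
proof -
  obtain C where C: "\<And>x y. norm (grad k x - grad k y) \<le> C * norm (x - y)"
    using test_functions_grad_Lipschitz[OF k] by metis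
  \<comment> \<open>The Lipschitz bound between \<open>b\<close> and \<open>0\<close>, which are at
    distance 1, shows that \<open>C\<close> is nonnegative.\<close>
  obtain b :: 'a where b: "b \<in> Basis" using nonempty_Basis by blast
  have C0: "C \<ge> 0"
    using order_trans[OF norm_ge_zero C[of b 0]] b by simp
  have "\<bar>k (z + h) - k z - grad k z \<bullet> h\<bar> \<le> C * (norm h)\<^sup>2" for z h
  proof -
    have "norm (k (z + h) - k z - (\<lambda>h. grad k z \<bullet> h) (z + h - z)) \<le> norm (z + h - z) * (C * norm h)"
    proof (rule differentiable_bound_linearization[where S = "cball z (norm h)" and f' = "\<lambda>x h. grad k x \<bullet> h"])
      show "z + t *\<^sub>R (z + h - z) \<in> cball z (norm h)" if "t \<in> {0..1}" for t
        using that by (auto simp: dist_norm intro: mult_left_le_one_le)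
      show "(k has_derivative (\<lambda>h. grad k x \<bullet> h)) (at x within cball z (norm h))" for x
        by (rule has_derivative_at_withinI[OF has_derivative_grad[OF test_functions_smooth[OF k]]])
      show "onorm ((\<lambda>h. grad k x \<bullet> h) - (\<lambda>h. grad k z \<bullet> h)) \<le> C * norm h" if "x \<in> cball z (norm h)" for x
      proof (rule onorm_le)
        fix v
        have "norm (((\<lambda>h. grad k x \<bullet> h) - (\<lambda>h. grad k z \<bullet> h)) v) = \<bar>(grad k x - grad k z) \<bullet> v\<bar>"
          by (simp add: inner_diff_left)
        also have "\<dots> \<le> norm (grad k x - grad k z) * norm v" by (rule Cauchy_Schwarz_ineq2)
        also have "\<dots> \<le> (C * norm h) * norm v"
        proof (rule mult_right_mono)
          have "norm (x - z) \<le> norm h" using that by (simp add: dist_norm norm_minus_commute)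
          then show "norm (grad k x - grad k z) \<le> C * norm h"
            using C[of x z] C0 by (meson mult_left_mono order_trans)
        qed simp
        finally show "norm (((\<lambda>h. grad k x \<bullet> h) - (\<lambda>h. grad k z \<bullet> h)) v) \<le> C * norm h * norm v" .
      qed
    qed auto
    then show ?thesis by (simp add: power2_eq_square mult.commute mult.left_commute)
  qed
  then show ?thesis using that by blast
qed

lemma shifted_measurable:
  fixes f :: "'a::euclidean_space \<Rightarrow> 'b::euclidean_space"
  assumes "continuous_on UNIV f"
  shows "(\<lambda>y. f (x - y)) \<in> borel_measurable (lebesgue_on S)"
  by (intro continuous_imp_lebesgue_on_measurable continuous_on_compose2[OF assms] continuous_intros) auto

lemma mollify_integrable:
  fixes f :: "'a::euclidean_space \<Rightarrow> 'b::euclidean_space"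
  assumes "k \<in> test_functions UNIV" "integrable (lebesgue_on \<Omega>) f"
  shows "integrable (lebesgue_on \<Omega>) (\<lambda>y. k (x - y) *\<^sub>R f y)"
proof -
  obtain B where "\<And>x. \<bar>k x\<bar> \<le> B" using test_functions_bounded[OF assms(1)] by metis
  then show ?thesis
    by (intro integrable_bounded_scaleR[OF assms(2) shifted_measurable] test_functions_continuous[OF assms(1)])
qed

lemma mollify_grad_integrable:
  fixes u :: "'a::euclidean_space \<Rightarrow> real"
  assumes k: "k \<in> test_functions UNIV" and u: "integrable (lebesgue_on \<Omega>) u"
  shows "integrable (lebesgue_on \<Omega>) (\<lambda>y. u y *\<^sub>R grad k (x - y))"
proof -
  obtain B where B: "\<And>x. norm (grad k x) \<le> B" using test_functions_grad_bounded[OF k] by metis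
  show ?thesis
  proof (rule Bochner_Integration.integrable_bound)
    show "integrable (lebesgue_on \<Omega>) (\<lambda>y. B * \<bar>u y\<bar>)" using u by simp
    show "AE y in lebesgue_on \<Omega>. norm (u y *\<^sub>R grad k (x - y)) \<le> norm (B * \<bar>u y\<bar>)"
    proof (intro AE_I2)
      fix y
      show "norm (u y *\<^sub>R grad k (x - y)) \<le> norm (B * \<bar>u y\<bar>)"
        using mult_left_mono[OF order_trans[OF B[of "x - y"] abs_ge_self], of "\<bar>u y\<bar>"]
        by (simp add: abs_mult mult.commute)
    qed
    show "(\<lambda>y. u y *\<^sub>R grad k (x - y)) \<in> borel_measurable (lebesgue_on \<Omega>)"
      by (rule borel_measurable_scaleR[OF borel_measurable_integrable[OF u]
            shifted_measurable[OF continuous_grad[OF test_functions_smooth[OF k]]]])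
  qed
qed

text \<open>Differentiation under the integral sign: the uniform Taylor remainder contributes at
  most \<open>C * (norm h)\<^sup>2\<close> times the integral of \<open>\<bar>u\<bar>\<close>, which
  is of smaller order than \<open>norm h\<close>.\<close>

lemma mollify_has_derivative:
  fixes u :: "'a::euclidean_space \<Rightarrow> real"
  assumes k: "k \<in> test_functions UNIV" and u: "integrable (lebesgue_on \<Omega>) u"
  shows "(mollify k \<Omega> u has_derivative (\<lambda>h. (LINT y|lebesgue_on \<Omega>. u y *\<^sub>R grad k (x - y)) \<bullet> h)) (at x)"
proof -
  obtain C where C: "\<And>z h. \<bar>k (z + h) - k z - grad k z \<bullet> h\<bar> \<le> C * (norm h)\<^sup>2"
    using test_functions_Taylor[OF k] by metis
  define G where "G = (LINT y|lebesgue_on \<Omega>. u y *\<^sub>R grad k (x - y))"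
  define U where "U = (LINT y|lebesgue_on \<Omega>. \<bar>u y\<bar>)"
  note iG = mollify_grad_integrable[OF k u, of x]
  have est: "\<bar>mollify k \<Omega> u (x + h) - mollify k \<Omega> u x - G \<bullet> h\<bar> \<le> C * U * (norm h)\<^sup>2" for h
  proof -
    have i: "integrable (lebesgue_on \<Omega>) (\<lambda>y. k (z - y) * u y)" for z
      using mollify_integrable[OF k u] by simp
    have iGh: "integrable (lebesgue_on \<Omega>) (\<lambda>y. (u y *\<^sub>R grad k (x - y)) \<bullet> h)"
      using iG by (rule integrable_inner_left)
    have "mollify k \<Omega> u (x + h) - mollify k \<Omega> u x - G \<bullet> h
      = (LINT y|lebesgue_on \<Omega>. k (x + h - y) * u y - k (x - y) * u y - (u y *\<^sub>R grad k (x - y)) \<bullet> h)"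
      unfolding mollify_def G_def real_scaleR_def integral_inner_left[OF iG, symmetric]
      using i iGh by (simp del: inner_scaleR_left)
    also have "\<bar>\<dots>\<bar> \<le> (LINT y|lebesgue_on \<Omega>. C * (norm h)\<^sup>2 * \<bar>u y\<bar>)"
    proof (rule order_trans[OF integral_abs_bound integral_mono])
      fix y
      have "k (x + h - y) * u y - k (x - y) * u y - (u y *\<^sub>R grad k (x - y)) \<bullet> h
        = (k (x - y + h) - k (x - y) - grad k (x - y) \<bullet> h) * u y"
        by (simp add: algebra_simps)
      then show "\<bar>k (x + h - y) * u y - k (x - y) * u y - (u y *\<^sub>R grad k (x - y)) \<bullet> h\<bar>
          \<le> C * (norm h)\<^sup>2 * \<bar>u y\<bar>"
        using C[of "x - y" h] by (simp add: abs_mult mult_right_mono)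
    qed (use i iGh u in auto)
    finally show ?thesis by (simp add: U_def mult.commute mult.left_commute)
  qed
  have "((\<lambda>h. norm (mollify k \<Omega> u (x + h) - mollify k \<Omega> u x - G \<bullet> h) / norm h) \<longlongrightarrow> 0) (at 0)"
  proof (rule tendsto_sandwich[OF _ _ tendsto_const])
    show "\<forall>\<^sub>F h in at 0. norm (mollify k \<Omega> u (x + h) - mollify k \<Omega> u x - G \<bullet> h) / norm h \<le> C * U * norm h"
      unfolding eventually_at_filter
    proof (intro always_eventually allI impI)
      fix h :: 'a assume "h \<noteq> 0"
      then show "norm (mollify k \<Omega> u (x + h) - mollify k \<Omega> u x - G \<bullet> h) / norm h \<le> C * U * norm h"
        using est[of h] by (simp add: divide_simps power2_eq_square mult.assoc)
    qed
    show "((\<lambda>h. C * U * norm h) \<longlongrightarrow> 0) (at (0::'a))"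
      by (auto intro!: tendsto_eq_intros)
  qed auto
  then show ?thesis
    unfolding has_derivative_at G_def[symmetric] by (simp add: bounded_linear_inner_right)
qed

lemma mollify_partial:
  fixes u :: "'a::euclidean_space \<Rightarrow> real"
  assumes k: "k \<in> test_functions UNIV" and u: "integrable (lebesgue_on \<Omega>) u" and b: "b \<in> Basis"
  shows "frechet_derivative (mollify k \<Omega> u) (at x) b = mollify (\<lambda>z. frechet_derivative k (at z) b) \<Omega> u x"
proof -
  note iG = mollify_grad_integrable[OF k u, of x]
  have "frechet_derivative (mollify k \<Omega> u) (at x) b = (LINT y|lebesgue_on \<Omega>. u y *\<^sub>R grad k (x - y)) \<bullet> b"
    by (simp flip: frechet_derivative_at[OF mollify_has_derivative[OF k u]])
  also have "\<dots> = (LINT y|lebesgue_on \<Omega>. (u y *\<^sub>R grad k (x - y)) \<bullet> b)"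
    using integral_inner_left[OF iG] by simp
  finally show ?thesis by (simp add: mollify_def inner_grad[OF b] mult.commute)
qed

text \<open>A partial derivative of the mollification is the mollification with the differentiated
  kernel, again a test function. The induction over the order therefore varies the kernel, which
  need not have the sign and mass of a mollifier.\<close>

lemma mollify_smooth:
  fixes u :: "'a::euclidean_space \<Rightarrow> real"
  assumes "k \<in> test_functions UNIV" and u: "integrable (lebesgue_on \<Omega>) u"
  shows "smooth_on UNIV (mollify k \<Omega> u)"
proof -
  have "Ck_on n UNIV (mollify k \<Omega> u)" for n
    using assms(1)
  proof (induction n arbitrary: k)
    case 0
    show ?case
      unfolding Ck_on.simps
      by (intro continuous_at_imp_continuous_on ballI has_derivative_continuous[OF mollify_has_derivative[OF 0 u]])
  next
    case (Suc n)
    show ?case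
    proof (rule Ck_on_SucI[OF open_UNIV])
      show "(mollify k \<Omega> u has_derivative frechet_derivative (mollify k \<Omega> u) (at x)) (at x)" for x
        using mollify_has_derivative[OF Suc.prems u] differentiableI frechet_derivative_works by metis
      show "Ck_on n UNIV (\<lambda>x. frechet_derivative (mollify k \<Omega> u) (at x) b)" if "b \<in> Basis" for b
        using Suc.IH[OF test_functions_partial[OF Suc.prems that]] mollify_partial[OF Suc.prems u that]
        by simp
    qed
  qed
  then show ?thesis by (simp add: smooth_on_def)
qed

lemma reflect_derivative:
  assumes "smooth_on UNIV f"
  shows "((\<lambda>y. f (x - y)) has_derivative (\<lambda>h. (- grad f (x - y)) \<bullet> h)) (at y)"
proof -
  have "((\<lambda>y. f (x - y)) has_derivative (\<lambda>h. grad f (x - y) \<bullet> (- h))) (at y)"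
    by (rule has_derivative_compose[where g = f and f = "\<lambda>y. x - y" and f' = uminus])
      (auto intro!: derivative_eq_intros has_derivative_grad[OF assms])
  then show ?thesis by simp
qed

lemma test_functions_reflect:
  fixes k :: "'a::euclidean_space \<Rightarrow> real"
  assumes "k \<in> test_functions UNIV"
  shows "(\<lambda>y. k (x - y)) \<in> test_functions UNIV"
proof -
  have "Ck_on n UNIV (\<lambda>y. k (x - y))" for n
    using assms
  proof (induction n arbitrary: k)
    case 0
    show ?case
      by (auto intro!: continuous_intros continuous_on_compose2[OF test_functions_continuous[OF 0]])
  next
    case (Suc n)
    show ?case
    proof (rule Ck_on_SucI[OF open_UNIV reflect_derivative[OF test_functions_smooth[OF Suc.prems]]])
      fix b :: 'a assume b: "b \<in> Basis"
      have "Ck_on n UNIV (\<lambda>y. (-1) * frechet_derivative k (at (x - y)) b)"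
        by (rule Ck_on_mult[OF open_UNIV Ck_on_const Suc.IH[OF test_functions_partial[OF Suc.prems b]]])
      then show "Ck_on n UNIV (\<lambda>y. (- grad k (x - y)) \<bullet> b)"
        by (simp add: inner_grad[OF b])
    qed
  qed
  then have "smooth_on UNIV (\<lambda>y. k (x - y))" by (simp add: smooth_on_def)
  moreover obtain K where K: "compact K" "\<And>x. x \<notin> K \<Longrightarrow> k x = 0"
    using test_functionsE[OF assms] by metis
  moreover have "k (x - y) = 0" if "y \<notin> (\<lambda>y. x - y) ` K" for y
    using K(2)[of "x - y"] image_eqI[of y "\<lambda>y. x - y" "x - y" K] that by auto
  ultimately show ?thesis
    by (intro test_functionsI[where K = "(\<lambda>y. x - y) ` K"] compact_continuous_image continuous_intros) auto
qed

text \<open>The derivative is moved from the kernel to \<open>u\<close>. As a function of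
  \<open>y\<close> the kernel \<open>k (x - y)\<close> is a test function of the whole space but in
  general not of \<Omega>, so the zero-trace integration by parts is essential; thanks to it the
  identity holds at every \<open>x\<close>, also near and outside the boundary.\<close>

lemma grad_mollify:
  assumes \<Omega>: "open \<Omega>" and u: "u \<in> W1p0 1 \<Omega>" and D: "has_weak_gradient \<Omega> u D"
    and k: "k \<in> test_functions UNIV"
  shows "grad (mollify k \<Omega> u) x = mollify k \<Omega> D x"
proof -
  note iu = W1p0_1_integrable(1)[OF \<Omega> u D] and iD = W1p0_1_integrable(2)[OF \<Omega> u D]
  show ?thesis
  proof (rule euclidean_eqI)
    fix b :: 'a assume b: "b \<in> Basis"
    have fd: "frechet_derivative (\<lambda>y. k (x - y)) (at y) b = - frechet_derivative k (at (x - y)) b" for y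
      using inner_grad[OF b] by (simp flip: frechet_derivative_at[OF reflect_derivative[OF test_functions_smooth[OF k]]])
    have "grad (mollify k \<Omega> u) x \<bullet> b = (LINT y|lebesgue_on \<Omega>. frechet_derivative k (at (x - y)) b * u y)"
      by (simp add: inner_grad[OF b] mollify_partial[OF k iu b] mollify_def)
    also have "\<dots> = - (LINT y|lebesgue_on \<Omega>. frechet_derivative (\<lambda>y. k (x - y)) (at y) b * u y)"
      by (simp add: fd)
    also have "\<dots> = (LINT y|lebesgue_on \<Omega>. k (x - y) * (D y \<bullet> b))"
      by (simp add: W1p0_1_integration_by_parts[OF \<Omega> u D test_functions_reflect[OF k] b])
    also have "\<dots> = mollify k \<Omega> D x \<bullet> b"
      unfolding mollify_def using integral_inner_left[OF mollify_integrable[OF k iD, of x]] by simp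
    finally show "grad (mollify k \<Omega> u) x \<bullet> b = mollify k \<Omega> D x \<bullet> b" .
  qed
qed

section \<open>Bounds and convergence for mollification\<close>

lemma mollifierD:
  assumes "mollifier r k"
  shows "k \<in> test_functions UNIV" "0 \<le> k x" "r \<le> norm x \<Longrightarrow> k x = 0" "(LINT x|lborel. k x) = 1"
  using assms by (auto simp: mollifier_def)

lemma mollifier_mass:
  assumes "mollifier r k"
  shows "(LINT y|lborel. k (x - y)) = 1"
  using integral_lborel_reflect[of k x] mollifierD(4)[OF assms]
    borel_measurable_continuous_onI[OF test_functions_continuous[OF mollifierD(1)[OF assms]]] by simp

lemma mollifier_mass_le:
  assumes k: "mollifier r k" and \<Omega>: "\<Omega> \<in> sets lebesgue"
  shows "(LINT y|lebesgue_on \<Omega>. k (x - y)) \<le> 1"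
proof -
  note t = test_functions_reflect[OF mollifierD(1)[OF k], of x]
  have i: "integrable lebesgue (\<lambda>y. k (x - y))"
    using test_functions_integrable[OF t]
      integrable_completion[OF borel_measurable_integrable[OF test_functions_integrable[OF t]]] by simp
  have "(LINT y|lebesgue_on \<Omega>. k (x - y)) = (LINT y|lebesgue. indicator \<Omega> y *\<^sub>R k (x - y))"
    using \<Omega> by (simp add: integral_restrict_space)
  also have "\<dots> \<le> (LINT y|lebesgue. k (x - y))"
    using mollifierD(2)[OF k] by (intro integral_mono integrable_mult_indicator \<Omega> i) (auto simp: indicator_def)
  also have "\<dots> = (LINT y|lborel. k (x - y))"
    by (rule integral_completion[OF borel_measurable_integrable[OF test_functions_integrable[OF t]]])
  finally show ?thesis by (simp add: mollifier_mass[OF k])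
qed

lemma norm_mollify_le:
  fixes f :: "'a::euclidean_space \<Rightarrow> 'b::euclidean_space"
  assumes k: "mollifier r k" and f: "integrable (lebesgue_on \<Omega>) f" and \<Omega>: "\<Omega> \<in> sets lebesgue"
    and M: "AE y in lebesgue_on \<Omega>. norm (f y) \<le> M" "0 \<le> M"
  shows "norm (mollify k \<Omega> f x) \<le> M"
proof -
  note k1 = mollifierD(1)[OF k]
  have ik: "integrable (lebesgue_on \<Omega>) (\<lambda>y. k (x - y))"
    by (rule integrable_lebesgue_on_of_lborel[OF \<Omega> test_functions_integrable[OF test_functions_reflect[OF k1]]])
  have "norm (mollify k \<Omega> f x) \<le> (LINT y|lebesgue_on \<Omega>. norm (k (x - y) *\<^sub>R f y))"
    unfolding mollify_def by (rule integral_norm_bound)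
  also have "\<dots> \<le> (LINT y|lebesgue_on \<Omega>. M * k (x - y))"
  proof (rule integral_mono_AE)
    show "AE y in lebesgue_on \<Omega>. norm (k (x - y) *\<^sub>R f y) \<le> M * k (x - y)"
      using M(1) by eventually_elim (simp add: mollifierD(2)[OF k] mult.commute mult_right_mono)
  qed (use integrable_norm[OF mollify_integrable[OF k1 f, of x]] ik in auto)
  also have "\<dots> \<le> M * 1"
    using mollifier_mass_le[OF k \<Omega>, of x] M(2) ik by (simp add: mult_left_le)
  finally show ?thesis by simp
qed

lemma mollify_nonneg:
  fixes f :: "'a::euclidean_space \<Rightarrow> real"
  assumes "mollifier r k" "AE y in lebesgue_on \<Omega>. 0 \<le> f y"
  shows "0 \<le> mollify k \<Omega> f x"
  unfolding mollify_def
proof (rule integral_nonneg_AE)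
  show "AE y in lebesgue_on \<Omega>. 0 \<le> k (x - y) *\<^sub>R f y"
    using assms(2) by eventually_elim (simp add: mollifierD(2)[OF assms(1)])
qed

lemma mollify_eq_0:
  assumes "mollifier r k" "\<And>y. y \<in> \<Omega> \<Longrightarrow> r \<le> norm (x - y)"
  shows "mollify k \<Omega> f x = 0"
proof -
  have "mollify k \<Omega> f x = (LINT y|lebesgue_on \<Omega>. 0)"
    unfolding mollify_def
    by (rule Bochner_Integration.integral_cong) (use assms(2) mollifierD(3)[OF assms(1)] in auto)
  then show ?thesis by simp
qed

lemma mollify_continuous:
  fixes f :: "'a::euclidean_space \<Rightarrow> 'b::euclidean_space"
  assumes k: "k \<in> test_functions UNIV" and f: "integrable (lebesgue_on \<Omega>) f"
  shows "continuous_on UNIV (mollify k \<Omega> f)"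
proof (subst continuous_on_componentwise, intro ballI)
  fix b :: 'b assume "b \<in> Basis"
  have "mollify k \<Omega> f x \<bullet> b = mollify k \<Omega> (\<lambda>y. f y \<bullet> b) x" for x
    unfolding mollify_def using integral_inner_left[OF mollify_integrable[OF k f, of x]] by simp
  moreover have "continuous_on UNIV (mollify k \<Omega> (\<lambda>y. f y \<bullet> b))"
    by (rule smooth_on_continuous[OF mollify_smooth[OF k]]) (use f in simp)
  ultimately show "continuous_on UNIV (\<lambda>x. mollify k \<Omega> f x \<bullet> b)" by simp
qed

text \<open>Fubini, after the outer integral has been enlarged from \<Omega> to the whole space:
  there the kernel has mass 1 for every fixed \<open>y\<close>. The inner variable keeps the
  completed measure, since \<open>f\<close> is only Lebesgue measurable.\<close>

lemma mollify_L1_le: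
  fixes f :: "'a::euclidean_space \<Rightarrow> 'b::euclidean_space"
  assumes k: "mollifier r k" and f: "integrable (lebesgue_on \<Omega>) f" and \<Omega>: "open \<Omega>" "bounded \<Omega>"
  shows "integrable (lebesgue_on \<Omega>) (mollify k \<Omega> f)"
    and "(LINT x|lebesgue_on \<Omega>. norm (mollify k \<Omega> f x)) \<le> (LINT x|lebesgue_on \<Omega>. norm (f x))"
proof -
  note k1 = mollifierD(1)[OF k]
  have \<Omega>': "\<Omega> \<in> sets lebesgue" "\<Omega> \<in> lmeasurable" using \<Omega> by (auto simp: lmeasurable_open)
  interpret fin: finite_measure "lebesgue_on \<Omega>" using \<Omega>'(2) by (rule finite_measure_lebesgue_on)
  interpret pair_sigma_finite lborel "lebesgue_on \<Omega>" ..
  have [measurable]: "k \<in> borel_measurable borel"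
    using test_functions_continuous[OF k1] by (rule borel_measurable_continuous_onI)
  have [measurable]: "f \<in> borel_measurable (lebesgue_on \<Omega>)" using f by auto
  have id: "(\<lambda>y. y) \<in> measurable (lebesgue_on \<Omega>) borel"
    by (rule continuous_imp_lebesgue_on_measurable) simp
  have sub [measurable]: "(\<lambda>z. fst z - snd z) \<in> measurable (lborel \<Otimes>\<^sub>M lebesgue_on \<Omega>) borel"
    by (rule borel_measurable_diff) (use measurable_compose[OF measurable_snd id] in auto)
  have meas: "(\<lambda>(x, y). ennreal (k (x - y) * norm (f y))) \<in> borel_measurable (lborel \<Otimes>\<^sub>M lebesgue_on \<Omega>)"
    unfolding case_prod_beta by measurable
  have mm: "mollify k \<Omega> f \<in> borel_measurable borel"
    by (rule borel_measurable_continuous_onI[OF mollify_continuous[OF k1 f]])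
  have kint: "(\<integral>\<^sup>+x. ennreal (k (x - y)) \<partial>lborel) = 1" for y
  proof -
    have "(\<integral>\<^sup>+x. ennreal (k (x - y)) \<partial>lborel) = (\<integral>\<^sup>+x. ennreal (k (- y + x)) \<partial>lborel)"
      by (simp add: add.commute)
    also have "\<dots> = (\<integral>\<^sup>+x. ennreal (k x) \<partial>distr lborel borel ((+) (- y)))"
      by (subst nn_integral_distr) auto
    also have "\<dots> = ennreal (LINT x|lborel. k x)"
      using mollifierD(2)[OF k] by (simp add: lborel_distr_plus nn_integral_eq_integral[OF test_functions_integrable[OF k1]])
    finally show ?thesis by (simp add: mollifierD(4)[OF k])
  qed
  have "(\<integral>\<^sup>+x. norm (mollify k \<Omega> f x) \<partial>lebesgue_on \<Omega>) = (\<integral>\<^sup>+x. ennreal (norm (mollify k \<Omega> f x)) * indicator \<Omega> x \<partial>lebesgue)"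
    using \<Omega>' by (simp add: nn_integral_restrict_space)
  also have "\<dots> \<le> (\<integral>\<^sup>+x. norm (mollify k \<Omega> f x) \<partial>lebesgue)"
    by (rule nn_integral_mono) (auto simp: indicator_def)
  also have "\<dots> = (\<integral>\<^sup>+x. norm (mollify k \<Omega> f x) \<partial>lborel)"
    by (rule nn_integral_completion)
  also have "\<dots> \<le> (\<integral>\<^sup>+x. \<integral>\<^sup>+y. ennreal (k (x - y) * norm (f y)) \<partial>lebesgue_on \<Omega> \<partial>lborel)"
  proof (rule nn_integral_mono)
    fix x
    show "ennreal (norm (mollify k \<Omega> f x)) \<le> (\<integral>\<^sup>+y. ennreal (k (x - y) * norm (f y)) \<partial>lebesgue_on \<Omega>)"
      using integral_norm_bound_ennreal[OF mollify_integrable[OF k1 f, of x]] mollifierD(2)[OF k]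
      by (simp add: mollify_def)
  qed
  also have "\<dots> = (\<integral>\<^sup>+y. \<integral>\<^sup>+x. ennreal (k (x - y) * norm (f y)) \<partial>lborel \<partial>lebesgue_on \<Omega>)"
    by (rule Fubini'[OF meas, symmetric])
  also have "\<dots> = (\<integral>\<^sup>+y. ennreal (norm (f y)) \<partial>lebesgue_on \<Omega>)"
    using mollifierD(2)[OF k] kint by (simp add: ennreal_mult'' nn_integral_multc)
  finally have le: "(\<integral>\<^sup>+x. norm (mollify k \<Omega> f x) \<partial>lebesgue_on \<Omega>) \<le> (\<integral>\<^sup>+y. ennreal (norm (f y)) \<partial>lebesgue_on \<Omega>)" .
  have fin: "(\<integral>\<^sup>+y. ennreal (norm (f y)) \<partial>lebesgue_on \<Omega>) = ennreal (LINT x|lebesgue_on \<Omega>. norm (f x))"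
    using f by (intro nn_integral_eq_integral) auto
  show i: "integrable (lebesgue_on \<Omega>) (mollify k \<Omega> f)"
    unfolding integrable_iff_bounded
    using le fin continuous_imp_lebesgue_on_measurable[OF mollify_continuous[OF k1 f]]
    by (auto intro: le_less_trans)
  show "(LINT x|lebesgue_on \<Omega>. norm (mollify k \<Omega> f x)) \<le> (LINT x|lebesgue_on \<Omega>. norm (f x))"
    using le i unfolding fin by (simp add: nn_integral_eq_integral)
qed

text \<open>Since \<psi> vanishes off \<Omega>, the integral may run over the whole space, where the
  kernel has full mass. The error is then an average of \<open>\<psi> y - \<psi> x\<close> over
  points at distance less than \<open>r\<close>. Without vanishing boundary values the kernel would
  lose mass near the boundary.\<close>

lemma mollify_Lipschitz_approx:
  fixes \<psi> :: "'a::euclidean_space \<Rightarrow> 'b::euclidean_space"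
  assumes k: "mollifier r k" and \<Omega>: "\<Omega> \<in> sets lebesgue"
    and lip: "\<And>x y. norm (\<psi> x - \<psi> y) \<le> C * norm (x - y)" and z: "\<And>x. x \<notin> \<Omega> \<Longrightarrow> \<psi> x = 0"
  shows "norm (mollify k \<Omega> \<psi> x - \<psi> x) \<le> C * r"
proof -
  note k1 = mollifierD(1)[OF k]
  obtain b :: 'a where b: "b \<in> Basis" using nonempty_Basis by blast
  have C0: "C \<ge> 0"
    using order_trans[OF norm_ge_zero lip[of b 0]] b by simp
  have cont: "continuous_on UNIV \<psi>"
    by (rule lipschitz_on_continuous_on[of C], rule lipschitz_onI)
      (use lip C0 in \<open>auto simp: dist_norm\<close>)
  note kr = test_functions_reflect[OF k1, of x]
  note kc = test_functions_continuous[OF kr]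
  obtain K where K: "compact K" "\<And>y. y \<notin> K \<Longrightarrow> k (x - y) = 0"
    using test_functionsE[OF kr] by metis
  have i: "integrable lborel (\<lambda>y. k (x - y) *\<^sub>R \<psi> y)" "integrable lborel (\<lambda>y. k (x - y) *\<^sub>R \<psi> x)"
    by (rule integrable_continuous_compact_support[OF _ K(1)]; use K(2) kc cont in \<open>auto intro!: continuous_intros\<close>)+
  have "mollify k \<Omega> \<psi> x = (LINT y|lborel. k (x - y) *\<^sub>R \<psi> y)"
    unfolding mollify_def
    by (rule integral_lebesgue_on_eq_lborel[OF \<Omega> borel_measurable_integrable[OF i(1), simplified]])
      (use z in auto)
  moreover have "\<psi> x = (LINT y|lborel. k (x - y) *\<^sub>R \<psi> x)"
    using mollifier_mass[OF k, of x] test_functions_integrable[OF kr] by simp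
  ultimately have "mollify k \<Omega> \<psi> x - \<psi> x = (LINT y|lborel. k (x - y) *\<^sub>R \<psi> y - k (x - y) *\<^sub>R \<psi> x)"
    using i by simp
  also have "norm \<dots> \<le> (LINT y|lborel. (C * r) * k (x - y))"
  proof (rule order_trans[OF integral_norm_bound integral_mono])
    fix y
    show "norm (k (x - y) *\<^sub>R \<psi> y - k (x - y) *\<^sub>R \<psi> x) \<le> (C * r) * k (x - y)"
    proof (cases "r \<le> norm (x - y)")
      case True
      then show ?thesis using mollifierD(3)[OF k] by simp
    next
      case False
      then have "C * norm (y - x) \<le> C * r" using C0 by (intro mult_left_mono) (auto simp: norm_minus_commute)
      then have "norm (\<psi> y - \<psi> x) \<le> C * r" using lip[of y x] by linarith
      then show ?thesis
        using mollifierD(2)[OF k, of "x - y"] mult_left_mono[of "norm (\<psi> y - \<psi> x)" "C * r" "k (x - y)"]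
        by (simp add: mult.commute[of "C * r"] flip: scaleR_diff_right)
    qed
  qed (use i test_functions_integrable[OF kr] in auto)
  also have "\<dots> = C * r" using mollifier_mass[OF k, of x] by simp
  finally show ?thesis .
qed

text \<open>Since mollification contracts the \<open>L\<^sup>1\<close> norm, convergence only has to be checked on Lipschitz
  approximants of \<open>f\<close>. The test functions that define zero trace provide such approximants, both
  of the function and of its weak gradient.\<close>

lemma mollify_tendsto_L1:
  fixes f :: "'a::euclidean_space \<Rightarrow> 'b::euclidean_space"
  assumes \<Omega>: "open \<Omega>" "bounded \<Omega>" and f: "integrable (lebesgue_on \<Omega>) f"
    and k: "\<And>n. mollifier (r n) (k n)" and r: "r \<longlonglongrightarrow> 0"
    and \<psi>: "\<And>m. integrable (lebesgue_on \<Omega>) (\<psi> m)"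
    and lip: "\<And>m x y. norm (\<psi> m x - \<psi> m y) \<le> C m * norm (x - y)" and z: "\<And>m x. x \<notin> \<Omega> \<Longrightarrow> \<psi> m x = 0"
    and lim: "(\<lambda>m::nat. LINT x|lebesgue_on \<Omega>. norm (f x - \<psi> m x)) \<longlonglongrightarrow> 0"
  shows "(\<lambda>n::nat. LINT x|lebesgue_on \<Omega>. norm (mollify (k n) \<Omega> f x - f x)) \<longlonglongrightarrow> 0"
proof -
  have \<Omega>': "\<Omega> \<in> sets lebesgue" "\<Omega> \<in> lmeasurable" using \<Omega> by (auto simp: lmeasurable_open)
  interpret fin: finite_measure "lebesgue_on \<Omega>" using \<Omega>'(2) by (rule finite_measure_lebesgue_on)
  define V where "V = measure (lebesgue_on \<Omega>) \<Omega>"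
  \<comment> \<open>The factor 2 counts \<open>f - \<psi> m\<close> once as it is and once
    mollified. In the limit \<open>m\<close> is fixed first and \<open>n\<close> is chosen
    afterwards, because \<open>C m\<close> is not controlled as \<open>m\<close> grows.\<close>
  have le: "(LINT x|lebesgue_on \<Omega>. norm (mollify (k n) \<Omega> f x - f x))
    \<le> 2 * (LINT x|lebesgue_on \<Omega>. norm (f x - \<psi> m x)) + C m * r n * V" for m n
  proof -
    have id: "integrable (lebesgue_on \<Omega>) (\<lambda>x. f x - \<psi> m x)" using f \<psi> by simp
    note im = mollify_L1_le[OF k id \<Omega>]
    have split: "mollify (k n) \<Omega> f x = mollify (k n) \<Omega> (\<lambda>x. f x - \<psi> m x) x + mollify (k n) \<Omega> (\<psi> m) x" for x
      unfolding mollify_def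
      using mollify_integrable[OF mollifierD(1)[OF k] f] mollify_integrable[OF mollifierD(1)[OF k] \<psi>]
      by (simp add: scaleR_diff_right)
    have "(LINT x|lebesgue_on \<Omega>. norm (mollify (k n) \<Omega> f x - f x))
      \<le> (LINT x|lebesgue_on \<Omega>. norm (mollify (k n) \<Omega> (\<lambda>x. f x - \<psi> m x) x) + norm (f x - \<psi> m x) + C m * r n)"
    proof (rule integral_mono)
      fix x
      have "mollify (k n) \<Omega> f x - f x = mollify (k n) \<Omega> (\<lambda>x. f x - \<psi> m x) x - (f x - \<psi> m x)
          + (mollify (k n) \<Omega> (\<psi> m) x - \<psi> m x)"
        by (simp add: split)
      also have "norm \<dots> \<le> norm (mollify (k n) \<Omega> (\<lambda>x. f x - \<psi> m x) x) + norm (f x - \<psi> m x) + C m * r n"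
        using mollify_Lipschitz_approx[OF k \<Omega>'(1) lip z, where x = x]
        by (intro order_trans[OF norm_triangle_ineq] add_mono norm_triangle_ineq4) auto
      finally show "norm (mollify (k n) \<Omega> f x - f x)
        \<le> norm (mollify (k n) \<Omega> (\<lambda>x. f x - \<psi> m x) x) + norm (f x - \<psi> m x) + C m * r n" .
    qed (use im(1) id f mollify_L1_le(1)[OF k f \<Omega>] in auto)
    also have "\<dots> = (LINT x|lebesgue_on \<Omega>. norm (mollify (k n) \<Omega> (\<lambda>x. f x - \<psi> m x) x))
        + (LINT x|lebesgue_on \<Omega>. norm (f x - \<psi> m x)) + C m * r n * V"
      using im(1) id by (simp add: V_def space_restrict_space mult.commute)
    finally show ?thesis using im(2)[of n] by linarith
  qed
  show ?thesis
  proof (rule LIMSEQ_I)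
    fix e :: real assume e: "e > 0"
    obtain m where m: "(LINT x|lebesgue_on \<Omega>. norm (f x - \<psi> m x)) < e / 4"
      using order_tendstoD(2)[OF lim, of "e/4"] e by (auto simp: eventually_sequentially)
    have "(\<lambda>n. C m * r n * V) \<longlonglongrightarrow> C m * 0 * V" by (intro tendsto_intros r)
    then obtain N where N: "\<And>n. n \<ge> N \<Longrightarrow> C m * r n * V < e / 2"
      using order_tendstoD(2)[of "\<lambda>n. C m * r n * V" 0 sequentially "e/2"] e by (auto simp: eventually_sequentially)
    have "norm ((LINT x|lebesgue_on \<Omega>. norm (mollify (k n) \<Omega> f x - f x)) - 0) < e" if "n \<ge> N" for n
    proof -
      have "0 \<le> (LINT x|lebesgue_on \<Omega>. norm (mollify (k n) \<Omega> f x - f x))"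
        by (rule Bochner_Integration.integral_nonneg) simp
      then show ?thesis using le[of n m] m N[OF that] by simp
    qed
    then show "\<exists>N. \<forall>n\<ge>N. norm ((LINT x|lebesgue_on \<Omega>. norm (mollify (k n) \<Omega> f x - f x)) - 0) < e" by blast
  qed
qed

section \<open>Approximation of positive Lipschitz functions with zero trace\<close>

text \<open>Moving from \<open>x\<close> against \<open>e\<close> does not change the projection on
  which \<gamma> is evaluated, and it leads strictly below the graph, into an open set that misses
  \<Omega>. For a domain with a slit the conclusion would be false.\<close>

lemma smooth_boundary_exterior:
  fixes \<Omega> :: "'a::euclidean_space set"
  assumes \<Omega>: "open \<Omega>" "smooth_boundary \<Omega>" and x: "x \<in> frontier \<Omega>"
  shows "x \<in> closure (interior (- \<Omega>))"
proof -
  obtain r e \<gamma> where r: "r > 0" and e: "norm e = 1" and \<gamma>: "smooth_on UNIV (\<gamma> :: 'a \<Rightarrow> real)"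
    and eq: "\<Omega> \<inter> ball x r = {y \<in> ball x r. y \<bullet> e > \<gamma> (y - (y \<bullet> e) *\<^sub>R e)}"
    using \<Omega>(2) x unfolding smooth_boundary_def by blast
  have ee: "e \<bullet> e = 1" using e by (simp add: dot_square_norm)
  have c: "continuous_on UNIV (\<lambda>y. \<gamma> (y - (y \<bullet> e) *\<^sub>R e))"
    by (intro continuous_on_compose2[OF smooth_on_continuous[OF \<gamma>]] continuous_intros) auto
  define E where "E = ball x r \<inter> {y. y \<bullet> e < \<gamma> (y - (y \<bullet> e) *\<^sub>R e)}"
  have "open E"
    unfolding E_def by (intro open_Int open_ball open_Collect_less continuous_intros c)
  moreover have "E \<subseteq> - \<Omega>"
  proof
    fix y assume y: "y \<in> E"
    show "y \<in> - \<Omega>"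
    proof
      assume "y \<in> \<Omega>"
      then have "y \<in> \<Omega> \<inter> ball x r" using y by (auto simp: E_def)
      then show False using y unfolding eq by (auto simp: E_def)
    qed
  qed
  ultimately have EI: "E \<subseteq> interior (- \<Omega>)" by (rule interior_maximal[rotated])
  have "x \<notin> \<Omega>" using \<Omega>(1) x by (auto simp: frontier_def interior_open)
  \<comment> \<open>A point strictly above the graph would belong to the open set \<Omega>, which
    contains none of its frontier points.\<close>
  have xe: "x \<bullet> e \<le> \<gamma> (x - (x \<bullet> e) *\<^sub>R e)"
  proof (rule ccontr)
    assume "\<not> x \<bullet> e \<le> \<gamma> (x - (x \<bullet> e) *\<^sub>R e)"
    then have "x \<in> {y \<in> ball x r. y \<bullet> e > \<gamma> (y - (y \<bullet> e) *\<^sub>R e)}" using r by simp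
    then show False using \<open>x \<notin> \<Omega>\<close> unfolding eq[symmetric] by blast
  qed
  have "\<exists>y\<in>interior (- \<Omega>). dist y x < \<delta>" if \<delta>: "\<delta> > 0" for \<delta>
  proof
    define s where "s = min \<delta> r / 2"
    have s: "0 < s" "s < \<delta>" "s < r" using \<delta> r by (auto simp: s_def)
    have "(x - s *\<^sub>R e) \<bullet> e = x \<bullet> e - s" by (simp add: inner_diff_left ee)
    moreover have "x - s *\<^sub>R e - (x \<bullet> e - s) *\<^sub>R e = x - (x \<bullet> e) *\<^sub>R e" by (simp add: algebra_simps)
    moreover have "y \<in> E" if y: "y \<bullet> e = x \<bullet> e - s" "y - (y \<bullet> e) *\<^sub>R e = x - (x \<bullet> e) *\<^sub>R e" "dist x y < r" for y
      unfolding E_def Int_iff mem_Collect_eq y(2) using y(1,3) xe s(1) by simp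
    moreover have "dist x (x - s *\<^sub>R e) < r" using s e by (simp add: dist_norm)
    ultimately have "x - s *\<^sub>R e \<in> E" by metis
    then show "x - s *\<^sub>R e \<in> interior (- \<Omega>)" by (rule subsetD[OF EI])
    show "dist (x - s *\<^sub>R e) x < \<delta>" using s e by (simp add: dist_norm)
  qed
  then show ?thesis by (simp add: closure_approachable)
qed

text \<open>Near any point outside \<Omega> there is a point \<open>z\<close> with a whole ball
  outside \<Omega>; the mollification is exactly zero at \<open>z\<close> once the kernel radius is
  smaller than that ball. The Lipschitz bound, which is common to all \<open>n\<close>, carries
  smallness to the neighbourhood, and compactness makes it uniform.\<close>

lemma mollify_small_outside:
  fixes u :: "'a::euclidean_space \<Rightarrow> real"
  assumes \<Omega>: "open \<Omega>" "bounded \<Omega>" "smooth_boundary \<Omega>"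
    and k: "\<And>n. mollifier (r n) (k n)" and r: "r \<longlonglongrightarrow> 0"
    and lip: "\<And>n x y. \<bar>mollify (k n) \<Omega> u x - mollify (k n) \<Omega> u y\<bar> \<le> M * norm (x - y)"
    and e: "e > 0"
  shows "\<forall>\<^sub>F n in sequentially. \<forall>x. x \<notin> \<Omega> \<longrightarrow> \<bar>mollify (k n) \<Omega> u x\<bar> < e"
proof -
  obtain R where R: "\<And>x. x \<in> \<Omega> \<Longrightarrow> norm x \<le> R" using \<Omega>(2) bounded_iff by metis
  have M: "0 \<le> M"
  proof -
    obtain b :: 'a where b: "b \<in> Basis" using nonempty_Basis by blast
    show ?thesis using order_trans[OF abs_ge_zero lip[of 0 b 0]] b by simp
  qed
  \<comment> \<open>A point of \<open>ball x \<sigma>\<close> is at distance less than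
    \<open>2 * \<sigma>\<close> from the exterior point chosen near \<open>x\<close>. The summand 1
    covers \<open>M = 0\<close>.\<close>
  define \<sigma> where "\<sigma> = e / (4 * (M + 1))"
  have \<sigma>: "\<sigma> > 0" using e M by (simp add: \<sigma>_def)
  have M\<sigma>: "M * (2 * \<sigma>) < e"
  proof -
    have "(4 * (M + 1)) * \<sigma> = e" using M by (simp add: \<sigma>_def)
    then have "M * (2 * \<sigma>) = e - (2 * (M * \<sigma>) + 4 * \<sigma>)" by (simp add: algebra_simps)
    moreover have "0 \<le> M * \<sigma>" using M \<sigma> by simp
    ultimately show ?thesis using \<sigma> by linarith
  qed
  \<comment> \<open>Beyond radius \<open>R + 1\<close> the mollification vanishes as soon as the
    kernel radius is below 1, so only this compact part of the complement needs an argument.\<close>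
  define K where "K = cball 0 (R + 1) - \<Omega>"
  have K: "compact K" unfolding K_def using \<Omega>(1) by (intro compact_diff compact_cball)
  have loc: "\<forall>\<^sub>F n in sequentially. \<forall>y\<in>ball x \<sigma>. \<bar>mollify (k n) \<Omega> u y\<bar> < e" if x: "x \<in> K" for x
  proof -
    have "x \<in> closure (interior (- \<Omega>))"
    proof (cases "x \<in> closure \<Omega>")
      case True
      then have "x \<in> frontier \<Omega>" using x \<Omega>(1) by (auto simp: K_def frontier_def interior_open)
      then show ?thesis by (rule smooth_boundary_exterior[OF \<Omega>(1,3)])
    next
      case False
      then show ?thesis using closure_subset[of "- closure \<Omega>"] by (auto simp: interior_complement)
    qed
    then obtain z where z: "z \<in> interior (- \<Omega>)" "dist z x < \<sigma>"
      using \<sigma> by (auto simp: closure_approachable)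
    then obtain \<rho> where \<rho>: "\<rho> > 0" "ball z \<rho> \<subseteq> - \<Omega>" by (auto simp: mem_interior)
    have "\<forall>\<^sub>F n in sequentially. r n < \<rho>" using order_tendstoD(2)[OF r \<rho>(1)] .
    then show ?thesis
    proof eventually_elim
      case (elim n)
      show ?case
      proof
        fix y assume y: "y \<in> ball x \<sigma>"
        have "mollify (k n) \<Omega> u z = 0"
        proof (rule mollify_eq_0[OF k])
          fix w assume "w \<in> \<Omega>"
          then have "w \<notin> ball z \<rho>" using \<rho>(2) by auto
          then show "r n \<le> norm (z - w)" using elim by (simp add: dist_norm)
        qed
        then have "\<bar>mollify (k n) \<Omega> u y\<bar> \<le> M * norm (y - z)" using lip[of n y z] by simp
        also have "\<dots> \<le> M * (2 * \<sigma>)"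
        proof (rule mult_left_mono[OF _ M])
          have "dist y z \<le> dist x y + dist z x" by (metis dist_commute dist_triangle add.commute)
          then show "norm (y - z) \<le> 2 * \<sigma>" using y z(2) by (simp add: dist_norm)
        qed
        finally show "\<bar>mollify (k n) \<Omega> u y\<bar> < e" using M\<sigma> by linarith
      qed
    qed
  qed
  obtain F where F: "F \<subseteq> K" "finite F" "K \<subseteq> (\<Union>x\<in>F. ball x \<sigma>)"
  proof (rule compactE_image[OF K, of K "\<lambda>x. ball x \<sigma>"])
    show "K \<subseteq> (\<Union>x\<in>K. ball x \<sigma>)" using \<sigma> by auto
  qed auto
  have "\<forall>\<^sub>F n in sequentially. \<forall>x\<in>F. \<forall>y\<in>ball x \<sigma>. \<bar>mollify (k n) \<Omega> u y\<bar> < e"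
    using F(1,2) loc by (intro eventually_ball_finite) auto
  moreover have "\<forall>\<^sub>F n in sequentially. r n < 1" using order_tendstoD(2)[OF r, of 1] by simp
  ultimately show ?thesis
  proof eventually_elim
    case (elim n)
    show ?case
    proof (intro allI impI)
      fix x assume x: "x \<notin> \<Omega>"
      show "\<bar>mollify (k n) \<Omega> u x\<bar> < e"
      proof (cases "norm x \<le> R + 1")
        case True
        then have "x \<in> K" using x by (simp add: K_def)
        then show ?thesis using F(3) elim(1) by auto
      next
        case False
        have "mollify (k n) \<Omega> u x = 0"
        proof (rule mollify_eq_0[OF k])
          fix y assume "y \<in> \<Omega>"
          then have "norm y \<le> R" by (rule R)
          then show "r n \<le> norm (x - y)" using elim(2) False norm_triangle_ineq2[of x y] by linarith
        qed
        then show ?thesis using e by simp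
      qed
    qed
  qed
qed

text \<open>For \<open>s > \<delta>\<close> this is \<open>(s - \<delta>) exp (- \<delta> / (s - \<delta>))\<close>: a smooth, 1-Lipschitz function that vanishes
  for \<open>s \<le> \<delta>\<close> and tends to \<open>s\<close> with derivative tending to 1 as \<open>\<delta> \<rightarrow> 0\<close>.\<close>

definition trunc :: "real \<Rightarrow> real \<Rightarrow> real" where
  "trunc \<delta> s = \<delta> * flat 1 (s / \<delta> - 1)"

lemma smooth_on_trunc:
  assumes "\<delta> > 0"
  shows "smooth_on UNIV (trunc \<delta>)"
proof -
  have "smooth_on UNIV (\<lambda>s::real. (s \<bullet> 1) * (1 / \<delta>) - 1)"
    by (intro smooth_on_diff smooth_on_mult smooth_on_inner smooth_on_const open_UNIV)
  then have "smooth_on UNIV (\<lambda>s::real. s / \<delta> - 1)" by simp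
  then have "smooth_on UNIV (\<lambda>s. flat 1 (s / \<delta> - 1))"
    by (rule smooth_on_compose[OF open_UNIV open_UNIV smooth_on_flat]) auto
  then show ?thesis unfolding trunc_def[abs_def]
    by (intro smooth_on_mult smooth_on_const open_UNIV)
qed

lemma trunc_has_derivative:
  assumes "\<delta> > 0"
  shows "(trunc \<delta> has_real_derivative flat 0 (s / \<delta> - 1) + flat (-1) (s / \<delta> - 1)) (at s)"
proof -
  have "((\<lambda>s. \<delta> * flat 1 (s / \<delta> - 1)) has_real_derivative
    \<delta> * ((1 * flat (1 - 1) (s / \<delta> - 1) + flat (1 - 2) (s / \<delta> - 1)) * (1 / \<delta>))) (at s)"
    using assms by (auto intro!: derivative_eq_intros DERIV_chain2[OF flat_has_derivative])
  then show ?thesis using assms unfolding trunc_def[abs_def] by simp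
qed

text \<open>For positive \<open>t\<close> the sum is \<open>(1 + 1 / t) * exp (- 1 / t)\<close>, and
  the upper bound is \<open>1 + s \<le> exp s\<close> for \<open>s = 1 / t\<close>. Truncation thus
  never increases the norm of a gradient.\<close>

lemma trunc_derivative_bounds:
  "0 \<le> flat 0 t + flat (-1) t" "flat 0 t + flat (-1) t \<le> 1"
proof -
  show "0 \<le> flat 0 t + flat (-1) t" by (auto simp: flat_def)
  show "flat 0 t + flat (-1) t \<le> 1"
  proof (cases "t > 0")
    case True
    have "flat 0 t + flat (-1) t = (1 + 1 / t) / exp (1 / t)"
      using True by (simp add: flat_def powr_minus exp_minus divide_simps)
    also have "\<dots> \<le> 1" using exp_ge_add_one_self[of "1 / t"] by simp
    finally show ?thesis .
  qed (simp add: flat_def)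
qed

lemma trunc_bounds:
  assumes "\<delta> > 0"
  shows "0 \<le> trunc \<delta> s" "s \<ge> 0 \<Longrightarrow> trunc \<delta> s \<le> s" "s \<le> \<delta> \<Longrightarrow> trunc \<delta> s = 0"
proof -
  show "0 \<le> trunc \<delta> s" using assms by (auto simp: trunc_def flat_def)
  show "s \<le> \<delta> \<Longrightarrow> trunc \<delta> s = 0" using assms by (auto simp: trunc_def flat_def divide_simps)
  show "trunc \<delta> s \<le> s" if "s \<ge> 0"
  proof (cases "s / \<delta> - 1 > 0")
    case True
    then have "flat 1 (s / \<delta> - 1) \<le> s / \<delta> - 1"
      by (simp add: flat_def mult_left_le)
    then have "trunc \<delta> s \<le> \<delta> * (s / \<delta> - 1)" using assms unfolding trunc_def by (intro mult_left_mono) auto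
    also have "\<dots> \<le> s" using assms by (simp add: field_simps)
    finally show ?thesis .
  qed (use that in \<open>simp add: trunc_def flat_def\<close>)
qed

text \<open>With a positive limit \<open>l\<close> the argument of \<open>flat\<close> tends to
  infinity: its reciprocal is \<open>\<delta> n / (s n - \<delta> n)\<close>. This is where
  positivity of the solutions makes the gradients of the truncated functions converge.\<close>

lemma trunc_tendsto:
  assumes \<delta>: "\<And>n. \<delta> n > 0" "\<delta> \<longlonglongrightarrow> 0" and s: "s \<longlonglongrightarrow> l" "l > 0"
  shows "(\<lambda>n. trunc (\<delta> n) (s n)) \<longlonglongrightarrow> l"
    and "(\<lambda>n. flat 0 (s n / \<delta> n - 1) + flat (-1) (s n / \<delta> n - 1)) \<longlonglongrightarrow> 1"
proof -
  have d: "(\<lambda>n. s n - \<delta> n) \<longlonglongrightarrow> l" using tendsto_diff[OF s(1) \<delta>(2)] by simp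
  have ev: "\<forall>\<^sub>F n in sequentially. s n - \<delta> n > 0" using order_tendstoD(1)[OF d s(2)] .
  have q: "(\<lambda>n. \<delta> n / (s n - \<delta> n)) \<longlonglongrightarrow> 0" using tendsto_divide[OF \<delta>(2) d] s(2) by simp
  have e: "(\<lambda>n. exp (- (\<delta> n / (s n - \<delta> n)))) \<longlonglongrightarrow> 1"
    using tendsto_exp[OF tendsto_minus[OF q]] by simp
  have "(\<lambda>n. (s n - \<delta> n) * exp (- (\<delta> n / (s n - \<delta> n)))) \<longlonglongrightarrow> l" using tendsto_mult[OF d e] by simp
  then show "(\<lambda>n. trunc (\<delta> n) (s n)) \<longlonglongrightarrow> l"
  proof (rule Lim_transform_eventually)
    show "\<forall>\<^sub>F n in sequentially. (s n - \<delta> n) * exp (- (\<delta> n / (s n - \<delta> n))) = trunc (\<delta> n) (s n)"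
      using ev
    proof eventually_elim
      case (elim n)
      then have "s n / \<delta> n - 1 > 0" using \<delta>(1)[of n] by (simp add: field_simps)
      moreover have "s n / \<delta> n - 1 = (s n - \<delta> n) / \<delta> n" using \<delta>(1)[of n] by (simp add: field_simps)
      ultimately show ?case using \<delta>(1)[of n] elim by (simp add: trunc_def flat_def)
    qed
  qed
  have "(\<lambda>n. exp (- (\<delta> n / (s n - \<delta> n))) + \<delta> n / (s n - \<delta> n) * exp (- (\<delta> n / (s n - \<delta> n)))) \<longlonglongrightarrow> 1"
    using tendsto_add[OF e tendsto_mult[OF q e]] by simp
  then show "(\<lambda>n. flat 0 (s n / \<delta> n - 1) + flat (-1) (s n / \<delta> n - 1)) \<longlonglongrightarrow> 1"
  proof (rule Lim_transform_eventually)
    show "\<forall>\<^sub>F n in sequentially. exp (- (\<delta> n / (s n - \<delta> n))) + \<delta> n / (s n - \<delta> n) * exp (- (\<delta> n / (s n - \<delta> n)))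
      = flat 0 (s n / \<delta> n - 1) + flat (-1) (s n / \<delta> n - 1)"
      using ev
    proof eventually_elim
      case (elim n)
      then have "s n / \<delta> n - 1 > 0" using \<delta>(1)[of n] by (simp add: field_simps)
      moreover have "s n / \<delta> n - 1 = (s n - \<delta> n) / \<delta> n" using \<delta>(1)[of n] by (simp add: field_simps)
      ultimately show ?case using \<delta>(1)[of n] elim by (simp add: flat_def powr_minus)
    qed
  qed
qed

lemma grad_compose:
  assumes f: "smooth_on UNIV f" and h: "(h has_real_derivative h') (at (f x))"
  shows "grad (\<lambda>x. h (f x)) x = h' *\<^sub>R grad f x"
proof (rule grad_unique)
  have "((\<lambda>x. h (f x)) has_derivative (\<lambda>v. h' * (grad f x \<bullet> v))) (at x)"
    by (rule has_derivative_compose[OF has_derivative_grad[OF f]])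
      (use h in \<open>simp add: has_field_derivative_def\<close>)
  then show "((\<lambda>x. h (f x)) has_derivative (\<lambda>v. (h' *\<^sub>R grad f x) \<bullet> v)) (at x)" by simp
qed

text \<open>The gain over the definition of zero trace is pointwise control: bounds common to all
  \<open>n\<close> and convergence almost everywhere. The bounds survive because mollifying is
  averaging and truncating is a contraction.\<close>

lemma positive_approximation:
  fixes u :: "'a::euclidean_space \<Rightarrow> real"
  assumes dom: "bounded_smooth_domain \<Omega>" and u: "u \<in> W1p0 1 \<Omega>" and D: "has_weak_gradient \<Omega> u D"
    and M: "AE x in lebesgue_on \<Omega>. norm (D x) \<le> M" "0 \<le> M"
    and B: "AE x in lebesgue_on \<Omega>. u x \<le> B" "0 \<le> B" and pos: "AE x in lebesgue_on \<Omega>. 0 < u x"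
  obtains \<phi> where "\<And>n::nat. \<phi> n \<in> test_functions \<Omega>" "\<And>n x. 0 \<le> \<phi> n x" "\<And>n x. \<phi> n x \<le> B"
    "\<And>n x. norm (grad (\<phi> n) x) \<le> M"
    "AE x in lebesgue_on \<Omega>. (\<lambda>n. \<phi> n x) \<longlonglongrightarrow> u x"
    "AE x in lebesgue_on \<Omega>. (\<lambda>n. grad (\<phi> n) x) \<longlonglongrightarrow> D x"
proof -
  have \<Omega>: "open \<Omega>" "bounded \<Omega>" "smooth_boundary \<Omega>" using dom by (auto simp: bounded_smooth_domain_def)
  have \<Omega>': "\<Omega> \<in> sets lebesgue" using \<Omega>(1) by auto
  obtain \<eta> where iu: "integrable (lebesgue_on \<Omega>) u" and iD: "integrable (lebesgue_on \<Omega>) D"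
    and \<eta>: "\<And>n::nat. \<eta> n \<in> test_functions \<Omega>"
    and l1: "(\<lambda>n. LINT x|lebesgue_on \<Omega>. norm (u x - \<eta> n x)) \<longlonglongrightarrow> 0"
    and l2: "(\<lambda>n. LINT x|lebesgue_on \<Omega>. norm (D x - grad (\<eta> n) x)) \<longlonglongrightarrow> 0"
    by (rule W1p0_1_approx[OF \<Omega>(1) u D]) (rule that)
  define r where "r n = 1 / real (Suc n)" for n
  have r0: "r \<longlonglongrightarrow> 0" unfolding r_def by real_asymp
  have "\<exists>k :: 'a \<Rightarrow> real. mollifier (r n) k" for n
    using mollifier_exists[of "r n"] by (metis r_def of_nat_0_less_iff zero_less_Suc zero_less_divide_1_iff)
  then obtain k :: "nat \<Rightarrow> 'a \<Rightarrow> real" where k: "\<And>n. mollifier (r n) (k n)" by metis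
  define w where "w n = mollify (k n) \<Omega> u" for n
  have gw: "grad (w n) x = mollify (k n) \<Omega> D x" for n x
    unfolding w_def by (rule grad_mollify[OF \<Omega>(1) u D mollifierD(1)[OF k]])
  have sw: "smooth_on UNIV (w n)" for n
    unfolding w_def by (rule mollify_smooth[OF mollifierD(1)[OF k] iu])
  have gwM: "norm (grad (w n) x) \<le> M" for n x
    unfolding gw by (rule norm_mollify_le[OF k iD \<Omega>' M])
  have w0: "0 \<le> w n x" for n x
    unfolding w_def using pos by (intro mollify_nonneg[OF k]) (auto elim: eventually_mono)
  have wB: "w n x \<le> B" for n x
  proof -
    have "AE x in lebesgue_on \<Omega>. norm (u x) \<le> B"
      using pos B(1) by eventually_elim simp
    from norm_mollify_le[OF k iu \<Omega>' this B(2), of n x] show ?thesis by (simp add: w_def)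
  qed
  have "\<exists>C. \<forall>x y. norm (\<eta> m x - \<eta> m y) \<le> C * norm (x - y)" for m
    using grad_bound_imp_Lipschitz[OF test_functions_smooth[OF \<eta>]] test_functions_grad_bounded[OF \<eta>[of m]]
    by (metis real_norm_def)
  then obtain C1 where C1: "\<And>m x y. norm (\<eta> m x - \<eta> m y) \<le> C1 m * norm (x - y)" by metis
  have "\<exists>C. \<forall>x y. norm (grad (\<eta> m) x - grad (\<eta> m) y) \<le> C * norm (x - y)" for m
    using test_functions_grad_Lipschitz[OF \<eta>[of m]] by metis
  then obtain C2 where C2: "\<And>m x y. norm (grad (\<eta> m) x - grad (\<eta> m) y) \<le> C2 m * norm (x - y)" by metis
  have z: "\<eta> m x = 0" "grad (\<eta> m) x = 0" if "x \<notin> \<Omega>" for m x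
    using test_functionsE[OF \<eta>[of m]] that by (metis subsetD)+
  have L1: "(\<lambda>n. LINT x|lebesgue_on \<Omega>. norm (w n x - u x)) \<longlonglongrightarrow> 0"
    unfolding w_def
    by (rule mollify_tendsto_L1[OF \<Omega>(1,2) iu k r0 _ C1 z(1) l1])
      (rule integrable_lebesgue_on_of_lborel[OF \<Omega>' test_functions_integrable[OF \<eta>]])
  have L2: "(\<lambda>n. LINT x|lebesgue_on \<Omega>. norm (mollify (k n) \<Omega> D x - D x)) \<longlonglongrightarrow> 0"
    by (rule mollify_tendsto_L1[OF \<Omega>(1,2) iD k r0 _ C2 z(2) l2])
      (rule integrable_lebesgue_on_of_lborel[OF \<Omega>' test_functions_grad_integrable[OF \<eta>]])
  have iw: "integrable (lebesgue_on \<Omega>) (\<lambda>x. w n x - u x)" for n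
    unfolding w_def by (intro Bochner_Integration.integrable_diff mollify_L1_le(1)[OF k iu \<Omega>(1,2)] iu)
  have iDw: "integrable (lebesgue_on \<Omega>) (\<lambda>x. mollify (k n) \<Omega> D x - D x)" for n
    by (intro Bochner_Integration.integrable_diff mollify_L1_le(1)[OF k iD \<Omega>(1,2)] iD)
  have "\<exists>\<alpha>::nat \<Rightarrow> nat. strict_mono \<alpha> \<and> (AE x in lebesgue_on \<Omega>. (\<lambda>n. w (\<alpha> n) x - u x) \<longlonglongrightarrow> 0)"
    by (rule tendsto_L1_AE_subseq) (rule iw, rule L1)
  then obtain \<alpha> :: "nat \<Rightarrow> nat" where \<alpha>: "strict_mono \<alpha>" "AE x in lebesgue_on \<Omega>. (\<lambda>n. w (\<alpha> n) x - u x) \<longlonglongrightarrow> 0"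
    by blast
  \<comment> \<open>A second subsequence is drawn from the first, so that values and gradients
    converge along the same indices.\<close>
  have "(\<lambda>n. LINT x|lebesgue_on \<Omega>. norm (mollify (k (\<alpha> n)) \<Omega> D x - D x)) \<longlonglongrightarrow> 0"
    using LIMSEQ_subseq_LIMSEQ[OF L2 \<alpha>(1)] by (simp add: o_def)
  then have "\<exists>\<beta>::nat \<Rightarrow> nat. strict_mono \<beta> \<and>
    (AE x in lebesgue_on \<Omega>. (\<lambda>n. mollify (k (\<alpha> (\<beta> n))) \<Omega> D x - D x) \<longlonglongrightarrow> 0)"
    by (rule tendsto_L1_AE_subseq[rotated]) (rule iDw)
  then obtain \<beta> :: "nat \<Rightarrow> nat" where \<beta>: "strict_mono \<beta>"
    "AE x in lebesgue_on \<Omega>. (\<lambda>n. mollify (k (\<alpha> (\<beta> n))) \<Omega> D x - D x) \<longlonglongrightarrow> 0"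
    by blast
  have lip: "\<bar>mollify (k n) \<Omega> u x - mollify (k n) \<Omega> u y\<bar> \<le> M * norm (x - y)" for n x y
    using grad_bound_imp_Lipschitz[OF sw gwM] by (simp add: w_def)
  have "\<exists>N. \<forall>n\<ge>N. \<forall>x. x \<notin> \<Omega> \<longrightarrow> \<bar>w n x\<bar> < r j" for j
    using mollify_small_outside[OF \<Omega> k r0 lip, of "r j"]
    by (auto simp: eventually_sequentially w_def r_def)
  then obtain N where N: "\<And>j n x. n \<ge> N j \<Longrightarrow> x \<notin> \<Omega> \<Longrightarrow> \<bar>w n x\<bar> < r j" by metis
  \<comment> \<open>Taking at least \<open>N j\<close> keeps the mollification below the truncation
    level \<open>r j\<close> outside \<Omega>; taking at least \<open>j\<close> sends the indices to
    infinity.\<close>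
  define \<mu> where "\<mu> j = \<alpha> (\<beta> (max j (N j)))" for j
  have \<mu>N: "\<mu> j \<ge> N j" for j
    using seq_suble[OF strict_mono_o[OF \<alpha>(1) \<beta>(1)], of "max j (N j)"] by (simp add: \<mu>_def)
  have max: "filterlim (\<lambda>j. max j (N j)) sequentially sequentially"
    by (rule filterlim_at_top_mono[OF filterlim_ident]) (auto intro: always_eventually)
  define \<phi> where "\<phi> j x = trunc (r j) (w (\<mu> j) x)" for j x
  have r: "r j > 0" for j by (simp add: r_def)
  have g\<phi>: "grad (\<phi> j) x = (flat 0 (w (\<mu> j) x / r j - 1) + flat (-1) (w (\<mu> j) x / r j - 1)) *\<^sub>R grad (w (\<mu> j)) x" for j x
    unfolding \<phi>_def[abs_def] by (rule grad_compose[OF sw trunc_has_derivative[OF r]])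
  have w_lim: "AE x in lebesgue_on \<Omega>. (\<lambda>j. w (\<mu> j) x) \<longlonglongrightarrow> u x"
    using \<alpha>(2)
  proof eventually_elim
    case (elim x)
    have "(\<lambda>n. w (\<alpha> n) x) \<longlonglongrightarrow> u x" using Lim_transform[OF _ elim] LIM_zero_cancel[OF elim] by blast
    from filterlim_compose[OF this filterlim_compose[OF filterlim_subseq[OF \<beta>(1)] max]]
    show ?case by (simp add: \<mu>_def)
  qed
  have D_lim: "AE x in lebesgue_on \<Omega>. (\<lambda>j. grad (w (\<mu> j)) x) \<longlonglongrightarrow> D x"
    using \<beta>(2)
  proof eventually_elim
    case (elim x)
    have "(\<lambda>n. mollify (k (\<alpha> (\<beta> n))) \<Omega> D x) \<longlonglongrightarrow> D x" using LIM_zero_cancel[OF elim] .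
    from filterlim_compose[OF this max] show ?case by (simp add: \<mu>_def gw)
  qed
  show ?thesis
  proof (rule that[of \<phi>])
    fix j x
    show "0 \<le> \<phi> j x" unfolding \<phi>_def by (rule trunc_bounds(1)[OF r])
    show "\<phi> j x \<le> B" unfolding \<phi>_def using trunc_bounds(2)[OF r w0] wB order_trans by blast
    have "norm (grad (\<phi> j) x) \<le> 1 * norm (grad (w (\<mu> j)) x)"
      unfolding g\<phi> norm_scaleR using trunc_derivative_bounds by (intro mult_right_mono) (auto simp: abs_le_iff intro: order_trans[of _ 0])
    then show "norm (grad (\<phi> j) x) \<le> M" using gwM[of "\<mu> j" x] by linarith
  next
    fix j
    \<comment> \<open>Truncation removes everything below \<open>r j\<close>. What remains lies in a
      closed set which, by the choice of the index, does not reach beyond \<Omega> and is thus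
      compact.\<close>
    define K where "K = {x. r j \<le> w (\<mu> j) x}"
    have sub: "K \<subseteq> \<Omega>"
    proof
      fix x assume "x \<in> K"
      then show "x \<in> \<Omega>" using N[OF \<mu>N, of x j] by (cases "x \<in> \<Omega>") (auto simp: K_def)
    qed
    have "closed K"
      unfolding K_def by (intro closed_Collect_le continuous_intros smooth_on_continuous[OF sw])
    then have comp: "compact K" using \<Omega>(2) sub by (meson bounded_subset compact_eq_bounded_closed)
    show "\<phi> j \<in> test_functions \<Omega>"
    proof (rule test_functionsI[OF _ comp sub])
      show "smooth_on UNIV (\<phi> j)"
        unfolding \<phi>_def[abs_def] by (rule smooth_on_compose[OF open_UNIV open_UNIV smooth_on_trunc[OF r] sw]) simp
      show "\<phi> j x = 0" if "x \<notin> K" for x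
        using that unfolding \<phi>_def by (intro trunc_bounds(3)[OF r]) (simp add: K_def)
    qed
  next
    show "AE x in lebesgue_on \<Omega>. (\<lambda>n. \<phi> n x) \<longlonglongrightarrow> u x"
      using w_lim pos by eventually_elim (simp add: \<phi>_def trunc_tendsto(1)[OF r r0])
    show "AE x in lebesgue_on \<Omega>. (\<lambda>n. grad (\<phi> n) x) \<longlonglongrightarrow> D x"
      using w_lim D_lim pos
    proof eventually_elim
      case (elim x)
      from tendsto_scaleR[OF trunc_tendsto(2)[OF r r0 elim(1,3)] elim(2)]
      show ?case by (simp add: g\<phi>)
    qed
  qed
qed

section \<open>Limits of bounded sequences of test functions\<close>

lemma locally_integrable_of_integrable:
  fixes f :: "'a::euclidean_space \<Rightarrow> 'b::euclidean_space"
  assumes "\<Omega> \<in> sets lebesgue" "integrable (lebesgue_on \<Omega>) f"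
  shows "locally_integrable \<Omega> f"
  unfolding locally_integrable_def set_integrable_def
proof (intro allI impI)
  fix K assume K: "compact K \<and> K \<subseteq> \<Omega>"
  have "integrable lebesgue (\<lambda>x. indicator K x *\<^sub>R (indicator \<Omega> x *\<^sub>R f x))"
    by (rule integrable_mult_indicator) (use assms K in \<open>auto simp: integrable_restrict_space compact_imp_closed\<close>)
  moreover have "(\<lambda>x. indicator K x *\<^sub>R (indicator \<Omega> x *\<^sub>R f x)) = (\<lambda>x. indicator K x *\<^sub>R f x)"
    using K by (auto simp: fun_eq_iff indicator_def)
  ultimately show "integrable lebesgue (\<lambda>x. indicator K x *\<^sub>R f x)" by simp
qed

lemma AE_limit_norm_le:
  fixes f :: "nat \<Rightarrow> 'a \<Rightarrow> 'b::real_normed_vector"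
  assumes "\<And>n x. norm (f n x) \<le> B" "AE x in M. (\<lambda>n. f n x) \<longlonglongrightarrow> g x"
  shows "AE x in M. norm (g x) \<le> B"
  using assms(2)
proof eventually_elim
  case (elim x)
  show ?case by (rule LIMSEQ_le_const2[OF tendsto_norm[OF elim]]) (use assms(1) in auto)
qed

text \<open>On a bounded set constants are integrable, so uniform bounds and convergence almost
  everywhere suffice for dominated convergence, both in the identity that defines weak gradients and
  in the norm, for every exponent. All memberships in \<open>W1p0 p\<close> are obtained from
  this.\<close>

lemma bounded_limit_W1p0:
  fixes f :: "'a::euclidean_space \<Rightarrow> real"
  assumes \<Omega>: "open \<Omega>" "bounded \<Omega>" and p: "1 \<le> p"
    and \<phi>: "\<And>n::nat. \<phi> n \<in> test_functions \<Omega>"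
    and B: "\<And>n x. \<bar>\<phi> n x\<bar> \<le> B" and C: "\<And>n x. norm (grad (\<phi> n) x) \<le> C"
    and f: "f \<in> borel_measurable (lebesgue_on \<Omega>)" "D \<in> borel_measurable (lebesgue_on \<Omega>)"
    and lim: "AE x in lebesgue_on \<Omega>. (\<lambda>n. \<phi> n x) \<longlonglongrightarrow> f x"
      "AE x in lebesgue_on \<Omega>. (\<lambda>n. grad (\<phi> n) x) \<longlonglongrightarrow> D x"
  shows "f \<in> W1p0 p \<Omega>" and "has_weak_gradient \<Omega> f D" and "integrable (lebesgue_on \<Omega>) D"
proof -
  have \<Omega>': "\<Omega> \<in> sets lebesgue" "\<Omega> \<in> lmeasurable" using \<Omega> by (auto simp: lmeasurable_open)
  interpret fin: finite_measure "lebesgue_on \<Omega>" using \<Omega>'(2) by (rule finite_measure_lebesgue_on)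
  note m\<phi> = continuous_imp_lebesgue_on_measurable[OF test_functions_continuous[OF \<phi>], of _ \<Omega>]
  note mg\<phi> = continuous_imp_lebesgue_on_measurable[OF continuous_grad[OF test_functions_smooth[OF \<phi>]], of _ \<Omega>]
  have fB: "AE x in lebesgue_on \<Omega>. norm (f x) \<le> B"
    by (rule AE_limit_norm_le[OF _ lim(1)]) (use B in simp)
  have DC: "AE x in lebesgue_on \<Omega>. norm (D x) \<le> C" by (rule AE_limit_norm_le[OF C lim(2)])
  have i: "integrable (lebesgue_on \<Omega>) f" "integrable (lebesgue_on \<Omega>) D"
    using fin.integrable_const_bound[OF fB f(1)] fin.integrable_const_bound[OF DC f(2)] by auto
  show "integrable (lebesgue_on \<Omega>) D" by (rule i)
  show wg: "has_weak_gradient \<Omega> f D"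
    unfolding has_weak_gradient_def
  proof (intro conjI ballI locally_integrable_of_integrable[OF \<Omega>'(1)] i)
    fix \<zeta> and b :: 'a assume \<zeta>: "\<zeta> \<in> test_functions \<Omega>" and b: "b \<in> Basis"
    obtain Z where Z: "\<And>x. \<bar>\<zeta> x\<bar> \<le> Z" using test_functions_bounded[OF \<zeta>] by metis
    note \<zeta>' = test_functions_partial[OF \<zeta> b]
    obtain Z' where Z': "\<And>x. \<bar>frechet_derivative \<zeta> (at x) b\<bar> \<le> Z'" using test_functions_bounded[OF \<zeta>'] by metis
    note m\<zeta> = continuous_imp_lebesgue_on_measurable[OF test_functions_continuous[OF \<zeta>], of \<Omega>]
    note m\<zeta>' = continuous_imp_lebesgue_on_measurable[OF test_functions_continuous[OF \<zeta>'], of \<Omega>]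
    have 1: "(\<lambda>n. LINT x|lebesgue_on \<Omega>. \<phi> n x * frechet_derivative \<zeta> (at x) b)
      \<longlonglongrightarrow> (LINT x|lebesgue_on \<Omega>. f x * frechet_derivative \<zeta> (at x) b)"
    proof (rule integral_dominated_convergence)
      show "integrable (lebesgue_on \<Omega>) (\<lambda>x. B * Z')" by simp
      show "AE x in lebesgue_on \<Omega>. norm (\<phi> n x * frechet_derivative \<zeta> (at x) b) \<le> B * Z'" for n
        using B Z' by (intro AE_I2) (auto simp: abs_mult intro!: mult_mono order_trans[OF abs_ge_zero B])
      show "AE x in lebesgue_on \<Omega>. (\<lambda>n. \<phi> n x * frechet_derivative \<zeta> (at x) b) \<longlonglongrightarrow> f x * frechet_derivative \<zeta> (at x) b"
        using lim(1) by eventually_elim (rule tendsto_mult_right)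
    qed (use m\<phi> m\<zeta>' f in \<open>auto intro!: borel_measurable_times\<close>)
    have 2: "(\<lambda>n. LINT x|lebesgue_on \<Omega>. (grad (\<phi> n) x \<bullet> b) * \<zeta> x)
      \<longlonglongrightarrow> (LINT x|lebesgue_on \<Omega>. (D x \<bullet> b) * \<zeta> x)"
    proof (rule integral_dominated_convergence)
      show "integrable (lebesgue_on \<Omega>) (\<lambda>x. C * Z)" by simp
      have "norm ((grad (\<phi> n) x \<bullet> b) * \<zeta> x) \<le> C * Z" for n x
        using Basis_le_norm[OF b, of "grad (\<phi> n) x"] C[of n x] Z[of x]
        by (auto simp: abs_mult intro!: mult_mono)
      then show "AE x in lebesgue_on \<Omega>. norm ((grad (\<phi> n) x \<bullet> b) * \<zeta> x) \<le> C * Z" for n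
        by simp
      show "AE x in lebesgue_on \<Omega>. (\<lambda>n. (grad (\<phi> n) x \<bullet> b) * \<zeta> x) \<longlonglongrightarrow> (D x \<bullet> b) * \<zeta> x"
        using lim(2) by eventually_elim (intro tendsto_mult_right tendsto_inner tendsto_const)
    qed (use mg\<phi> m\<zeta> f in \<open>auto intro!: borel_measurable_times borel_measurable_inner\<close>)
    have "(LINT x|lebesgue_on \<Omega>. \<phi> n x * frechet_derivative \<zeta> (at x) b) = - (LINT x|lebesgue_on \<Omega>. (grad (\<phi> n) x \<bullet> b) * \<zeta> x)" for n
      by (rule integration_by_parts_test_function[OF \<phi> test_functions_smooth[OF \<zeta>] b \<Omega>'(1)])
    then show "(LINT x|lebesgue_on \<Omega>. f x * frechet_derivative \<zeta> (at x) b) = - (LINT x|lebesgue_on \<Omega>. (D x \<bullet> b) * \<zeta> x)"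
      using LIMSEQ_unique[OF 1] tendsto_minus[OF 2] by simp
  qed
  have mem: "mem_Lp p \<Omega> h" if "h \<in> borel_measurable (lebesgue_on \<Omega>)" "AE x in lebesgue_on \<Omega>. norm (h x) \<le> c"
    for h :: "'a \<Rightarrow> 'c::euclidean_space" and c
    unfolding mem_Lp_def
  proof (intro conjI that(1) fin.integrable_const_bound)
    show "AE x in lebesgue_on \<Omega>. norm (norm (h x) powr p) \<le> c powr p"
      using that(2) by eventually_elim (use p in \<open>simp add: powr_mono2\<close>)
    show "(\<lambda>x. norm (h x) powr p) \<in> borel_measurable (lebesgue_on \<Omega>)"
      using that(1) by measurable
  qed
  have W: "f \<in> W1p p \<Omega>"
    using mem[OF f(1) fB] mem[OF f(2) DC] wg by (auto simp: W1p_def)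
  have Lp_lim: "(\<lambda>n. LINT x|lebesgue_on \<Omega>. norm (h x - h_n n x) powr p) \<longlonglongrightarrow> 0"
    if h: "h \<in> borel_measurable (lebesgue_on \<Omega>)" "\<And>n. h_n n \<in> borel_measurable (lebesgue_on \<Omega>)"
      and c: "\<And>n x. norm (h_n n x) \<le> c" and lim: "AE x in lebesgue_on \<Omega>. (\<lambda>n. h_n n x) \<longlonglongrightarrow> h x"
    for h :: "'a \<Rightarrow> 'c::euclidean_space" and h_n :: "nat \<Rightarrow> 'a \<Rightarrow> 'c" and c
  proof -
    have hc: "AE x in lebesgue_on \<Omega>. norm (h x) \<le> c" by (rule AE_limit_norm_le[OF c lim])
    have "(\<lambda>n. LINT x|lebesgue_on \<Omega>. norm (h x - h_n n x) powr p) \<longlonglongrightarrow> (LINT x|lebesgue_on \<Omega>. 0)"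
    proof (rule integral_dominated_convergence)
      show "integrable (lebesgue_on \<Omega>) (\<lambda>x. (2 * c) powr p)" by simp
      show "AE x in lebesgue_on \<Omega>. norm (norm (h x - h_n n x) powr p) \<le> (2 * c) powr p" for n
        using hc
      proof eventually_elim
        case (elim x)
        have "norm (h x - h_n n x) \<le> 2 * c" using norm_triangle_ineq4[of "h x" "h_n n x"] elim c[of n x] by simp
        then show ?case using p by (simp add: powr_mono2)
      qed
      show "AE x in lebesgue_on \<Omega>. (\<lambda>n. norm (h x - h_n n x) powr p) \<longlonglongrightarrow> 0"
        using lim
      proof eventually_elim
        case (elim x)
        have "(\<lambda>n. norm (h x - h_n n x)) \<longlonglongrightarrow> 0"
          using tendsto_norm[OF tendsto_diff[OF tendsto_const elim, of "h x"]] by simp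
        from tendsto_zero_powrI[OF this tendsto_const[of p]] show ?case using p by simp
      qed
      show "(\<lambda>x. norm (h x - h_n n x) powr p) \<in> borel_measurable (lebesgue_on \<Omega>)" for n
        using h(1) h(2)[of n] by measurable
    qed simp
    then show ?thesis by simp
  qed
  have norm_eq: "W1p_norm p \<Omega> (\<lambda>x. f x - \<phi> n x) = ((LINT x|lebesgue_on \<Omega>. norm (f x - \<phi> n x) powr p) +
      (LINT x|lebesgue_on \<Omega>. norm (D x - grad (\<phi> n) x) powr p)) powr (1 / p)" for n
  proof -
    have hw: "has_weak_gradient \<Omega> (\<lambda>x. f x - \<phi> n x) (\<lambda>x. D x - grad (\<phi> n) x)"
      using has_weak_gradient_add_scaled[OF \<Omega>'(1) wg test_function_has_weak_gradient[OF \<phi> \<Omega>'(1)], of 1 "-1" n] by simp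
    have "(LINT x|lebesgue_on \<Omega>. norm (weak_gradient \<Omega> (\<lambda>x. f x - \<phi> n x) x) powr p)
      = (LINT x|lebesgue_on \<Omega>. norm (D x - grad (\<phi> n) x) powr p)"
    proof (rule integral_cong_AE)
      show "AE x in lebesgue_on \<Omega>. norm (weak_gradient \<Omega> (\<lambda>x. f x - \<phi> n x) x) powr p = norm (D x - grad (\<phi> n) x) powr p"
        using weak_gradient_AE_eq[OF \<Omega>(1) hw] by eventually_elim simp
      have [measurable]: "weak_gradient \<Omega> (\<lambda>x. f x - \<phi> n x) \<in> borel_measurable (lebesgue_on \<Omega>)"
        "(\<lambda>x. D x - grad (\<phi> n) x) \<in> borel_measurable (lebesgue_on \<Omega>)"
        using has_weak_gradient_measurable(2)[OF \<Omega>(1)] hw has_weak_gradient_weak_gradient[OF hw] by auto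
      show "(\<lambda>x. norm (weak_gradient \<Omega> (\<lambda>x. f x - \<phi> n x) x) powr p) \<in> borel_measurable (lebesgue_on \<Omega>)"
        "(\<lambda>x. norm (D x - grad (\<phi> n) x) powr p) \<in> borel_measurable (lebesgue_on \<Omega>)"
        by measurable
    qed
    then show ?thesis by (simp add: W1p_norm_def)
  qed
  have "(\<lambda>n. W1p_norm p \<Omega> (\<lambda>x. f x - \<phi> n x)) \<longlonglongrightarrow> 0"
  proof -
    have s: "(\<lambda>n. (LINT x|lebesgue_on \<Omega>. norm (f x - \<phi> n x) powr p) +
      (LINT x|lebesgue_on \<Omega>. norm (D x - grad (\<phi> n) x) powr p)) \<longlonglongrightarrow> 0"
    proof -
      have "norm (\<phi> n x) \<le> B" for n x using B by simp
      from tendsto_add[OF Lp_lim[OF f(1) m\<phi> this lim(1)] Lp_lim[OF f(2) mg\<phi> C lim(2)]]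
      show ?thesis by simp
    qed
    show ?thesis unfolding norm_eq
      by (rule tendsto_zero_powrI[OF s tendsto_const]) (use p in auto)
  qed
  note lim0 = this
  have "\<exists>\<psi>\<in>test_functions \<Omega>. W1p_norm p \<Omega> (\<lambda>x. f x - \<psi> x) < \<epsilon>" if pos: "\<epsilon> > 0" for \<epsilon>
  proof -
    obtain N where "\<forall>n\<ge>N. W1p_norm p \<Omega> (\<lambda>x. f x - \<phi> n x) < \<epsilon>"
      using order_tendstoD(2)[OF lim0 pos] unfolding eventually_sequentially by blast
    then show ?thesis using \<phi>[of N] by blast
  qed
  then show "f \<in> W1p0 p \<Omega>" using W by (simp add: W1p0_def)
qed

definition approximates ::
  "'a::euclidean_space set \<Rightarrow> (nat \<Rightarrow> 'a \<Rightarrow> real) \<Rightarrow> real \<Rightarrow> real \<Rightarrow> ('a \<Rightarrow> real) \<Rightarrow> ('a \<Rightarrow> 'a) \<Rightarrow> bool" where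
  "approximates \<Omega> \<phi> B C u D \<longleftrightarrow>
    u \<in> borel_measurable (lebesgue_on \<Omega>) \<and> D \<in> borel_measurable (lebesgue_on \<Omega>) \<and>
    (\<forall>n. \<phi> n \<in> test_functions \<Omega>) \<and> (\<forall>n x. 0 \<le> \<phi> n x) \<and> (\<forall>n x. \<phi> n x \<le> B) \<and>
    (\<forall>n x. norm (grad (\<phi> n) x) \<le> C) \<and>
    (AE x in lebesgue_on \<Omega>. (\<lambda>n. \<phi> n x) \<longlonglongrightarrow> u x) \<and>
    (AE x in lebesgue_on \<Omega>. (\<lambda>n. grad (\<phi> n) x) \<longlonglongrightarrow> D x)"

text \<open>The bounds on values and gradients make dominated convergence applicable to smooth functions
  of the approximants, whatever the exponent; the convergence with exponent 1 that is part of
  \<open>W1inf0\<close> would not suffice for \<open>W1p0 p\<close>.\<close>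

definition approximable :: "'a::euclidean_space set \<Rightarrow> ('a \<Rightarrow> real) \<Rightarrow> ('a \<Rightarrow> 'a) \<Rightarrow> bool" where
  "approximable \<Omega> u D \<longleftrightarrow> (\<exists>\<phi> B C. approximates \<Omega> \<phi> B C u D)"

lemma approximatesD:
  assumes "approximates \<Omega> \<phi> B C u D"
  shows "u \<in> borel_measurable (lebesgue_on \<Omega>)" "D \<in> borel_measurable (lebesgue_on \<Omega>)"
    "\<phi> n \<in> test_functions \<Omega>" "0 \<le> \<phi> n x" "\<phi> n x \<le> B" "norm (grad (\<phi> n) x) \<le> C"
    "AE x in lebesgue_on \<Omega>. (\<lambda>n. \<phi> n x) \<longlonglongrightarrow> u x" "AE x in lebesgue_on \<Omega>. (\<lambda>n. grad (\<phi> n) x) \<longlonglongrightarrow> D x"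
  using assms unfolding approximates_def by auto

lemma approximable_W1p0:
  assumes "open \<Omega>" "bounded \<Omega>" "1 \<le> p" "approximable \<Omega> u D"
  shows "u \<in> W1p0 p \<Omega>" "has_weak_gradient \<Omega> u D"
proof -
  from assms(4) obtain \<phi> B C where "approximates \<Omega> \<phi> B C u D"
    unfolding approximable_def by blast
  note \<phi> = approximatesD[OF this]
  have "\<bar>\<phi> n x\<bar> \<le> B" for n x using \<phi>(4,5)[of n x] by simp
  from bounded_limit_W1p0[OF assms(1-3) \<phi>(3) this \<phi>(6,1,2,7,8)]
  show "u \<in> W1p0 p \<Omega>" "has_weak_gradient \<Omega> u D" by auto
qed

lemma grad_mult:
  assumes "smooth_on UNIV f" "smooth_on UNIV g"
  shows "grad (\<lambda>x. f x * g x) x = f x *\<^sub>R grad g x + g x *\<^sub>R grad f x"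
proof (rule grad_unique)
  have "((\<lambda>x. f x * g x) has_derivative (\<lambda>h. f x * (grad g x \<bullet> h) + (grad f x \<bullet> h) * g x)) (at x)"
    by (rule has_derivative_mult[OF has_derivative_grad[OF assms(1)] has_derivative_grad[OF assms(2)]])
  then show "((\<lambda>x. f x * g x) has_derivative (\<lambda>h. (f x *\<^sub>R grad g x + g x *\<^sub>R grad f x) \<bullet> h)) (at x)"
    by (rule has_derivative_eq_rhs) (simp add: fun_eq_iff inner_add_left mult.commute)
qed

text \<open>Provides the directions \<open>\<theta> x * u x\<close> and the perturbed functions
  \<open>(1 + t * \<theta> x) * u x\<close> of the supergradient argument. A smooth \<zeta> may be
  unbounded on the whole space; bounds on the closure of \<Omega> suffice, since the approximants
  vanish elsewhere.\<close>

lemma approximable_mult_smooth: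
  assumes \<Omega>: "open \<Omega>" "bounded \<Omega>" and p: "1 \<le> p" and u: "approximable \<Omega> u D"
    and \<zeta>: "smooth_on UNIV \<zeta>"
  shows "(\<lambda>x. \<zeta> x * u x) \<in> W1p0 p \<Omega>"
proof -
  from u obtain \<phi> B C where "approximates \<Omega> \<phi> B C u D"
    unfolding approximable_def by blast
  note \<phi> = approximatesD[OF this]
  have cl: "compact (closure \<Omega>)" using \<Omega>(2) by (simp add: compact_closure)
  obtain Z where Z: "\<And>x. x \<in> closure \<Omega> \<Longrightarrow> \<bar>\<zeta> x\<bar> \<le> Z"
    using compact_imp_bounded[OF compact_continuous_image[OF continuous_on_subset[OF smooth_on_continuous[OF \<zeta>]] cl]]
    unfolding bounded_iff by auto
  obtain Z' where Z': "\<And>x. x \<in> closure \<Omega> \<Longrightarrow> norm (grad \<zeta> x) \<le> Z'"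
    using compact_imp_bounded[OF compact_continuous_image[OF continuous_on_subset[OF continuous_grad[OF \<zeta>]] cl]]
    unfolding bounded_iff by auto
  have out: "\<phi> n x = 0" "grad (\<phi> n) x = 0" if "x \<notin> closure \<Omega>" for n x
    using test_functionsE[OF \<phi>(3)[of n]] that closure_subset by (metis subsetD)+
  have t: "(\<lambda>x. \<phi> n x * \<zeta> x) \<in> test_functions \<Omega>" for n by (rule test_functions_mult[OF \<phi>(3) \<zeta>])
  have g: "grad (\<lambda>x. \<phi> n x * \<zeta> x) x = \<phi> n x *\<^sub>R grad \<zeta> x + \<zeta> x *\<^sub>R grad (\<phi> n) x" for n x
    by (rule grad_mult[OF test_functions_smooth[OF \<phi>(3)] \<zeta>])
  have B0: "0 \<le> B" and C0: "0 \<le> C"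
    using order_trans[OF \<phi>(4,5)] order_trans[OF norm_ge_zero \<phi>(6)] by auto
  show ?thesis
  proof (rule bounded_limit_W1p0(1)[OF \<Omega> p t])
    fix n x
    have 1: "\<bar>\<phi> n x * \<zeta> x\<bar> \<le> B * \<bar>Z\<bar>"
    proof (cases "x \<in> closure \<Omega>")
      case True
      then show ?thesis using \<phi>(4,5)[of n x] order_trans[OF Z[OF True] abs_ge_self] B0
        by (auto simp: abs_mult intro!: mult_mono)
    qed (use out B0 in auto)
    show "\<bar>\<phi> n x * \<zeta> x\<bar> \<le> B * \<bar>Z\<bar>" by (rule 1)
    show "norm (grad (\<lambda>x. \<phi> n x * \<zeta> x) x) \<le> B * \<bar>Z'\<bar> + \<bar>Z\<bar> * C"
    proof (cases "x \<in> closure \<Omega>")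
      case True
      have "norm (\<phi> n x *\<^sub>R grad \<zeta> x) \<le> B * \<bar>Z'\<bar>"
        using \<phi>(4,5)[of n x] order_trans[OF Z'[OF True] abs_ge_self] B0 by (auto intro!: mult_mono)
      moreover have "norm (\<zeta> x *\<^sub>R grad (\<phi> n) x) \<le> \<bar>Z\<bar> * C"
        using \<phi>(6)[of n x] order_trans[OF Z[OF True] abs_ge_self] by (auto intro!: mult_mono)
      ultimately show ?thesis unfolding g by (rule norm_triangle_le[OF add_mono])
    qed (use out B0 C0 g in auto)
  next
    have m: "\<zeta> \<in> borel_measurable (lebesgue_on \<Omega>)" "grad \<zeta> \<in> borel_measurable (lebesgue_on \<Omega>)"
      by (rule continuous_imp_lebesgue_on_measurable[OF smooth_on_continuous[OF \<zeta>]]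
          continuous_imp_lebesgue_on_measurable[OF continuous_grad[OF \<zeta>]])+
    show "(\<lambda>x. \<zeta> x * u x) \<in> borel_measurable (lebesgue_on \<Omega>)"
      by (rule borel_measurable_times[OF m(1) \<phi>(1)])
    show "(\<lambda>x. u x *\<^sub>R grad \<zeta> x + \<zeta> x *\<^sub>R D x) \<in> borel_measurable (lebesgue_on \<Omega>)"
      using m \<phi>(1,2) by (intro borel_measurable_add borel_measurable_scaleR)
    show "AE x in lebesgue_on \<Omega>. (\<lambda>n. \<phi> n x * \<zeta> x) \<longlonglongrightarrow> \<zeta> x * u x"
      using \<phi>(7) by eventually_elim (subst mult.commute, rule tendsto_mult_right)
    show "AE x in lebesgue_on \<Omega>. (\<lambda>n. grad (\<lambda>x. \<phi> n x * \<zeta> x) x) \<longlonglongrightarrow> u x *\<^sub>R grad \<zeta> x + \<zeta> x *\<^sub>R D x"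
      using \<phi>(7,8) unfolding g by eventually_elim (intro tendsto_intros)
  qed
qed

section \<open>Supergradients of the potential\<close>

lemma W1p_norm_scale:
  assumes \<Omega>: "open \<Omega>" and p: "1 \<le> p" and D: "has_weak_gradient \<Omega> v D"
  shows "W1p_norm p \<Omega> (\<lambda>x. s * v x) = \<bar>s\<bar> * W1p_norm p \<Omega> v"
proof -
  have \<Omega>': "\<Omega> \<in> sets lebesgue" using \<Omega> by auto
  define W where "W = weak_gradient \<Omega> v"
  have W: "has_weak_gradient \<Omega> v W" unfolding W_def by (rule has_weak_gradient_weak_gradient[OF D])
  have sW: "has_weak_gradient \<Omega> (\<lambda>x. s * v x) (\<lambda>x. s *\<^sub>R W x)"
    using has_weak_gradient_add_scaled[OF \<Omega>' W W, of s 0] by simp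
  have [measurable]: "W \<in> borel_measurable (lebesgue_on \<Omega>)"
    "weak_gradient \<Omega> (\<lambda>x. s * v x) \<in> borel_measurable (lebesgue_on \<Omega>)"
    using has_weak_gradient_measurable(2)[OF \<Omega>] W has_weak_gradient_weak_gradient[OF sW] by auto
  have "(LINT x|lebesgue_on \<Omega>. norm (weak_gradient \<Omega> (\<lambda>x. s * v x) x) powr p)
    = (LINT x|lebesgue_on \<Omega>. norm (s *\<^sub>R W x) powr p)"
  proof (rule integral_cong_AE)
    show "AE x in lebesgue_on \<Omega>. norm (weak_gradient \<Omega> (\<lambda>x. s * v x) x) powr p = norm (s *\<^sub>R W x) powr p"
      using weak_gradient_AE_eq[OF \<Omega> sW] by eventually_elim simp
  qed measurable
  also have "\<dots> = \<bar>s\<bar> powr p * (LINT x|lebesgue_on \<Omega>. norm (W x) powr p)"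
    by (simp add: powr_mult)
  finally have 2: "(LINT x|lebesgue_on \<Omega>. norm (weak_gradient \<Omega> (\<lambda>x. s * v x) x) powr p)
    = \<bar>s\<bar> powr p * (LINT x|lebesgue_on \<Omega>. norm (W x) powr p)" .
  have 1: "(LINT x|lebesgue_on \<Omega>. \<bar>s * v x\<bar> powr p) = \<bar>s\<bar> powr p * (LINT x|lebesgue_on \<Omega>. \<bar>v x\<bar> powr p)"
    by (simp add: powr_mult abs_mult)
  define X where "X = (LINT x|lebesgue_on \<Omega>. \<bar>v x\<bar> powr p) + (LINT x|lebesgue_on \<Omega>. norm (W x) powr p)"
  have X: "X \<ge> 0" unfolding X_def by (intro add_nonneg_nonneg Bochner_Integration.integral_nonneg) auto
  have "W1p_norm p \<Omega> (\<lambda>x. s * v x) = (\<bar>s\<bar> powr p * X) powr (1 / p)"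
    unfolding W1p_norm_def 1 2 X_def by (simp add: distrib_left)
  also have "\<dots> = \<bar>s\<bar> * X powr (1 / p)"
    using X p by (simp add: powr_mult powr_powr)
  finally show ?thesis by (simp add: W1p_norm_def X_def W_def)
qed

text \<open>Along a ray the Frechet remainder is at most \<epsilon> times
  \<open>\<bar>t n\<bar>\<close> times the norm of \<open>v\<close>, by homogeneity of the norm.
  Membership of all multiples of \<open>v\<close> is a premise because it is immediate for the
  directions in use.\<close>

lemma W1p0_derivative_directional:
  assumes \<Omega>: "open \<Omega>" and p: "1 \<le> p" and der: "has_W1p0_derivative p \<Omega> J L u"
    and v: "\<And>s. (\<lambda>x. s * v x) \<in> W1p0 p \<Omega>" and t: "t \<longlonglongrightarrow> 0" "\<And>n::nat. t n \<noteq> 0"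
  shows "(\<lambda>n. (J (\<lambda>x. u x + t n * v x) - J u) / t n) \<longlonglongrightarrow> L v"
proof -
  have v1: "v \<in> W1p0 p \<Omega>" using v[of 1] by simp
  then obtain D where D: "has_weak_gradient \<Omega> v D" by (auto simp: W1p0_def W1p_def)
  note scale = W1p_norm_scale[OF \<Omega> p D]
  define N where "N = W1p_norm p \<Omega> v"
  have N: "N \<ge> 0" by (simp add: N_def W1p_norm_def)
  have lin: "L (\<lambda>x. s * v x) = s * L v" for s
  proof -
    have "L (\<lambda>x. s * v x + 0 * v x) = s * L v + 0 * L v"
      using der v1 unfolding has_W1p0_derivative_def by blast
    then show ?thesis by simp
  qed
  show ?thesis
  proof (rule LIMSEQ_I)
    fix e :: real assume e: "e > 0"
    define \<epsilon> where "\<epsilon> = e / (2 * (N + 1))"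
    have \<epsilon>: "\<epsilon> > 0" using e N by (simp add: \<epsilon>_def)
    have \<epsilon>N: "\<epsilon> * N < e"
    proof -
      have "\<epsilon> * (2 * (N + 1)) = e" using N by (simp add: \<epsilon>_def)
      then have "\<epsilon> * N = e - (\<epsilon> * N + 2 * \<epsilon>)" by (simp add: algebra_simps)
      moreover have "0 \<le> \<epsilon> * N" using \<epsilon> N by simp
      ultimately show ?thesis using \<epsilon> by linarith
    qed
    obtain \<delta> where \<delta>: "\<delta> > 0" "\<And>w. w \<in> W1p0 p \<Omega> \<Longrightarrow> W1p_norm p \<Omega> w < \<delta> \<Longrightarrow>
        \<bar>J (\<lambda>x. u x + w x) - J u - L w\<bar> \<le> \<epsilon> * W1p_norm p \<Omega> w"
      using der \<epsilon> unfolding has_W1p0_derivative_def by blast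
    have "(\<lambda>n. \<bar>t n\<bar> * N) \<longlonglongrightarrow> 0" using tendsto_mult_left_zero[OF tendsto_rabs_zero[OF t(1)]] .
    then obtain n0 where n0: "\<And>n. n \<ge> n0 \<Longrightarrow> \<bar>t n\<bar> * N < \<delta>"
      using order_tendstoD(2)[of "\<lambda>n. \<bar>t n\<bar> * N" 0 sequentially \<delta>] \<delta>(1) by (auto simp: eventually_sequentially)
    have "norm ((J (\<lambda>x. u x + t n * v x) - J u) / t n - L v) < e" if "n \<ge> n0" for n
    proof -
      have "\<bar>J (\<lambda>x. u x + t n * v x) - J u - t n * L v\<bar> \<le> \<epsilon> * (\<bar>t n\<bar> * N)"
        using \<delta>(2)[OF v[of "t n"]] n0[OF that] by (simp add: scale lin N_def)
      then have "\<bar>J (\<lambda>x. u x + t n * v x) - J u - t n * L v\<bar> / \<bar>t n\<bar> \<le> \<epsilon> * N"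
        using t(2)[of n] by (simp add: divide_simps mult.commute mult.left_commute)
      moreover have "(J (\<lambda>x. u x + t n * v x) - J u) / t n - L v = (J (\<lambda>x. u x + t n * v x) - J u - t n * L v) / t n"
        using t(2)[of n] by (simp add: field_simps)
      ultimately show ?thesis using \<epsilon>N by (simp add: abs_divide)
    qed
    then show "\<exists>n0. \<forall>n\<ge>n0. norm ((J (\<lambda>x. u x + t n * v x) - J u) / t n - L v) < e" by blast
  qed
qed

text \<open>A mean value estimate: on the interval the derivative
  \<open>p * (1 + z) powr (p - 1)\<close> is at most \<open>2 * 2\<close>. The bound is crude; it
  only has to dominate difference quotients.\<close>

lemma one_plus_powr_bound:
  fixes y p :: real
  assumes p: "1 < p" "p < 2" and y: "\<bar>y\<bar> \<le> 1 / 2"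
  shows "\<bar>(1 + y) powr p - 1\<bar> \<le> 4 * \<bar>y\<bar>"
proof -
  have "norm ((1 + y) powr p - (1 + 0) powr p) \<le> 4 * norm (y - 0)"
  proof (rule field_differentiable_bound[where S = "{-1/2..1/2}" and f' = "\<lambda>z. p * (1 + z) powr (p - 1)"])
    fix z :: real assume z: "z \<in> {-1/2..1/2}"
    show "((\<lambda>y. (1 + y) powr p) has_field_derivative p * (1 + z) powr (p - 1)) (at z within {-1/2..1/2})"
      using z by (auto intro!: derivative_eq_intros)
    have "(1 + z) powr (p - 1) \<le> 2 powr (p - 1)" using z p by (intro powr_mono2) auto
    also have "\<dots> \<le> 2 powr 1" using p by (intro powr_mono) auto
    finally have "(1 + z) powr (p - 1) \<le> 2" by simp
    then have "p * (1 + z) powr (p - 1) \<le> 2 * 2" using p by (intro mult_mono) auto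
    then show "norm (p * (1 + z) powr (p - 1)) \<le> 4" using p by simp
  qed (use y in auto)
  then show ?thesis by simp
qed

text \<open>The hypotheses do not make \<open>h x\<close> the derivative of \<open>G x\<close> at \<open>u x\<close>; this information only comes from
  the Frechet derivative, tested in the directions \<open>\<theta> u\<close> with test functions \<open>\<theta>\<close>. Multiples of \<open>u\<close>
  are used because \<open>(1 + t \<theta>) u\<close> then lies between \<open>u\<close> and \<open>\<kappa> u\<close>, so that concavity bounds the
  difference quotient by an integrable function, without a lower bound on \<open>u\<close>.\<close>

lemma supergradient_scaled:
  fixes G :: "'a::euclidean_space \<Rightarrow> real \<Rightarrow> real"
  assumes \<Omega>: "open \<Omega>" "bounded \<Omega>" and p: "1 < p" "p < 2"
    and u: "approximable \<Omega> u D" and pos: "AE x in lebesgue_on \<Omega>. 0 < u x"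
    and conc: "\<And>x. x \<in> \<Omega> \<Longrightarrow> concave_on {0..} (\<lambda>t. G x (t powr (1 / p)))"
    and intG: "\<And>w. w \<in> W1p0 p \<Omega> \<Longrightarrow> integrable (lebesgue_on \<Omega>) (\<lambda>x. G x (w x))"
    and inth: "\<And>w. w \<in> W1p0 p \<Omega> \<Longrightarrow> integrable (lebesgue_on \<Omega>) (\<lambda>x. h x * w x)"
    and der: "has_W1p0_derivative p \<Omega> (\<lambda>w. LINT x|lebesgue_on \<Omega>. G x (w x)) (\<lambda>v. LINT x|lebesgue_on \<Omega>. h x * v x) u"
    and \<kappa>: "\<kappa> > 0"
  shows "AE x in lebesgue_on \<Omega>. G x (\<kappa> * u x) - G x (u x) \<le> h x * u x * (\<kappa> powr p - 1) / p"
proof (cases "\<kappa> = 1")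
  case True
  then show ?thesis by simp
next
  case False
  have p1: "1 \<le> p" using p by simp
  have \<Omega>': "\<Omega> \<in> sets lebesgue" using \<Omega> by auto
  \<comment> \<open>The potential is concave in the variable \<open>s powr p\<close>. Passing from
    \<open>u x\<close> to \<open>\<kappa> * u x\<close> changes this variable by \<open>c\<close>
    times \<open>u x powr p\<close>.\<close>
  define c where "c = \<kappa> powr p - 1"
  have c: "c \<noteq> 0"
  proof
    assume "c = 0"
    then have "\<kappa> powr p = 1 powr p" by (simp add: c_def)
    then have "(\<kappa> powr p) powr (1 / p) = (1 powr p) powr (1 / p)" by simp
    then show False using False \<kappa> p by (simp add: powr_powr)
  qed
  have mult: "(\<lambda>x. \<zeta> x * u x) \<in> W1p0 p \<Omega>" if "smooth_on UNIV \<zeta>" for \<zeta>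
    by (rule approximable_mult_smooth[OF \<Omega> p1 u that])
  have uW: "u \<in> W1p0 p \<Omega>" by (rule approximable_W1p0(1)[OF \<Omega> p1 u])
  define \<Delta> where "\<Delta> x = G x (\<kappa> * u x) - G x (u x)" for x
  have i\<Delta>: "integrable (lebesgue_on \<Omega>) \<Delta>"
    unfolding \<Delta>_def[abs_def] using intG[OF mult[OF smooth_on_const]] intG[OF uW]
    by (rule Bochner_Integration.integrable_diff)
  have ihu: "integrable (lebesgue_on \<Omega>) (\<lambda>x. h x * u x)" by (rule inth[OF uW])
  define f where "f x = h x * u x * (c / p) - \<Delta> x" for x
  have if': "integrable (lebesgue_on \<Omega>) f"
    unfolding f_def[abs_def] using ihu i\<Delta> by (intro Bochner_Integration.integrable_diff integrable_mult_left)
  have "AE x in lebesgue_on \<Omega>. 0 \<le> f x"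
  proof (rule AE_nonneg_of_test_functions[OF \<Omega>(1) locally_integrable_of_integrable[OF \<Omega>' if']])
    fix \<theta> assume \<theta>: "\<theta> \<in> test_functions \<Omega>" and \<theta>0: "\<And>x. 0 \<le> \<theta> x"
    obtain Z where Z: "\<And>x. \<bar>\<theta> x\<bar> \<le> Z" using test_functions_bounded[OF \<theta>] by metis
    have Z0: "Z \<ge> 0" using order_trans[OF abs_ge_zero Z] .
    note s\<theta> = test_functions_smooth[OF \<theta>]
    note m\<theta> = continuous_imp_lebesgue_on_measurable[OF smooth_on_continuous[OF s\<theta>], of \<Omega>]
    \<comment> \<open>The perturbation takes the sign of \<open>c\<close>, so that it moves
      \<open>u\<close> towards \<open>\<kappa> * u\<close>, upwards for \<kappa> above 1 and
      downwards below.\<close>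
    define \<sigma> where "\<sigma> = sgn c"
    have \<sigma>: "\<sigma> * c = \<bar>c\<bar>" "\<sigma> \<noteq> 0" "\<bar>\<sigma>\<bar> = 1" "\<sigma> * \<sigma> = 1" using c by (auto simp: \<sigma>_def sgn_if)
    \<comment> \<open>The step is so small that \<open>4 * \<tau> n * Z\<close> is at most
      \<open>1 / (1 + 1 / \<bar>c\<bar>)\<close>, hence at most 1 and at most
      \<open>\<bar>c\<bar>\<close>. The first bound keeps \<open>1 + t n * \<theta> x\<close> above
      3/4 and within reach of the power estimate, the second keeps the interpolation weight below
      1.\<close>
    define \<tau> where "\<tau> n = 1 / (real (Suc n) * (4 * (Z + 1) * (1 + 1 / \<bar>c\<bar>)))" for n
    define t where "t n = \<sigma> * \<tau> n" for n
    have cc: "1 + 1 / \<bar>c\<bar> > 0" by (simp add: add_pos_nonneg)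
    have \<tau>: "\<tau> n > 0" for n using Z0 cc by (simp add: \<tau>_def)
    have \<tau>0: "\<tau> \<longlonglongrightarrow> 0"
    proof -
      have "(\<lambda>n. (1 / real (Suc n)) * (1 / (4 * (Z + 1) * (1 + 1 / \<bar>c\<bar>)))) \<longlonglongrightarrow> 0"
        by (rule tendsto_mult_left_zero) real_asymp
      then show ?thesis by (simp add: \<tau>_def[abs_def])
    qed
    have t0: "t \<longlonglongrightarrow> 0" "\<And>n. t n \<noteq> 0"
      using tendsto_mult_right_zero[OF \<tau>0, of \<sigma>] \<sigma>(2) \<tau> by (auto simp: t_def[abs_def] less_le)
    have \<tau>Z: "4 * \<tau> n * Z \<le> 1" "4 * \<tau> n * Z \<le> \<bar>c\<bar>" for n
    proof -
      have le: "\<tau> n \<le> 1 / (4 * (Z + 1) * (1 + 1 / \<bar>c\<bar>))"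
      proof -
        define E where "E = 4 * (Z + 1) * (1 + 1 / \<bar>c\<bar>)"
        have "E > 0" using Z0 cc by (simp add: E_def)
        then have "1 / (real (Suc n) * E) \<le> 1 / E" by (intro divide_left_mono) auto
        then show ?thesis by (simp add: \<tau>_def E_def)
      qed
      have "4 * \<tau> n * Z \<le> 4 * \<tau> n * (Z + 1)" using \<tau>[of n] by simp
      also have "\<dots> \<le> 4 * (1 / (4 * (Z + 1) * (1 + 1 / \<bar>c\<bar>))) * (Z + 1)"
        using le Z0 by (intro mult_right_mono mult_left_mono) auto
      also have "\<dots> = 1 / (1 + 1 / \<bar>c\<bar>)" using Z0 cc by (simp add: divide_simps)
      finally have *: "4 * \<tau> n * Z \<le> 1 / (1 + 1 / \<bar>c\<bar>)" .
      also have "\<dots> \<le> 1" by (simp add: divide_simps)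
      finally show "4 * \<tau> n * Z \<le> 1" .
      have "1 / (1 + 1 / \<bar>c\<bar>) \<le> \<bar>c\<bar>" using c by (simp add: divide_simps)
      with * show "4 * \<tau> n * Z \<le> \<bar>c\<bar>" by linarith
    qed
    \<comment> \<open>The weight for which \<open>((1 + t n * \<theta> x) * u x) powr p\<close> is
      the convex combination of \<open>u x powr p\<close> and
      \<open>(\<kappa> * u x) powr p\<close>, that is, the position of the perturbed value in the
      variable of concavity.\<close>
    define a where "a n x = ((1 + t n * \<theta> x) powr p - 1) / c" for n x
    have t\<theta>: "\<bar>t n * \<theta> x\<bar> \<le> \<tau> n * Z" "\<bar>t n * \<theta> x\<bar> \<le> 1 / 4" for n x
    proof -
      show "\<bar>t n * \<theta> x\<bar> \<le> \<tau> n * Z"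
        using Z[of x] \<tau>[of n] by (auto simp: t_def abs_mult \<sigma>(3) intro!: mult_mono)
      then show "\<bar>t n * \<theta> x\<bar> \<le> 1 / 4" using \<tau>Z(1)[of n] by linarith
    qed
    have a4: "\<bar>(1 + t n * \<theta> x) powr p - 1\<bar> \<le> 4 * (\<tau> n * Z)" for n x
      using one_plus_powr_bound[OF p, of "t n * \<theta> x"] t\<theta>[of n x] by linarith
    have a1: "\<bar>a n x\<bar> \<le> 1" for n x
    proof -
      have "\<bar>(1 + t n * \<theta> x) powr p - 1\<bar> \<le> \<bar>c\<bar>" using a4[of n x] \<tau>Z(2)[of n] by linarith
      then show ?thesis using c by (simp add: a_def abs_divide)
    qed
    have a0: "0 \<le> a n x" for n x
    proof (cases "c > 0")
      case True
      then have "1 + t n * \<theta> x \<ge> 1" using \<theta>0 \<tau>[of n] by (simp add: t_def \<sigma>_def)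
      then have "(1 + t n * \<theta> x) powr p \<ge> 1" using p by (simp add: ge_one_powr_ge_zero)
      then show ?thesis using True by (simp add: a_def)
    next
      case False
      then have "1 + t n * \<theta> x \<le> 1" using \<theta>0 \<tau>[of n] c by (simp add: t_def \<sigma>_def)
      then have "(1 + t n * \<theta> x) powr p \<le> 1 powr p" using p t\<theta>(2)[of n x] by (intro powr_mono2) auto
      then show ?thesis using False c by (simp add: a_def divide_nonpos_nonpos)
    qed
    have concave: "a n x * \<Delta> x \<le> G x (u x + t n * (\<theta> x * u x)) - G x (u x)" if x: "x \<in> \<Omega>" and ux: "0 < u x" for n x
    proof -
      define s where "s = 1 + t n * \<theta> x"
      have s: "s > 0" using t\<theta>(2)[of n x] by (simp add: s_def abs_le_iff)
      have eq: "(1 - a n x) * u x powr p + a n x * (\<kappa> * u x) powr p = (s * u x) powr p"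
      proof -
        have "s powr p = 1 + a n x * c" using c by (simp add: a_def s_def)
        then have "(s * u x) powr p = (1 + a n x * c) * u x powr p"
          using ux s by (simp add: powr_mult)
        also have "\<dots> = (1 - a n x) * u x powr p + a n x * (\<kappa> powr p * u x powr p)"
          by (simp add: c_def algebra_simps)
        finally show ?thesis using \<kappa> ux by (simp add: powr_mult)
      qed
      have "(1 - a n x) * G x ((u x powr p) powr (1 / p)) + a n x * G x (((\<kappa> * u x) powr p) powr (1 / p))
        \<le> G x (((1 - a n x) *\<^sub>R (u x powr p) + a n x *\<^sub>R ((\<kappa> * u x) powr p)) powr (1 / p))"
        using concave_onD[OF conc[OF x], of "a n x" "u x powr p" "(\<kappa> * u x) powr p"] a0[of n x] a1[of n x] by simp
      then have "(1 - a n x) * G x (u x) + a n x * G x (\<kappa> * u x) \<le> G x (s * u x)"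
        using ux \<kappa> p s by (simp add: powr_powr eq)
      then show ?thesis by (simp add: s_def \<Delta>_def algebra_simps)
    qed
    have ma: "(\<lambda>x. a n x) \<in> borel_measurable (lebesgue_on \<Omega>)" for n
      unfolding a_def using m\<theta> by measurable
    have ia\<Delta>: "integrable (lebesgue_on \<Omega>) (\<lambda>x. a n x * \<Delta> x)" for n
      using integrable_bounded_scaleR[OF i\<Delta> ma a1, of n] by simp
    have uv: "(\<lambda>x. u x + t n * (\<theta> x * u x)) \<in> W1p0 p \<Omega>" for n
    proof -
      have "smooth_on UNIV (\<lambda>x. 1 + t n * \<theta> x)"
        by (intro smooth_on_add smooth_on_mult smooth_on_const s\<theta> open_UNIV)
      from mult[OF this] show ?thesis by (simp add: algebra_simps)
    qed
    define J where "J w = (LINT x|lebesgue_on \<Omega>. G x (w x))" for w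
    have Jle: "(LINT x|lebesgue_on \<Omega>. a n x * \<Delta> x) \<le> J (\<lambda>x. u x + t n * (\<theta> x * u x)) - J u" for n
    proof -
      have "(LINT x|lebesgue_on \<Omega>. a n x * \<Delta> x)
        \<le> (LINT x|lebesgue_on \<Omega>. G x (u x + t n * (\<theta> x * u x)) - G x (u x))"
      proof (rule integral_mono_AE[OF ia\<Delta>])
        show "integrable (lebesgue_on \<Omega>) (\<lambda>x. G x (u x + t n * (\<theta> x * u x)) - G x (u x))"
          using intG[OF uv] intG[OF uW] by (rule Bochner_Integration.integrable_diff)
        have "AE x in lebesgue_on \<Omega>. x \<in> \<Omega>" by (rule AE_I2) simp
        with pos show "AE x in lebesgue_on \<Omega>. a n x * \<Delta> x \<le> G x (u x + t n * (\<theta> x * u x)) - G x (u x)"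
          by eventually_elim (rule concave)
      qed
      also have "\<dots> = J (\<lambda>x. u x + t n * (\<theta> x * u x)) - J u"
        unfolding J_def by (rule Bochner_Integration.integral_diff[OF intG[OF uv] intG[OF uW]])
      finally show ?thesis .
    qed
    have lim1: "(\<lambda>n. \<sigma> * ((J (\<lambda>x. u x + t n * (\<theta> x * u x)) - J u) / t n)) \<longlonglongrightarrow> \<sigma> * (LINT x|lebesgue_on \<Omega>. h x * (\<theta> x * u x))"
    proof (rule tendsto_mult_left, rule W1p0_derivative_directional[OF \<Omega>(1) p1 _ _ t0])
      show "has_W1p0_derivative p \<Omega> J (\<lambda>v. LINT x|lebesgue_on \<Omega>. h x * v x) u"
        unfolding J_def[abs_def] by (rule der)
      show "(\<lambda>x. s * (\<theta> x * u x)) \<in> W1p0 p \<Omega>" for s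
        using mult[OF smooth_on_mult[OF open_UNIV smooth_on_const[of UNIV s] s\<theta>]] by (simp add: mult.assoc)
    qed
    \<comment> \<open>Division by \<open>\<tau> n\<close>, which is positive, preserves the
      integrated concavity inequality for either sign of \<open>c\<close>; the sign \<sigma> then
      turns the other side into the difference quotient with \<open>t n\<close>. The limit contains
      \<open>p * \<theta> x\<close>, the derivative of \<open>(1 + s * \<theta> x) powr p\<close> at
      \<open>s = 0\<close>.\<close>
    have lim2: "(\<lambda>n. LINT x|lebesgue_on \<Omega>. a n x / \<tau> n * \<Delta> x) \<longlonglongrightarrow> (LINT x|lebesgue_on \<Omega>. p * \<theta> x * \<sigma> / c * \<Delta> x)"
    proof (rule integral_dominated_convergence)
      show "integrable (lebesgue_on \<Omega>) (\<lambda>x. 4 * Z / \<bar>c\<bar> * norm (\<Delta> x))" using i\<Delta> by simp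
      show "AE x in lebesgue_on \<Omega>. norm (a n x / \<tau> n * \<Delta> x) \<le> 4 * Z / \<bar>c\<bar> * norm (\<Delta> x)" for n
      proof (intro AE_I2)
        fix x
        have "\<bar>a n x / \<tau> n\<bar> = \<bar>(1 + t n * \<theta> x) powr p - 1\<bar> / (\<bar>c\<bar> * \<tau> n)"
          using \<tau>[of n] by (simp add: a_def abs_divide abs_mult)
        also have "\<dots> \<le> 4 * (\<tau> n * Z) / (\<bar>c\<bar> * \<tau> n)"
          using a4[of n x] \<tau>[of n] by (intro divide_right_mono) auto
        also have "\<dots> = 4 * Z / \<bar>c\<bar>" using \<tau>[of n] by simp
        finally have "\<bar>a n x / \<tau> n\<bar> \<le> 4 * Z / \<bar>c\<bar>" .
        then show "norm (a n x / \<tau> n * \<Delta> x) \<le> 4 * Z / \<bar>c\<bar> * norm (\<Delta> x)"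
          unfolding real_norm_def abs_mult by (rule mult_right_mono) simp
      qed
      show "AE x in lebesgue_on \<Omega>. (\<lambda>n. a n x / \<tau> n * \<Delta> x) \<longlonglongrightarrow> p * \<theta> x * \<sigma> / c * \<Delta> x"
      proof (intro AE_I2 tendsto_mult_right)
        fix x
        have "((\<lambda>s. (1 + s * \<theta> x) powr p) has_real_derivative p * \<theta> x) (at 0)"
          by (auto intro!: derivative_eq_intros)
        then have "((\<lambda>s. ((1 + s * \<theta> x) powr p - 1) / s) \<longlongrightarrow> p * \<theta> x) (at 0)"
          by (simp add: DERIV_def)
        moreover have "filterlim t (at 0) sequentially"
          using t0 by (auto simp: filterlim_at)
        ultimately have "(\<lambda>n. ((1 + t n * \<theta> x) powr p - 1) / t n) \<longlonglongrightarrow> p * \<theta> x"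
          by (rule filterlim_compose)
        then have "(\<lambda>n. ((1 + t n * \<theta> x) powr p - 1) / t n * (\<sigma> / c)) \<longlonglongrightarrow> p * \<theta> x * (\<sigma> / c)"
          by (rule tendsto_mult_right)
        moreover have "((1 + t n * \<theta> x) powr p - 1) / t n * (\<sigma> / c) = a n x / \<tau> n" for n
          using \<sigma>(2) by (simp add: a_def t_def divide_simps)
        ultimately show "(\<lambda>n. a n x / \<tau> n) \<longlonglongrightarrow> p * \<theta> x * \<sigma> / c" by simp
      qed
      show "(\<lambda>x. a n x / \<tau> n * \<Delta> x) \<in> borel_measurable (lebesgue_on \<Omega>)" for n
        using ma[of n] borel_measurable_integrable[OF i\<Delta>] by measurable
      show "(\<lambda>x. p * \<theta> x * \<sigma> / c * \<Delta> x) \<in> borel_measurable (lebesgue_on \<Omega>)"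
        using m\<theta> borel_measurable_integrable[OF i\<Delta>] by measurable
    qed
    have "(LINT x|lebesgue_on \<Omega>. p * \<theta> x * \<sigma> / c * \<Delta> x) \<le> \<sigma> * (LINT x|lebesgue_on \<Omega>. h x * (\<theta> x * u x))"
    proof (rule LIMSEQ_le[OF lim2 lim1], intro exI allI impI)
      fix n
      have "(LINT x|lebesgue_on \<Omega>. a n x / \<tau> n * \<Delta> x) = (LINT x|lebesgue_on \<Omega>. a n x * \<Delta> x) / \<tau> n"
        by simp
      also have "\<dots> \<le> (J (\<lambda>x. u x + t n * (\<theta> x * u x)) - J u) / \<tau> n"
        using Jle[of n] \<tau>[of n] by (simp add: divide_right_mono)
      also have "\<dots> = \<sigma> * ((J (\<lambda>x. u x + t n * (\<theta> x * u x)) - J u) / t n)"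
        using \<sigma>(2,4) by (simp add: t_def)
      finally show "(LINT x|lebesgue_on \<Omega>. a n x / \<tau> n * \<Delta> x)
        \<le> \<sigma> * ((J (\<lambda>x. u x + t n * (\<theta> x * u x)) - J u) / t n)" .
    qed
    then have "(\<sigma> / c * p) * (LINT x|lebesgue_on \<Omega>. \<theta> x * \<Delta> x) \<le> \<sigma> * (LINT x|lebesgue_on \<Omega>. h x * (\<theta> x * u x))"
      by (simp add: mult.commute mult.left_commute flip: integral_mult_right_zero)
    then have scaled: "(\<sigma> * c / p) * ((\<sigma> / c * p) * (LINT x|lebesgue_on \<Omega>. \<theta> x * \<Delta> x))
      \<le> (\<sigma> * c / p) * (\<sigma> * (LINT x|lebesgue_on \<Omega>. h x * (\<theta> x * u x)))"
      using \<sigma>(1) p by (intro mult_left_mono) auto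
    have *: "(LINT x|lebesgue_on \<Omega>. \<theta> x * \<Delta> x) \<le> (c / p) * (LINT x|lebesgue_on \<Omega>. h x * (\<theta> x * u x))"
    proof -
      have "(\<sigma> * c / p) * ((\<sigma> / c * p) * X) = (\<sigma> * \<sigma>) * X" for X
        using c p by simp
      moreover have "(\<sigma> * c / p) * (\<sigma> * Y) = (\<sigma> * \<sigma>) * (c / p * Y)" for Y
        by simp
      ultimately show ?thesis
        using scaled by (simp only: \<sigma>(4) mult_1_left)
    qed
    have "(LINT x|lebesgue_on \<Omega>. f x * \<theta> x)
      = (c / p) * (LINT x|lebesgue_on \<Omega>. h x * (\<theta> x * u x)) - (LINT x|lebesgue_on \<Omega>. \<theta> x * \<Delta> x)"
    proof -
      have "integrable (lebesgue_on \<Omega>) (\<lambda>x. (c / p) * (h x * (\<theta> x * u x)))"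
        by (rule integrable_mult_right[OF inth[OF mult[OF s\<theta>]]])
      moreover have "integrable (lebesgue_on \<Omega>) (\<lambda>x. \<theta> x * \<Delta> x)"
        using integrable_bounded_scaleR[OF i\<Delta> m\<theta> Z] by simp
      ultimately have "(LINT x|lebesgue_on \<Omega>. (c / p) * (h x * (\<theta> x * u x)) - \<theta> x * \<Delta> x)
        = (LINT x|lebesgue_on \<Omega>. (c / p) * (h x * (\<theta> x * u x))) - (LINT x|lebesgue_on \<Omega>. \<theta> x * \<Delta> x)"
        by (rule Bochner_Integration.integral_diff)
      moreover have "f x * \<theta> x = (c / p) * (h x * (\<theta> x * u x)) - \<theta> x * \<Delta> x" for x
        by (simp add: f_def algebra_simps)
      ultimately show ?thesis by simp
    qed
    then show "0 \<le> (LINT x|lebesgue_on \<Omega>. f x * \<theta> x)" using * by linarith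
  qed
  then show ?thesis by eventually_elim (simp add: f_def \<Delta>_def c_def)
qed

section \<open>The Picone inequality for the mean curvature operator\<close>

lemma powr_diff_le:
  fixes A B p :: real
  assumes "0 < A" "A \<le> B" "1 \<le> p"
  shows "B powr p - A powr p \<le> p * B powr (p - 1) * (B - A)"
proof (cases "A = B")
  case False
  then have "A < B" using assms(2) by simp
  then obtain z where z: "A < z" "z < B" "B powr p - A powr p = (B - A) * (p * z powr (p - 1))"
    using MVT2[of A B "\<lambda>s. s powr p" "\<lambda>s. p * s powr (p - 1)"] assms(1)
    by (metis has_real_derivative_powr less_le_trans)
  have "z powr (p - 1) \<le> B powr (p - 1)" using z assms by (intro powr_mono2) auto
  then have "(B - A) * (p * z powr (p - 1)) \<le> (B - A) * (p * B powr (p - 1))"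
    using assms by (intro mult_left_mono) auto
  then show ?thesis using z(3) by (simp add: mult.commute mult.left_commute)
qed simp

text \<open>The Diaz-Saa test function \<open>(A\<^sup>p - B\<^sup>p) / A\<^sup>p\<^sup>-\<^sup>1\<close> and its gradient for \<open>\<xi> = \<nabla>A\<close>, \<open>\<eta> = \<nabla>B\<close>.\<close>

definition picone :: "real \<Rightarrow> real \<Rightarrow> real \<Rightarrow> real" where
  "picone p A B = A - B powr p * A powr (1 - p)"

definition picone_grad :: "real \<Rightarrow> real \<Rightarrow> real \<Rightarrow> 'a::euclidean_space \<Rightarrow> 'a \<Rightarrow> 'a" where
  "picone_grad p A B \<xi> \<eta> =
    (1 + (p - 1) * (B powr p * A powr (- p))) *\<^sub>R \<xi> - (p * (B powr (p - 1) * A powr (1 - p))) *\<^sub>R \<eta>"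

lemma picone_eq: "A > 0 \<Longrightarrow> picone p A B = (A powr p - B powr p) * A powr (1 - p)"
  by (simp add: picone_def left_diff_distrib flip: powr_add)

text \<open>The logarithm has derivative \<open>(2 - p) / s - s / (1 + s\<^sup>2)\<close>, which for
  positive \<open>s\<close> is positive exactly when \<open>(p - 1) * s\<^sup>2 < 2 - p\<close>.
  This is the origin of the radius in \<open>Z_set\<close>.\<close>

lemma mean_curvature_rate_increasing:
  fixes a b p :: real
  assumes p: "1 < p" "p < 2" and ab: "0 \<le> a" "a < b" "b\<^sup>2 < (2 - p) / (p - 1)"
  shows "a powr (2 - p) / sqrt (1 + a\<^sup>2) < b powr (2 - p) / sqrt (1 + b\<^sup>2)"
\<comment> \<open>At zero the logarithm is of no use, but there the left-hand side is 0, by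
  \<open>0 powr (2 - p) = 0\<close>.\<close>
proof (cases "a = 0")
  case True
  then show ?thesis using ab p by (simp add: add_pos_nonneg)
next
  case False
  define L where "L s = (2 - p) * ln s - ln (1 + s\<^sup>2) / 2" for s :: real
  have eq: "s powr (2 - p) / sqrt (1 + s\<^sup>2) = exp (L s)" if "s > 0" for s
  proof -
    have "0 < 1 + s\<^sup>2" by (simp add: add_pos_nonneg)
    then have "sqrt (1 + s\<^sup>2) = exp (ln (1 + s\<^sup>2) / 2)"
      by (simp add: powr_def flip: powr_half_sqrt)
    then show ?thesis using that by (simp add: L_def powr_def exp_diff)
  qed
  have "L a < L b"
  proof (rule DERIV_pos_imp_increasing[OF ab(2)])
    fix s assume s: "a \<le> s" "s \<le> b"
    then have s0: "s > 0" using False ab(1) by simp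
    have s2: "0 < 1 + s\<^sup>2" by (simp add: add_pos_nonneg)
    have "(L has_real_derivative (2 - p) / s - s / (1 + s\<^sup>2)) (at s)"
      unfolding L_def[abs_def] using s0 s2 by (auto intro!: derivative_eq_intros simp: divide_simps)
    moreover have "0 < (2 - p) / s - s / (1 + s\<^sup>2)"
    proof -
      have "s\<^sup>2 \<le> b\<^sup>2" using s s0 by (intro power_mono) auto
      then have "s\<^sup>2 * (p - 1) < 2 - p" using ab(3) p by (simp add: pos_less_divide_eq) (meson le_less_trans mult_right_mono diff_ge_0_iff_ge less_imp_le)
      then have "s * s < (2 - p) * (1 + s\<^sup>2)" by (simp add: algebra_simps power2_eq_square)
      then have "(s * s) / (s * (1 + s\<^sup>2)) < ((2 - p) * (1 + s\<^sup>2)) / (s * (1 + s\<^sup>2))"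
        using s0 s2 by (intro divide_strict_right_mono) auto
      then show ?thesis using s0 s2 by simp
    qed
    ultimately show "\<exists>y. (L has_real_derivative y) (at s) \<and> 0 < y" by blast
  qed
  then show ?thesis using eq False ab by simp
qed

text \<open>Only the ratio \<open>B / A\<close> matters. Young's inequality with exponents
  \<open>p / (p - 1)\<close> and \<open>p\<close> is applied to
  \<open>(\<tau> * a) powr (p - 1)\<close> and \<open>b\<close>, and multiplied by
  \<open>a powr (2 - p)\<close>. The last term of the bound is the defect in the Cauchy-Schwarz
  inequality; it is kept because its vanishing decides the case of equality.\<close>

lemma picone_lower_bound:
  fixes \<xi> \<eta> :: "'a::euclidean_space"
  assumes p: "1 < p" "p < 2" and AB: "0 < A" "0 < B"
  shows "\<xi> \<bullet> picone_grad p A B \<xi> \<eta> \<ge> norm \<xi> powr (2 - p) * (norm \<xi> powr p - norm \<eta> powr p)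
    + p * (B powr (p - 1) * A powr (1 - p)) * (norm \<xi> * norm \<eta> - \<xi> \<bullet> \<eta>)"
proof -
  define a b where "a = norm \<xi>" and "b = norm \<eta>"
  define \<tau> where "\<tau> = B / A"
  have \<tau>: "\<tau> > 0" using AB by (simp add: \<tau>_def)
  have T1: "B powr p * A powr (- p) = \<tau> powr p"
    using AB by (simp add: \<tau>_def powr_divide powr_minus_divide)
  have T2: "B powr (p - 1) * A powr (1 - p) = \<tau> powr (p - 1)"
    using AB powr_minus_divide[of A "p - 1"] by (simp add: \<tau>_def powr_divide)
  have young: "p * \<tau> powr (p - 1) * (a * b) \<le> (p - 1) * \<tau> powr p * a\<^sup>2 + a powr (2 - p) * b powr p"
  proof (cases "a = 0 \<or> b = 0")
    case True
    then show ?thesis using p \<tau> by (auto simp: a_def b_def)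
  next
    case False
    then have a: "a > 0" and b: "b > 0" by (auto simp: a_def b_def)
    have "((\<tau> * a) powr p) powr ((p - 1) / p) * (b powr p) powr (1 / p)
      \<le> (p - 1) / p * (\<tau> * a) powr p + 1 / p * b powr p"
      using p a b \<tau> by (intro Youngs_inequality_0) (auto simp: field_simps)
    then have "p * ((\<tau> * a) powr (p - 1) * b) \<le> p * ((p - 1) / p * (\<tau> * a) powr p + 1 / p * b powr p)"
      using p b by (intro mult_left_mono) (auto simp: powr_powr)
    also have "\<dots> = (p - 1) * (\<tau> * a) powr p + b powr p" using p by (simp add: distrib_left)
    finally have "a powr (2 - p) * (p * ((\<tau> * a) powr (p - 1) * b)) \<le> a powr (2 - p) * ((p - 1) * (\<tau> * a) powr p + b powr p)"
      by (intro mult_left_mono) auto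
    moreover have "a powr (2 - p) * a powr (p - 1) = a" "a powr (2 - p) * a powr p = a\<^sup>2"
      using a by (simp_all flip: powr_add add: powr_numeral)
    moreover have "a powr (2 - p) * (p * ((\<tau> * a) powr (p - 1) * b))
        = p * \<tau> powr (p - 1) * ((a powr (2 - p) * a powr (p - 1)) * b)"
      using a \<tau> by (simp add: powr_mult)
    moreover have "a powr (2 - p) * ((p - 1) * (\<tau> * a) powr p + b powr p)
        = (p - 1) * \<tau> powr p * (a powr (2 - p) * a powr p) + a powr (2 - p) * b powr p"
      using a \<tau> by (simp add: powr_mult distrib_left)
    ultimately show ?thesis by simp
  qed
  have "\<xi> \<bullet> picone_grad p A B \<xi> \<eta> = (1 + (p - 1) * \<tau> powr p) * a\<^sup>2 - p * \<tau> powr (p - 1) * (\<xi> \<bullet> \<eta>)"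
    by (simp add: picone_grad_def T1 T2 inner_diff_right a_def power2_norm_eq_inner)
  moreover have "a powr (2 - p) * a powr p = a\<^sup>2"
    by (cases "a = 0") (simp_all flip: powr_add add: a_def powr_numeral)
  ultimately show ?thesis
    using young unfolding T2 a_def[symmetric] b_def[symmetric] by (simp add: algebra_simps)
qed

text \<open>The two lower bounds add up to \<open>(m a - m b) * (a powr p - b powr p)\<close> plus
  nonnegative Cauchy-Schwarz defects, and both factors of the product have the same sign because
  \<open>m\<close> increases below the radius. If \<open>Q\<close> vanishes, strictness makes the
  norms equal and the defect is zero, which forces equal vectors.\<close>

lemma picone_inequality:
  fixes \<xi> \<eta> :: "'a::euclidean_space"
  assumes p: "1 < p" "p < 2" and AB: "0 < A" "0 < B"
    and \<xi>: "(norm \<xi>)\<^sup>2 < (2 - p) / (p - 1)" and \<eta>: "(norm \<eta>)\<^sup>2 < (2 - p) / (p - 1)"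
  defines "Q \<equiv> (\<xi> \<bullet> picone_grad p A B \<xi> \<eta>) / sqrt (1 + (norm \<xi>)\<^sup>2)
    + (\<eta> \<bullet> picone_grad p B A \<eta> \<xi>) / sqrt (1 + (norm \<eta>)\<^sup>2)"
  shows "0 \<le> Q" "Q = 0 \<Longrightarrow> \<xi> = \<eta>"
proof -
  define a b where "a = norm \<xi>" and "b = norm \<eta>"
  have ab: "0 \<le> a" "0 \<le> b" by (auto simp: a_def b_def)
  define m where "m s = s powr (2 - p) / sqrt (1 + s\<^sup>2)" for s
  define T where "T A B = p * (B powr (p - 1) * A powr (1 - p))" for A B
  have T: "T A B > 0" if "A > 0" "B > 0" for A B using that p by (simp add: T_def)
  define S where "S = a * b - \<xi> \<bullet> \<eta>"
  have S: "S \<ge> 0" using norm_cauchy_schwarz[of \<xi> \<eta>] by (simp add: S_def a_def b_def)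
  have sq: "sqrt (1 + s\<^sup>2) > 0" for s :: real by (simp add: add_pos_nonneg)
  have 1: "(\<xi> \<bullet> picone_grad p A B \<xi> \<eta>) / sqrt (1 + a\<^sup>2) \<ge> m a * (a powr p - b powr p) + T A B * S / sqrt (1 + a\<^sup>2)"
  proof -
    have "\<xi> \<bullet> picone_grad p A B \<xi> \<eta> \<ge> a powr (2 - p) * (a powr p - b powr p) + T A B * S"
      using picone_lower_bound[OF p AB, of \<xi> \<eta>] by (simp add: a_def b_def S_def T_def)
    from divide_right_mono[OF this less_imp_le[OF sq[of a]]] show ?thesis
      by (simp add: m_def add_divide_distrib)
  qed
  have 2: "(\<eta> \<bullet> picone_grad p B A \<eta> \<xi>) / sqrt (1 + b\<^sup>2) \<ge> m b * (b powr p - a powr p) + T B A * S / sqrt (1 + b\<^sup>2)"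
  proof -
    have "\<eta> \<bullet> picone_grad p B A \<eta> \<xi> \<ge> b powr (2 - p) * (b powr p - a powr p) + T B A * S"
      using picone_lower_bound[OF p AB(2,1), of \<eta> \<xi>]
      by (simp add: a_def b_def S_def T_def inner_commute mult.commute)
    from divide_right_mono[OF this less_imp_le[OF sq[of b]]] show ?thesis
      by (simp add: m_def add_divide_distrib)
  qed
  have Q: "Q \<ge> (m a - m b) * (a powr p - b powr p) + (T A B * S / sqrt (1 + a\<^sup>2) + T B A * S / sqrt (1 + b\<^sup>2))"
    unfolding Q_def a_def[symmetric] b_def[symmetric] using add_mono[OF 1 2] by (simp add: algebra_simps)
  have P: "(m a - m b) * (a powr p - b powr p) > 0" if neq: "a \<noteq> b"
  proof -
    consider "a < b" | "b < a" using neq by linarith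
    then show ?thesis
    proof cases
      case 1
      have "m a < m b" unfolding m_def
        using mean_curvature_rate_increasing[OF p ab(1) 1] \<eta> by (simp add: b_def)
      moreover have "a powr p < b powr p" using 1 ab p by (intro powr_less_mono2) auto
      ultimately show ?thesis by (intro mult_neg_neg) auto
    next
      case 2
      have "m b < m a" unfolding m_def
        using mean_curvature_rate_increasing[OF p ab(2) 2] \<xi> by (simp add: a_def)
      moreover have "b powr p < a powr p" using 2 ab p by (intro powr_less_mono2) auto
      ultimately show ?thesis by simp
    qed
  qed
  have P': "(m a - m b) * (a powr p - b powr p) \<ge> 0" using P by (cases "a = b") auto
  have TS: "T A B * S / sqrt (1 + a\<^sup>2) \<ge> 0" "T B A * S / sqrt (1 + b\<^sup>2) \<ge> 0"
    using T[OF AB] T[OF AB(2,1)] S sq[of a] sq[of b] by (auto intro!: divide_nonneg_pos mult_nonneg_nonneg)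
  show "0 \<le> Q" using Q P' TS by linarith
  assume "Q = 0"
  then have "(m a - m b) * (a powr p - b powr p) = 0" "T A B * S / sqrt (1 + a\<^sup>2) = 0"
    using Q P' TS by linarith+
  then have "a = b" "S = 0" using P T[OF AB] sq[of a] by fastforce+
  then have "(norm (\<xi> - \<eta>))\<^sup>2 = 0"
    by (simp add: S_def a_def b_def power2_norm_eq_inner inner_diff_left inner_diff_right inner_commute
        norm_eq_sqrt_inner)
  then show "\<xi> = \<eta>" by simp
qed

text \<open>The bound must not depend on \<epsilon>. If \<open>v \<le> u\<close>, the quotient lies
  between 0 and \<open>p * (u - v)\<close>. If \<open>u < v\<close> it is nonpositive but may be
  huge where \<open>u\<close> is much smaller than \<open>v\<close>. This matters only for negative
  \<open>g\<close>, and then \<open>mono\<close> trades \<open>g\<close> for \<open>h\<close>, with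
  a power of \<open>u / v\<close> that compensates the growth.\<close>

lemma picone_source_bound:
  fixes u v \<epsilon> p g h :: real
  assumes p: "1 < p" "p < 2" and uv: "0 < u" "0 < v" and \<epsilon>: "0 < \<epsilon>"
    and mono: "(g * u powr (1 - p) - h * v powr (1 - p)) * (u powr p - v powr p) \<le> 0"
  shows "g * picone p (u + \<epsilon>) (v + \<epsilon>) \<le> p * (\<bar>g\<bar> + \<bar>h\<bar>) * \<bar>u - v\<bar>"
proof -
  define A B where "A = u + \<epsilon>" and "B = v + \<epsilon>"
  have AB: "0 < A" "0 < B" "A - B = u - v" using uv \<epsilon> by (auto simp: A_def B_def)
  have rhs: "\<bar>g\<bar> * (p * \<bar>u - v\<bar>) \<le> p * (\<bar>g\<bar> + \<bar>h\<bar>) * \<bar>u - v\<bar>" "\<bar>h\<bar> * (p * \<bar>u - v\<bar>) \<le> p * (\<bar>g\<bar> + \<bar>h\<bar>) * \<bar>u - v\<bar>"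
    using p by (simp_all add: algebra_simps)
  have AA: "A powr (p - 1) * A powr (1 - p) = 1" using AB by (simp flip: powr_add)
  show ?thesis
  proof (cases "v \<le> u")
    case True
    have "A powr p - B powr p \<le> p * A powr (p - 1) * (A - B)"
      using AB True p by (intro powr_diff_le) (auto simp: A_def B_def)
    then have "picone p A B \<le> p * A powr (p - 1) * (A - B) * A powr (1 - p)"
      unfolding picone_eq[OF AB(1)] by (intro mult_right_mono) auto
    also have "\<dots> = p * (A - B) * (A powr (p - 1) * A powr (1 - p))" by simp
    finally have le: "picone p A B \<le> p * \<bar>u - v\<bar>" using True AB(3) by (simp add: AA)
    have "0 \<le> picone p A B"
      unfolding picone_eq[OF AB(1)] using True p AB by (intro mult_nonneg_nonneg) (auto intro!: powr_mono2 simp: A_def B_def)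
    then have "g * picone p A B \<le> \<bar>g\<bar> * picone p A B"
      by (rule mult_right_mono[OF abs_ge_self])
    also have "\<dots> \<le> \<bar>g\<bar> * (p * \<bar>u - v\<bar>)"
      using le by (rule mult_left_mono) simp
    also note rhs(1)
    finally show ?thesis by (simp only: A_def B_def)
  next
    case False
    then have uv': "u < v" by simp
    have pow: "u powr p < v powr p" using uv uv' p by (intro powr_less_mono2) auto
    have neg: "picone p A B \<le> 0"
      unfolding picone_eq[OF AB(1)] using uv' p AB by (intro mult_nonpos_nonneg) (auto intro!: powr_mono2 simp: A_def B_def)
    show ?thesis
    proof (cases "g \<ge> 0")
      case True
      then have "g * picone p A B \<le> 0" using neg by (simp add: mult_nonneg_nonpos)
      also have "0 \<le> p * (\<bar>g\<bar> + \<bar>h\<bar>) * \<bar>u - v\<bar>" using p by simp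
      finally show ?thesis by (simp add: A_def B_def)
    next
      case g: False
      have "h * v powr (1 - p) \<le> g * u powr (1 - p)"
        using mono pow by (simp add: mult_le_0_iff)
      then have gh: "\<bar>g\<bar> * u powr (1 - p) \<le> \<bar>h\<bar> * v powr (1 - p)"
      proof -
        have "\<bar>g\<bar> * u powr (1 - p) = - (g * u powr (1 - p))" using g by simp
        also have "\<dots> \<le> - h * v powr (1 - p)" using \<open>h * v powr (1 - p) \<le> g * u powr (1 - p)\<close> by simp
        also have "\<dots> \<le> \<bar>h\<bar> * v powr (1 - p)" by (intro mult_right_mono) auto
        finally show ?thesis .
      qed
      have "B powr p - A powr p \<le> p * B powr (p - 1) * (B - A)"
        using AB uv' p by (intro powr_diff_le) (auto simp: A_def B_def)
      then have "- picone p A B \<le> p * B powr (p - 1) * (B - A) * A powr (1 - p)"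
      proof -
        have "- picone p A B = (B powr p - A powr p) * A powr (1 - p)"
          unfolding picone_eq[OF AB(1)] by (simp add: left_diff_distrib)
        with mult_right_mono[OF \<open>B powr p - A powr p \<le> p * B powr (p - 1) * (B - A)\<close>, of "A powr (1 - p)"]
        show ?thesis by simp
      qed
      then have "g * picone p A B \<le> \<bar>g\<bar> * (p * B powr (p - 1) * (B - A) * A powr (1 - p))"
        using g mult_left_mono[of "- picone p A B" _ "\<bar>g\<bar>"] by simp
      \<comment> \<open>The factor \<open>u powr (1 - p) * u powr (p - 1)\<close> is inserted so
        that \<open>gh\<close> can be applied. What remains after the exchange is the ratio of
        \<open>u * B\<close> to \<open>v * A\<close> to the power \<open>p - 1\<close>, at most 1
        because \<open>u * \<epsilon> \<le> v * \<epsilon>\<close>.\<close>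
      also have "\<dots> = (\<bar>g\<bar> * u powr (1 - p)) * (u powr (p - 1) * (p * B powr (p - 1) * (B - A) * A powr (1 - p)))"
      proof -
        have "u powr (1 - p) * u powr (p - 1) = 1" using uv by (simp flip: powr_add)
        then have cancel: "(\<bar>g\<bar> * u powr (1 - p)) * (u powr (p - 1) * X) = \<bar>g\<bar> * X" for X
          by (metis (no_types) mult.assoc mult.right_neutral)
        show ?thesis by (rule cancel[symmetric])
      qed
      also have "\<dots> \<le> (\<bar>h\<bar> * v powr (1 - p)) * (u powr (p - 1) * (p * B powr (p - 1) * (B - A) * A powr (1 - p)))"
        using gh p uv' by (intro mult_right_mono) (auto intro!: mult_nonneg_nonneg simp: A_def B_def)
      also have "\<dots> = \<bar>h\<bar> * (p * (B - A)) * ((u * B) powr (p - 1) * (v * A) powr (1 - p))"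
        using uv AB by (simp add: powr_mult)
      also have "\<dots> \<le> \<bar>h\<bar> * (p * (B - A)) * 1"
      proof (rule mult_left_mono)
        have "u * B \<le> v * A" using uv' \<epsilon> by (simp add: A_def B_def algebra_simps)
        then have "(u * B) powr (p - 1) \<le> (v * A) powr (p - 1)" using uv AB p by (intro powr_mono2) auto
        then have "(u * B) powr (p - 1) * (v * A) powr (1 - p) \<le> (v * A) powr (p - 1) * (v * A) powr (1 - p)"
          by (rule mult_right_mono) simp
        also have "\<dots> = 1" using uv AB by (simp flip: powr_add)
        finally show "(u * B) powr (p - 1) * (v * A) powr (1 - p) \<le> 1" .
        show "0 \<le> \<bar>h\<bar> * (p * (B - A))" using p uv' by (simp add: A_def B_def)
      qed
      also have "\<dots> \<le> p * (\<bar>g\<bar> + \<bar>h\<bar>) * \<bar>u - v\<bar>" using rhs(2) uv' by (simp add: A_def B_def)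
      finally show ?thesis by (simp add: A_def B_def)
    qed
  qed
qed

text \<open>Without a shift the sum equals the left-hand side of \<open>mono\<close>. With a shift
  the factors of \<open>g\<close> and \<open>h\<close> are powers of the shifted values, and no such
  identity is available.\<close>

lemma picone_source_limit:
  fixes u v p g h :: real
  assumes uv: "0 < u" "0 < v"
    and mono: "(g * u powr (1 - p) - h * v powr (1 - p)) * (u powr p - v powr p) \<le> 0"
  shows "g * picone p u v + h * picone p v u \<le> 0"
  using mono unfolding picone_eq[OF uv(1)] picone_eq[OF uv(2)] by (simp add: algebra_simps)

section \<open>The test functions of Diaz and Saa\<close>

lemma has_derivative_powr_shift:
  assumes f: "smooth_on UNIV f" and pos: "0 < f x + \<epsilon>"
  shows "((\<lambda>x. (f x + \<epsilon>) powr c) has_derivative (\<lambda>h. c * (f x + \<epsilon>) powr (c - 1) * (grad f x \<bullet> h))) (at x)"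
proof -
  have "((\<lambda>x. f x + \<epsilon>) has_derivative (\<lambda>h. grad f x \<bullet> h)) (at x)"
    using has_derivative_grad[OF f] by (auto intro!: derivative_eq_intros)
  moreover have "((\<lambda>s. s powr c) has_derivative (*) (c * (f x + \<epsilon>) powr (c - 1))) (at (f x + \<epsilon>))"
    using has_real_derivative_powr[OF pos, of c] by (simp add: has_field_derivative_def)
  ultimately show ?thesis by (rule has_derivative_compose)
qed

lemma smooth_on_powr_shift:
  assumes f: "smooth_on UNIV f" and pos: "\<And>x. 0 < f x + \<epsilon>"
  shows "smooth_on UNIV (\<lambda>x. (f x + \<epsilon>) powr c)"
  by (rule smooth_on_compose[OF open_UNIV open_greaterThan smooth_on_powr smooth_on_add[OF open_UNIV f smooth_on_const]])
    (use pos in auto)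

lemma grad_picone:
  assumes f: "smooth_on UNIV f" "0 < f x + \<epsilon>" and g: "smooth_on UNIV g" "0 < g x + \<epsilon>"
  shows "grad (\<lambda>x. picone p (f x + \<epsilon>) (g x + \<epsilon>)) x = picone_grad p (f x + \<epsilon>) (g x + \<epsilon>) (grad f x) (grad g x)"
proof (rule grad_unique)
  have "((\<lambda>x. f x + \<epsilon> - (g x + \<epsilon>) powr p * (f x + \<epsilon>) powr (1 - p)) has_derivative
    (\<lambda>h. grad f x \<bullet> h - ((g x + \<epsilon>) powr p * ((1 - p) * (f x + \<epsilon>) powr (1 - p - 1) * (grad f x \<bullet> h))
      + p * (g x + \<epsilon>) powr (p - 1) * (grad g x \<bullet> h) * (f x + \<epsilon>) powr (1 - p)))) (at x)"
    by (intro has_derivative_diff has_derivative_mult has_derivative_powr_shift f g)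
      (use has_derivative_grad[OF f(1)] in \<open>auto intro!: derivative_eq_intros\<close>)
  then show "((\<lambda>x. picone p (f x + \<epsilon>) (g x + \<epsilon>)) has_derivative
      (\<lambda>h. picone_grad p (f x + \<epsilon>) (g x + \<epsilon>) (grad f x) (grad g x) \<bullet> h)) (at x)"
    unfolding picone_def
    by (rule has_derivative_eq_rhs)
      (simp add: fun_eq_iff picone_grad_def inner_diff_left algebra_simps)
qed

text \<open>The same quotient of the shifted approximants is a test function. The shift bounds the
  negative powers from above by powers of \<epsilon>, and the upper bounds of the approximants
  control the positive ones, so values and gradients stay bounded for fixed \<epsilon>.\<close>

lemma approximable_picone:
  assumes \<Omega>: "open \<Omega>" "bounded \<Omega>" and p: "1 < p" "p < 2" and \<epsilon>: "0 < \<epsilon>"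
    and u: "approximable \<Omega> u D" and v: "approximable \<Omega> v E"
    and pos: "AE x in lebesgue_on \<Omega>. 0 < u x" "AE x in lebesgue_on \<Omega>. 0 < v x"
  defines "w \<equiv> \<lambda>x. picone p (u x + \<epsilon>) (v x + \<epsilon>)"
    and "F \<equiv> \<lambda>x. picone_grad p (u x + \<epsilon>) (v x + \<epsilon>) (D x) (E x)"
  shows "w \<in> W1p0 p \<Omega>" and "has_weak_gradient \<Omega> w F" and "integrable (lebesgue_on \<Omega>) F"
proof -
  from u obtain \<phi> B1 C1 where "approximates \<Omega> \<phi> B1 C1 u D"
    unfolding approximable_def by blast
  note \<phi> = approximatesD[OF this]
  from v obtain \<psi> B2 C2 where "approximates \<Omega> \<psi> B2 C2 v E"
    unfolding approximable_def by blast
  note \<psi> = approximatesD[OF this]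
  note s\<phi> = test_functions_smooth[OF \<phi>(3)] and s\<psi> = test_functions_smooth[OF \<psi>(3)]
  have p\<phi>: "0 < \<phi> n x + \<epsilon>" and p\<psi>: "0 < \<psi> n x + \<epsilon>" for n x
    using \<phi>(4)[of n x] \<psi>(4)[of n x] \<epsilon> by auto
  define \<omega> where "\<omega> n x = picone p (\<phi> n x + \<epsilon>) (\<psi> n x + \<epsilon>)" for n x
  have g: "grad (\<omega> n) x = picone_grad p (\<phi> n x + \<epsilon>) (\<psi> n x + \<epsilon>) (grad (\<phi> n) x) (grad (\<psi> n) x)" for n x
    unfolding \<omega>_def[abs_def] by (rule grad_picone[OF s\<phi> p\<phi> s\<psi> p\<psi>])
  have t: "\<omega> n \<in> test_functions \<Omega>" for n
  proof -
    obtain K where K: "compact K" "K \<subseteq> \<Omega>" "\<And>x. x \<notin> K \<Longrightarrow> \<phi> n x = 0"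
      using test_functionsE[OF \<phi>(3)[of n]] by metis
    obtain K' where K': "compact K'" "K' \<subseteq> \<Omega>" "\<And>x. x \<notin> K' \<Longrightarrow> \<psi> n x = 0"
      using test_functionsE[OF \<psi>(3)[of n]] by metis
    show ?thesis
    proof (rule test_functionsI)
      show "smooth_on UNIV (\<omega> n)"
        unfolding \<omega>_def[abs_def] picone_def
        by (intro smooth_on_diff smooth_on_mult smooth_on_add smooth_on_const smooth_on_powr_shift
            s\<phi> s\<psi> p\<phi> p\<psi> open_UNIV)
      show "compact (K \<union> K')" using K(1) K'(1) by (rule compact_Un)
      show "K \<union> K' \<subseteq> \<Omega>" using K(2) K'(2) by simp
      \<comment> \<open>Off both supports the two arguments equal \<epsilon>, and
        \<open>picone p \<epsilon> \<epsilon> = 0\<close>: the shift does not destroy the zero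
        boundary values.\<close>
      show "\<omega> n x = 0" if "x \<notin> K \<union> K'" for x
        using K(3)[of x] K'(3)[of x] that \<epsilon> by (simp add: \<omega>_def picone_eq)
    qed
  qed
  have up: "\<phi> n x + \<epsilon> \<le> B1 + \<epsilon>" "\<psi> n x + \<epsilon> \<le> B2 + \<epsilon>" for n x using \<phi>(5) \<psi>(5) by auto
  have b1: "(\<psi> n x + \<epsilon>) powr p \<le> (B2 + \<epsilon>) powr p" "(\<psi> n x + \<epsilon>) powr (p - 1) \<le> (B2 + \<epsilon>) powr (p - 1)" for n x
    using up(2)[of n x] p\<psi>[of n x] p by (auto intro!: powr_mono2)
  have b2: "(\<phi> n x + \<epsilon>) powr (1 - p) \<le> \<epsilon> powr (1 - p)" "(\<phi> n x + \<epsilon>) powr (- p) \<le> \<epsilon> powr (- p)" for n x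
    using \<phi>(4)[of n x] \<epsilon> p by (auto intro!: powr_mono2')
  define X where "X = (B2 + \<epsilon>) powr p * \<epsilon> powr (1 - p)"
  define Y where "Y = 1 + (p - 1) * ((B2 + \<epsilon>) powr p * \<epsilon> powr (- p))"
  define Y' where "Y' = p * ((B2 + \<epsilon>) powr (p - 1) * \<epsilon> powr (1 - p))"
  have wb: "\<bar>\<omega> n x\<bar> \<le> (B1 + \<epsilon>) + X" for n x
  proof -
    have "(\<psi> n x + \<epsilon>) powr p * (\<phi> n x + \<epsilon>) powr (1 - p) \<le> X"
      unfolding X_def using b1 b2 by (intro mult_mono) auto
    moreover have "0 \<le> (\<psi> n x + \<epsilon>) powr p * (\<phi> n x + \<epsilon>) powr (1 - p)" by simp
    ultimately show ?thesis using up(1)[of n x] p\<phi>[of n x] unfolding \<omega>_def picone_def by linarith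
  qed
  have gb: "norm (grad (\<omega> n) x) \<le> Y * C1 + Y' * C2" for n x
  proof -
    have "norm (picone_grad p (\<phi> n x + \<epsilon>) (\<psi> n x + \<epsilon>) (grad (\<phi> n) x) (grad (\<psi> n) x))
      \<le> norm ((1 + (p - 1) * ((\<psi> n x + \<epsilon>) powr p * (\<phi> n x + \<epsilon>) powr (- p))) *\<^sub>R grad (\<phi> n) x)
        + norm ((p * ((\<psi> n x + \<epsilon>) powr (p - 1) * (\<phi> n x + \<epsilon>) powr (1 - p))) *\<^sub>R grad (\<psi> n) x)"
      unfolding picone_grad_def by (rule norm_triangle_ineq4)
    also have "\<dots> = (1 + (p - 1) * ((\<psi> n x + \<epsilon>) powr p * (\<phi> n x + \<epsilon>) powr (- p))) * norm (grad (\<phi> n) x)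
        + (p * ((\<psi> n x + \<epsilon>) powr (p - 1) * (\<phi> n x + \<epsilon>) powr (1 - p))) * norm (grad (\<psi> n) x)"
      using p by (simp add: abs_of_nonneg add_nonneg_nonneg)
    also have "\<dots> \<le> Y * C1 + Y' * C2"
      unfolding Y_def Y'_def using p \<phi>(6)[of n x] \<psi>(6)[of n x] b1[of n x] b2[of n x]
      by (intro add_mono mult_mono order_refl) (auto intro!: add_nonneg_nonneg mult_nonneg_nonneg)
    finally show ?thesis unfolding g .
  qed
  have m: "w \<in> borel_measurable (lebesgue_on \<Omega>)" "F \<in> borel_measurable (lebesgue_on \<Omega>)"
    unfolding w_def F_def picone_def picone_grad_def using \<phi>(1,2) \<psi>(1,2) by measurable
  have lw: "AE x in lebesgue_on \<Omega>. (\<lambda>n. \<omega> n x) \<longlonglongrightarrow> w x"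
    using \<phi>(7) \<psi>(7) pos
  proof eventually_elim
    case (elim x)
    then show ?case
      unfolding \<omega>_def w_def picone_def using \<epsilon>
      by (intro tendsto_diff tendsto_mult tendsto_powr tendsto_add tendsto_const) auto
  qed
  have lF: "AE x in lebesgue_on \<Omega>. (\<lambda>n. grad (\<omega> n) x) \<longlonglongrightarrow> F x"
    using \<phi>(7,8) \<psi>(7,8) pos
  proof eventually_elim
    case (elim x)
    then show ?case
      unfolding g F_def picone_grad_def using \<epsilon>
      by (intro tendsto_diff tendsto_mult tendsto_powr tendsto_add tendsto_const tendsto_scaleR) auto
  qed
  from p have p1: "1 \<le> p" by simp
  note bounded_limit_W1p0[OF \<Omega> p1 t wb gb m lw lF]
  then show "w \<in> W1p0 p \<Omega>" "has_weak_gradient \<Omega> w F" "integrable (lebesgue_on \<Omega>) F" by auto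
qed

text \<open>Zero trace excludes an additive constant. The squared differences of the approximants
  are test functions; their integrals tend to the integral of \<open>(u x - v x)\<^sup>2\<close>
  and, after integration by parts, to 0 because the limit gradients agree.\<close>

lemma approximable_eq_of_grad_eq:
  assumes \<Omega>: "open \<Omega>" "bounded \<Omega>" and u: "approximable \<Omega> u D" and v: "approximable \<Omega> v E"
    and eq: "AE x in lebesgue_on \<Omega>. D x = E x"
  shows "AE x in lebesgue_on \<Omega>. u x = v x"
proof -
  have \<Omega>': "\<Omega> \<in> sets lebesgue" "\<Omega> \<in> lmeasurable" using \<Omega> by (auto simp: lmeasurable_open)
  interpret fin: finite_measure "lebesgue_on \<Omega>" using \<Omega>'(2) by (rule finite_measure_lebesgue_on)
  from u obtain \<phi> B1 C1 where "approximates \<Omega> \<phi> B1 C1 u D"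
    unfolding approximable_def by blast
  note \<phi> = approximatesD[OF this]
  from v obtain \<psi> B2 C2 where "approximates \<Omega> \<psi> B2 C2 v E"
    unfolding approximable_def by blast
  note \<psi> = approximatesD[OF this]
  note s\<phi> = test_functions_smooth[OF \<phi>(3)] and s\<psi> = test_functions_smooth[OF \<psi>(3)]
  obtain b :: 'a where b: "b \<in> Basis" using nonempty_Basis by blast
  obtain R where R: "\<And>x. x \<in> \<Omega> \<Longrightarrow> norm x \<le> R" using \<Omega>(2) bounded_iff by metis
  define f where "f n x = \<phi> n x - \<psi> n x" for n x
  have sf: "smooth_on UNIV (f n)" for n
    unfolding f_def[abs_def] by (rule smooth_on_diff[OF open_UNIV s\<phi> s\<psi>])
  have gf: "grad (f n) x = grad (\<phi> n) x - grad (\<psi> n) x" for n x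
  proof (rule grad_unique)
    show "(f n has_derivative (\<lambda>h. (grad (\<phi> n) x - grad (\<psi> n) x) \<bullet> h)) (at x)"
      unfolding f_def[abs_def] inner_diff_left
      by (intro has_derivative_diff has_derivative_grad s\<phi> s\<psi>)
  qed
  define A where "A = B1 + B2"
  define C where "C = C1 + C2"
  have fA: "\<bar>f n x\<bar> \<le> A" for n x
    using \<phi>(4,5)[of n x] \<psi>(4,5)[of n x] by (simp add: f_def A_def)
  have gC: "norm (grad (f n) x) \<le> C" for n x
    unfolding gf C_def using \<phi>(6)[of n x] \<psi>(6)[of n x] by (intro order_trans[OF norm_triangle_ineq4] add_mono)
  have A0: "A \<ge> 0" and C0: "C \<ge> 0" using order_trans[OF abs_ge_zero fA] order_trans[OF norm_ge_zero gC] by auto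
  have tf: "(\<lambda>x. f n x * f n x) \<in> test_functions \<Omega>" for n
  proof -
    obtain K where K: "compact K" "K \<subseteq> \<Omega>" "\<And>x. x \<notin> K \<Longrightarrow> \<phi> n x = 0"
      using test_functionsE[OF \<phi>(3)[of n]] by metis
    obtain K' where K': "compact K'" "K' \<subseteq> \<Omega>" "\<And>x. x \<notin> K' \<Longrightarrow> \<psi> n x = 0"
      using test_functionsE[OF \<psi>(3)[of n]] by metis
    show ?thesis
    proof (rule test_functionsI)
      show "smooth_on UNIV (\<lambda>x. f n x * f n x)" by (rule smooth_on_mult[OF open_UNIV sf sf])
      show "compact (K \<union> K')" using K(1) K'(1) by (rule compact_Un)
      show "K \<union> K' \<subseteq> \<Omega>" using K(2) K'(2) by simp
      show "f n x * f n x = 0" if "x \<notin> K \<union> K'" for x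
        using K(3)[of x] K'(3)[of x] that by (simp add: f_def)
    qed
  qed
  \<comment> \<open>Integrating \<open>f\<^sub>n\<^sup>2 \<partial>\<^sub>b x\<^sub>b\<close> by parts takes the place of a Poincare inequality.\<close>
  have ibp: "(LINT x|lebesgue_on \<Omega>. f n x * f n x) = - (LINT x|lebesgue_on \<Omega>. 2 * f n x * (grad (f n) x \<bullet> b) * (x \<bullet> b))" for n
  proof -
    have "((\<lambda>x::'a. x \<bullet> b) has_derivative (\<lambda>h. h \<bullet> b)) (at x)" for x
      by (auto intro!: derivative_eq_intros)
    then have "frechet_derivative (\<lambda>x::'a. x \<bullet> b) (at x) b = 1" for x
      using fun_cong[OF frechet_derivative_at, of "\<lambda>x::'a. x \<bullet> b" "\<lambda>h. h \<bullet> b" x b] b by simp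
    moreover have "grad (\<lambda>x. f n x * f n x) x \<bullet> b = 2 * f n x * (grad (f n) x \<bullet> b)" for x
      by (simp add: grad_mult[OF sf sf] inner_add_left)
    ultimately show ?thesis
      using integration_by_parts_test_function[OF tf smooth_on_inner[of UNIV b] b \<Omega>'(1)] by simp
  qed
  note mf = continuous_imp_lebesgue_on_measurable[OF smooth_on_continuous[OF sf], of _ \<Omega>]
  note mg = continuous_imp_lebesgue_on_measurable[OF continuous_grad[OF sf], of _ \<Omega>]
  have mx: "(\<lambda>x. x \<bullet> b) \<in> borel_measurable (lebesgue_on \<Omega>)"
    by (rule continuous_imp_lebesgue_on_measurable) (intro continuous_intros)
  have l1: "(\<lambda>n. LINT x|lebesgue_on \<Omega>. f n x * f n x) \<longlonglongrightarrow> (LINT x|lebesgue_on \<Omega>. (u x - v x) * (u x - v x))"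
  proof (rule integral_dominated_convergence)
    show "integrable (lebesgue_on \<Omega>) (\<lambda>x. A * A)" by simp
    show "AE x in lebesgue_on \<Omega>. norm (f n x * f n x) \<le> A * A" for n
      unfolding real_norm_def abs_mult by (intro AE_I2 mult_mono fA A0 abs_ge_zero)
    show "AE x in lebesgue_on \<Omega>. (\<lambda>n. f n x * f n x) \<longlonglongrightarrow> (u x - v x) * (u x - v x)"
      using \<phi>(7) \<psi>(7) unfolding f_def by eventually_elim (intro tendsto_intros)
    show "(\<lambda>x. f n x * f n x) \<in> borel_measurable (lebesgue_on \<Omega>)" for n
      using mf[of n] by measurable
    show "(\<lambda>x. (u x - v x) * (u x - v x)) \<in> borel_measurable (lebesgue_on \<Omega>)"
      using \<phi>(1) \<psi>(1) by measurable
  qed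
  have l2: "(\<lambda>n. LINT x|lebesgue_on \<Omega>. 2 * f n x * (grad (f n) x \<bullet> b) * (x \<bullet> b)) \<longlonglongrightarrow> (LINT x|lebesgue_on \<Omega>. 0)"
  proof (rule integral_dominated_convergence)
    show "integrable (lebesgue_on \<Omega>) (\<lambda>x. 2 * A * C * R)" by simp
    show "AE x in lebesgue_on \<Omega>. norm (2 * f n x * (grad (f n) x \<bullet> b) * (x \<bullet> b)) \<le> 2 * A * C * R" for n
    proof (intro AE_I2)
      fix x assume "x \<in> space (lebesgue_on \<Omega>)"
      then have "\<bar>x \<bullet> b\<bar> \<le> R" using Basis_le_norm[OF b, of x] R[of x] by simp
      moreover have "\<bar>grad (f n) x \<bullet> b\<bar> \<le> C" using Basis_le_norm[OF b, of "grad (f n) x"] gC[of n x] by simp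
      ultimately show "norm (2 * f n x * (grad (f n) x \<bullet> b) * (x \<bullet> b)) \<le> 2 * A * C * R"
        using fA[of n x] A0 C0 unfolding real_norm_def abs_mult by (intro mult_mono mult_nonneg_nonneg) auto
    qed
    show "AE x in lebesgue_on \<Omega>. (\<lambda>n. 2 * f n x * (grad (f n) x \<bullet> b) * (x \<bullet> b)) \<longlonglongrightarrow> 0"
      using \<phi>(7,8) \<psi>(7,8) eq
    proof eventually_elim
      case (elim x)
      have "(\<lambda>n. 2 * f n x * (grad (f n) x \<bullet> b) * (x \<bullet> b)) \<longlonglongrightarrow> 2 * (u x - v x) * ((D x - E x) \<bullet> b) * (x \<bullet> b)"
        unfolding gf unfolding f_def using elim by (intro tendsto_intros)
      then show ?case using elim(5) by simp
    qed
    show "(\<lambda>x. 2 * f n x * (grad (f n) x \<bullet> b) * (x \<bullet> b)) \<in> borel_measurable (lebesgue_on \<Omega>)" for n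
      by (intro borel_measurable_times borel_measurable_inner borel_measurable_const mf mg mx)
  qed simp
  have int0: "(LINT x|lebesgue_on \<Omega>. (u x - v x) * (u x - v x)) = 0"
    using LIMSEQ_unique[OF l1] tendsto_minus[OF l2] by (simp add: ibp)
  have "AE x in lebesgue_on \<Omega>. norm (u x - v x) \<le> A"
    by (rule AE_limit_norm_le[where f = f]) (use fA \<phi>(7) \<psi>(7) f_def in \<open>auto elim!: eventually_elim2 intro: tendsto_diff\<close>)
  then have "AE x in lebesgue_on \<Omega>. norm ((u x - v x) * (u x - v x)) \<le> A * A"
    unfolding real_norm_def abs_mult by eventually_elim (intro mult_mono A0 abs_ge_zero)
  then have "integrable (lebesgue_on \<Omega>) (\<lambda>x. (u x - v x) * (u x - v x))"
    using \<phi>(1) \<psi>(1) by (intro fin.integrable_const_bound) auto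
  then have "AE x in lebesgue_on \<Omega>. (u x - v x) * (u x - v x) = 0"
    using integral_nonneg_eq_0_iff_AE[of "lebesgue_on \<Omega>" "\<lambda>x. (u x - v x) * (u x - v x)"] int0 by simp
  then show ?thesis by eventually_elim simp
qed

section \<open>Uniqueness\<close>

text \<open>Fatou's lemma for the nonnegative functions \<open>W n + b\<close> bounds the integral
  of \<open>E + b\<close> by that of \<open>b\<close>, so that of \<open>E\<close> is not positive.
  Neither measurability nor integrability of \<open>E\<close> is assumed, hence the extended
  nonnegative integral and the measurable lower limit \<open>L\<close> in place of
  \<open>E + b\<close>.\<close>

lemma Fatou_squeeze:
  fixes W :: "nat \<Rightarrow> 'a \<Rightarrow> real"
  assumes W: "\<And>n. integrable M (W n)" "\<And>n. (LINT x|M. W n x) = 0"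
    and b: "integrable M b" "AE x in M. 0 \<le> b x" "\<And>n. AE x in M. - b x \<le> W n x"
    and lim: "AE x in M. (\<lambda>n. W n x) \<longlonglongrightarrow> E x" and E: "AE x in M. 0 \<le> E x"
  shows "AE x in M. E x = 0"
proof -
  define L where "L x = liminf (\<lambda>n. ennreal (W n x + b x))" for x
  have [measurable]: "W n \<in> borel_measurable M" "b \<in> borel_measurable M" for n
    using W b by auto
  have L [measurable]: "L \<in> borel_measurable M" unfolding L_def[abs_def] by measurable
  have LE: "AE x in M. L x = ennreal (E x + b x)"
    using lim
  proof eventually_elim
    case (elim x)
    have "(\<lambda>n. ennreal (W n x + b x)) \<longlonglongrightarrow> ennreal (E x + b x)"
      by (intro tendsto_ennrealI tendsto_add elim tendsto_const)
    then show ?case unfolding L_def by (intro lim_imp_Liminf) auto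
  qed
  have int: "(\<integral>\<^sup>+x. ennreal (W n x + b x) \<partial>M) = ennreal (LINT x|M. b x)" for n
  proof -
    have "AE x in M. 0 \<le> W n x + b x" using b(3)[of n] by eventually_elim simp
    then have "(\<integral>\<^sup>+x. ennreal (W n x + b x) \<partial>M) = ennreal (LINT x|M. W n x + b x)"
      using W(1) b(1) by (intro nn_integral_eq_integral) auto
    then show ?thesis using W b(1) by simp
  qed
  have "(\<integral>\<^sup>+x. L x \<partial>M) \<le> liminf (\<lambda>n. \<integral>\<^sup>+x. ennreal (W n x + b x) \<partial>M)"
    unfolding L_def by (rule nn_integral_liminf) measurable
  also have "\<dots> = (\<integral>\<^sup>+x. ennreal (b x) \<partial>M)"
    unfolding int using b by (simp add: Liminf_const nn_integral_eq_integral)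
  finally have le: "(\<integral>\<^sup>+x. L x \<partial>M) \<le> (\<integral>\<^sup>+x. ennreal (b x) \<partial>M)" .
  have fin: "(\<integral>\<^sup>+x. ennreal (b x) \<partial>M) \<noteq> \<infinity>"
    using b by (simp add: nn_integral_eq_integral)
  have "AE x in M. ennreal (b x) \<le> L x"
    using LE E by eventually_elim (simp add: ennreal_leI)
  then have "(\<integral>\<^sup>+x. L x - ennreal (b x) \<partial>M) = (\<integral>\<^sup>+x. L x \<partial>M) - (\<integral>\<^sup>+x. ennreal (b x) \<partial>M)"
    using fin by (intro nn_integral_diff) auto
  also have "\<dots> = 0"
    using le fin by (intro diff_eq_0_ennreal) (auto simp: less_top intro: le_less_trans)
  finally have "AE x in M. L x - ennreal (b x) = 0"
    by (subst (asm) nn_integral_0_iff_AE) auto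
  then show ?thesis
    using LE E b(2)
  proof eventually_elim
    case (elim x)
    then have "ennreal (E x) = 0" using ennreal_minus[of "b x" "E x + b x"] by simp
    then show ?case using elim(3) by (simp add: ennreal_eq_0_iff)
  qed
qed

lemma AE_norm_less_of_Linf:
  assumes "Linf_norm \<Omega> f < ereal R"
  shows "AE x in lebesgue_on \<Omega>. norm (f x) < R"
proof -
  have "AE x in lebesgue_on \<Omega>. ereal (norm (f x)) \<le> Linf_norm \<Omega> f"
    unfolding Linf_norm_def by (rule esssup_AE)
  then show ?thesis
    by eventually_elim (use assms in \<open>metis le_less_trans less_ereal.simps(1)\<close>)
qed

text \<open>The essential supremum itself lies strictly below the radius, so the strict bound holds
  at almost every point. This pointwise form is what the Picone inequality needs.\<close>

lemma Z_set_approximable: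
  assumes dom: "bounded_smooth_domain \<Omega>" and p: "1 < p" "p < 2"
    and u: "u \<in> Z_set p \<Omega>" and pos: "AE x in lebesgue_on \<Omega>. 0 < u x"
  shows "approximable \<Omega> u (weak_gradient \<Omega> u)"
    and "AE x in lebesgue_on \<Omega>. (norm (weak_gradient \<Omega> u x))\<^sup>2 < (2 - p) / (p - 1)"
proof -
  have \<Omega>: "open \<Omega>" using dom by (simp add: bounded_smooth_domain_def)
  define R where "R = ((2 - p) / (p - 1)) powr (1 / 2)"
  have uW: "u \<in> W1p0 1 \<Omega>" "mem_Linf \<Omega> u" and Zb: "Linf_norm \<Omega> (weak_gradient \<Omega> u) < ereal R"
    using u by (auto simp: Z_set_def W1inf0_def W1inf_def R_def)
  obtain D0 where "has_weak_gradient \<Omega> u D0" using uW(1) by (auto simp: W1p0_def W1p_def)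
  then have D: "has_weak_gradient \<Omega> u (weak_gradient \<Omega> u)" by (rule has_weak_gradient_weak_gradient)
  have DR: "AE x in lebesgue_on \<Omega>. norm (weak_gradient \<Omega> u x) < R"
    by (rule AE_norm_less_of_Linf[OF Zb])
  have R: "R \<ge> 0" "R\<^sup>2 = (2 - p) / (p - 1)"
    using p by (simp_all add: R_def powr_half_sqrt)
  show "AE x in lebesgue_on \<Omega>. (norm (weak_gradient \<Omega> u x))\<^sup>2 < (2 - p) / (p - 1)"
    using DR unfolding R(2)[symmetric] by eventually_elim (simp add: power_strict_mono)
  obtain b where b: "Linf_norm \<Omega> u < ereal b"
    using uW(2) less_PInf_Ex_of_nat[of "Linf_norm \<Omega> u"] by (auto simp: mem_Linf_def)
  have B: "AE x in lebesgue_on \<Omega>. u x \<le> max b 0"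
    using AE_norm_less_of_Linf[OF b] by eventually_elim auto
  have DM: "AE x in lebesgue_on \<Omega>. norm (weak_gradient \<Omega> u x) \<le> R"
    using DR by eventually_elim simp
  obtain \<phi> where \<phi>: "\<And>n::nat. \<phi> n \<in> test_functions \<Omega>" "\<And>n x. 0 \<le> \<phi> n x" "\<And>n x. \<phi> n x \<le> max b 0"
    "\<And>n x. norm (grad (\<phi> n) x) \<le> R"
    "AE x in lebesgue_on \<Omega>. (\<lambda>n. \<phi> n x) \<longlonglongrightarrow> u x"
    "AE x in lebesgue_on \<Omega>. (\<lambda>n. grad (\<phi> n) x) \<longlonglongrightarrow> weak_gradient \<Omega> u x"
    by (rule positive_approximation[OF dom uW(1) D DM R(1) B _ pos]) (simp, rule that)
  then show "approximable \<Omega> u (weak_gradient \<Omega> u)"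
    unfolding approximable_def approximates_def using has_weak_gradient_measurable[OF \<Omega> D] by blast
qed

text \<open>A concave function is continuous in the interior of its domain, and
  \<open>s powr p\<close> is a continuous inverse of the substitution. The continuity serves to pass
  from rational to real scaling factors.\<close>

lemma continuous_on_of_concave_power:
  fixes G :: "real \<Rightarrow> real"
  assumes "concave_on {0..} (\<lambda>t. G (t powr (1 / p)))" "1 < p"
  shows "continuous_on {0<..} G"
proof -
  have "convex_on {0<..} (\<lambda>t. - G (t powr (1 / p)))"
    using assms(1) unfolding concave_on_def by (rule convex_on_subset) auto
  then have "continuous_on {0<..} (\<lambda>t. - G (t powr (1 / p)))"
    by (rule convex_on_continuous[OF open_greaterThan])
  then have "continuous_on {0<..} (\<lambda>t. G (t powr (1 / p)))"
    using continuous_on_minus by fastforce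
  then have "continuous_on {0<..} (\<lambda>s. G ((s powr p) powr (1 / p)))"
    by (rule continuous_on_compose2) (auto intro!: continuous_intros)
  moreover have "G ((s powr p) powr (1 / p)) = G s" if "s \<in> {0<..}" for s
    using that assms(2) by (simp add: powr_powr)
  ultimately show ?thesis by (metis (no_types, lifting) continuous_on_cong)
qed

text \<open>The factor that carries \<open>u x\<close> to \<open>v x\<close> varies with
  \<open>x\<close>, while the exceptional set of the scaled inequality depends on the factor.
  Rational factors share one exceptional set, and continuity in the factor extends the inequality
  from them to \<open>v x / u x\<close>.\<close>

lemma supergradient:
  fixes G :: "'a::euclidean_space \<Rightarrow> real \<Rightarrow> real"
  assumes \<Omega>: "open \<Omega>" "bounded \<Omega>" and p: "1 < p" "p < 2"
    and u: "approximable \<Omega> u D" and pos: "AE x in lebesgue_on \<Omega>. 0 < u x" "AE x in lebesgue_on \<Omega>. 0 < v x"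
    and conc: "\<And>x. x \<in> \<Omega> \<Longrightarrow> concave_on {0..} (\<lambda>t. G x (t powr (1 / p)))"
    and intG: "\<And>w. w \<in> W1p0 p \<Omega> \<Longrightarrow> integrable (lebesgue_on \<Omega>) (\<lambda>x. G x (w x))"
    and inth: "\<And>w. w \<in> W1p0 p \<Omega> \<Longrightarrow> integrable (lebesgue_on \<Omega>) (\<lambda>x. h x * w x)"
    and der: "has_W1p0_derivative p \<Omega> (\<lambda>w. LINT x|lebesgue_on \<Omega>. G x (w x)) (\<lambda>v. LINT x|lebesgue_on \<Omega>. h x * v x) u"
  shows "AE x in lebesgue_on \<Omega>. G x (v x) - G x (u x) \<le> h x * u x powr (1 - p) * (v x powr p - u x powr p) / p"
proof -
  have "AE x in lebesgue_on \<Omega>. \<forall>\<kappa>\<in>\<rat> \<inter> {0<..}. G x (\<kappa> * u x) - G x (u x) \<le> h x * u x * (\<kappa> powr p - 1) / p"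
  proof (subst AE_ball_countable)
    show "countable (\<rat> \<inter> {0<..} :: real set)" by (rule countable_Int1[OF countable_rat])
    show "\<forall>\<kappa>\<in>\<rat> \<inter> {0<..}. AE x in lebesgue_on \<Omega>. G x (\<kappa> * u x) - G x (u x) \<le> h x * u x * (\<kappa> powr p - 1) / p"
      using supergradient_scaled[OF \<Omega> p u pos(1) conc intG inth der] by auto
  qed
  moreover have "AE x in lebesgue_on \<Omega>. x \<in> \<Omega>" by (rule AE_I2) simp
  ultimately show ?thesis
    using pos
  proof eventually_elim
    case (elim x)
    define f where "f \<kappa> = h x * u x * (\<kappa> powr p - 1) / p - (G x (\<kappa> * u x) - G x (u x))" for \<kappa>
    have "continuous_on {0<..} (\<lambda>\<kappa>. G x (\<kappa> * u x))"
      by (rule continuous_on_compose2[OF continuous_on_of_concave_power[OF conc[OF elim(2)] p(1)]])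
        (use elim(3) in \<open>auto intro!: continuous_intros\<close>)
    then have cont: "continuous_on {0<..} f"
      unfolding f_def[abs_def] by (intro continuous_intros) (use p in auto)
    define \<kappa> where "\<kappa> = v x / u x"
    have \<kappa>: "\<kappa> > 0" using elim by (simp add: \<kappa>_def)
    have "0 \<le> f \<kappa>"
    proof (rule ccontr)
      assume neg: "\<not> 0 \<le> f \<kappa>"
      have "isCont f \<kappa>" using cont \<kappa> by (simp add: continuous_on_eq_continuous_at)
      then have "\<forall>\<^sub>F z in at \<kappa>. f z < 0"
        using neg by (intro order_tendstoD(2)[of f "f \<kappa>"]) (auto simp: isCont_def)
      then obtain d where d: "d > 0" "\<And>z. z \<noteq> \<kappa> \<Longrightarrow> dist z \<kappa> < d \<Longrightarrow> f z < 0"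
        by (auto simp: eventually_at)
      obtain q where q: "q \<in> \<rat>" "\<kappa> < q" "q < \<kappa> + d"
        using Rats_dense_in_real[of \<kappa> "\<kappa> + d"] d(1) by auto
      then have "f q < 0" by (intro d(2)) (auto simp: dist_real_def)
      moreover have "0 \<le> f q" using elim(1) q \<kappa> by (simp add: f_def)
      ultimately show False by simp
    qed
    moreover have "\<kappa> * u x = v x" using elim by (simp add: \<kappa>_def)
    moreover have "u x * (\<kappa> powr p - 1) = u x powr (1 - p) * (v x powr p - u x powr p)"
    proof -
      have "u x = u x powr (1 - p) * u x powr p" using elim by (simp flip: powr_add)
      moreover have "v x powr p = \<kappa> powr p * u x powr p"
        using elim \<kappa> by (simp flip: powr_mult add: \<kappa>_def)
      ultimately show ?thesis by (metis (no_types, opaque_lifting) left_diff_distrib mult.assoc mult.commute mult_1)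
    qed
    ultimately show ?case by (simp add: f_def mult.assoc)
  qed
qed

theorem theorem5p1:
  fixes \<Omega> :: "'a::euclidean_space set" and g :: "'a \<Rightarrow> real \<Rightarrow> real" and p :: real
  assumes "bounded_smooth_domain \<Omega>"
    and "\<And>x t. x \<in> \<Omega> \<Longrightarrow> interval_lebesgue_integrable lebesgue (ereal 0) (ereal t) (g x)"
    and "1 < p" and "p < 2"
    and "\<And>x. x \<in> \<Omega> \<Longrightarrow> concave_on {0..} (\<lambda>t. primitive g x (t powr (1 / p)))"
    and "\<And>u. u \<in> W1p0 p \<Omega> \<Longrightarrow> integrable (lebesgue_on \<Omega>) (\<lambda>x. primitive g x (u x))"
    and "\<And>u v. u \<in> W1p0 p \<Omega> \<Longrightarrow> v \<in> W1p0 p \<Omega> \<Longrightarrow>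
           integrable (lebesgue_on \<Omega>) (\<lambda>x. g x (u x) * v x)"
    and "\<And>u. u \<in> W1p0 p \<Omega> \<Longrightarrow>
           has_W1p0_derivative p \<Omega> (\<lambda>w. LINT x|lebesgue_on \<Omega>. primitive g x (w x))
             (\<lambda>v. LINT x|lebesgue_on \<Omega>. g x (u x) * v x) u"
  shows "\<forall>u v. u \<in> Z_set p \<Omega> \<and> positive_on \<Omega> u \<and> weak_solution p \<Omega> g u \<and>
               v \<in> Z_set p \<Omega> \<and> positive_on \<Omega> v \<and> weak_solution p \<Omega> g v \<longrightarrow>
               (AE x in lebesgue_on \<Omega>. u x = v x)"
proof (intro allI impI, elim conjE)
  fix u v
  assume uZ: "u \<in> Z_set p \<Omega>" and "positive_on \<Omega> u" and uS: "weak_solution p \<Omega> g u"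
    and vZ: "v \<in> Z_set p \<Omega>" and "positive_on \<Omega> v" and vS: "weak_solution p \<Omega> g v"
  then have pos: "AE x in lebesgue_on \<Omega>. 0 < u x" "AE x in lebesgue_on \<Omega>. 0 < v x"
    by (auto simp: positive_on_def)
  note p = assms(3,4)
  have p1: "1 \<le> p" using p by simp
  have \<Omega>: "open \<Omega>" "bounded \<Omega>" using assms(1) by (auto simp: bounded_smooth_domain_def)
  define D where "D = weak_gradient \<Omega> u"
  define E where "E = weak_gradient \<Omega> v"
  note Zu = Z_set_approximable[OF assms(1) p uZ pos(1), folded D_def]
  note Zv = Z_set_approximable[OF assms(1) p vZ pos(2), folded E_def]
  \<comment> \<open>\<open>Z_set\<close> provides zero trace with exponent 1 only. Membership with
    exponent \<open>p\<close>, required for testing and for the Frechet derivative, comes from the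
    bounded approximants.\<close>
  have uW: "u \<in> W1p0 p \<Omega>" and vW: "v \<in> W1p0 p \<Omega>"
    using approximable_W1p0(1)[OF \<Omega> p1 Zu(1)] approximable_W1p0(1)[OF \<Omega> p1 Zv(1)] .
  note intu = assms(7)[OF uW] and intv = assms(7)[OF vW]
  have superu: "AE x in lebesgue_on \<Omega>. primitive g x (v x) - primitive g x (u x)
      \<le> g x (u x) * u x powr (1 - p) * (v x powr p - u x powr p) / p"
    by (rule supergradient[OF \<Omega> p Zu(1) pos assms(5,6) intu assms(8)[OF uW]])
  have superv: "AE x in lebesgue_on \<Omega>. primitive g x (u x) - primitive g x (v x)
      \<le> g x (v x) * v x powr (1 - p) * (u x powr p - v x powr p) / p"
    by (rule supergradient[OF \<Omega> p Zv(1) pos(2,1) assms(5,6) intv assms(8)[OF vW]])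
  \<comment> \<open>When the two supergradient inequalities are added, the potentials cancel; what
    is left is the monotonicity of \<open>g x s * s powr (1 - p)\<close> between the values of the
    two solutions.\<close>
  have mono: "AE x in lebesgue_on \<Omega>.
    (g x (u x) * u x powr (1 - p) - g x (v x) * v x powr (1 - p)) * (u x powr p - v x powr p) \<le> 0"
    using superu superv
  proof eventually_elim
    case (elim x)
    have "0 \<le> g x (u x) * u x powr (1 - p) * (v x powr p - u x powr p) / p
        + g x (v x) * v x powr (1 - p) * (u x powr p - v x powr p) / p"
      using elim by linarith
    also have "\<dots> = - ((g x (u x) * u x powr (1 - p) - g x (v x) * v x powr (1 - p)) * (u x powr p - v x powr p)) / p"
      by (simp add: algebra_simps flip: add_divide_distrib diff_divide_distrib)
    finally show ?case using p by (simp add: divide_le_0_iff)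
  qed
  define \<epsilon> where "\<epsilon> n = 1 / real (Suc n)" for n
  have \<epsilon>: "\<epsilon> n > 0" for n by (simp add: \<epsilon>_def)
  have \<epsilon>0: "\<epsilon> \<longlonglongrightarrow> 0" unfolding \<epsilon>_def by real_asymp
  \<comment> \<open>\<open>Q\<close> collects the left-hand and \<open>R\<close> the right-hand
    integrands of the two tested equations. The shift \<open>s\<close> is a parameter so that the
    same expressions cover \<open>\<epsilon> n\<close> and the limit case 0.\<close>
  define Q where "Q s x = (D x \<bullet> picone_grad p (u x + s) (v x + s) (D x) (E x)) / sqrt (1 + (norm (D x))\<^sup>2)
    + (E x \<bullet> picone_grad p (v x + s) (u x + s) (E x) (D x)) / sqrt (1 + (norm (E x))\<^sup>2)" for s x
  define R where "R s x = g x (u x) * picone p (u x + s) (v x + s) + g x (v x) * picone p (v x + s) (u x + s)" for s x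
  \<comment> \<open>One tested equation, stated for a generic pair because it is used twice, with
    the two solutions interchanged.\<close>
  have half: "integrable (lebesgue_on \<Omega>)
        (\<lambda>x. (A x \<bullet> picone_grad p (a x + \<epsilon> n) (b x + \<epsilon> n) (A x) (B x)) / sqrt (1 + (norm (A x))\<^sup>2))"
      "integrable (lebesgue_on \<Omega>) (\<lambda>x. g x (a x) * picone p (a x + \<epsilon> n) (b x + \<epsilon> n))"
      "(LINT x|lebesgue_on \<Omega>. (A x \<bullet> picone_grad p (a x + \<epsilon> n) (b x + \<epsilon> n) (A x) (B x)) / sqrt (1 + (norm (A x))\<^sup>2))
        = (LINT x|lebesgue_on \<Omega>. g x (a x) * picone p (a x + \<epsilon> n) (b x + \<epsilon> n))"
    if a: "approximable \<Omega> a A" "AE x in lebesgue_on \<Omega>. 0 < a x" "a \<in> W1p0 p \<Omega>" "weak_solution p \<Omega> g a"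
      and b: "approximable \<Omega> b B" "AE x in lebesgue_on \<Omega>. 0 < b x" and A: "A = weak_gradient \<Omega> a"
    for a b A B n
  proof -
    note P = approximable_picone[OF \<Omega> p \<epsilon> a(1) b(1) a(2) b(2), of n]
    have [measurable]: "A \<in> borel_measurable (lebesgue_on \<Omega>)" using a(1) by (auto simp: approximable_def approximates_def)
    define F where "F x = picone_grad p (a x + \<epsilon> n) (b x + \<epsilon> n) (A x) (B x)" for x
    define w where "w x = picone p (a x + \<epsilon> n) (b x + \<epsilon> n)" for x
    have [measurable]: "F \<in> borel_measurable (lebesgue_on \<Omega>)"
      using has_weak_gradient_measurable(2)[OF \<Omega>(1) P(2)] by (simp add: F_def[abs_def])
    have [measurable]: "weak_gradient \<Omega> w \<in> borel_measurable (lebesgue_on \<Omega>)"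
      using has_weak_gradient_measurable(2)[OF \<Omega>(1) has_weak_gradient_weak_gradient[OF P(2)]]
      by (simp add: w_def[abs_def])
    show "integrable (lebesgue_on \<Omega>)
        (\<lambda>x. (A x \<bullet> picone_grad p (a x + \<epsilon> n) (b x + \<epsilon> n) (A x) (B x)) / sqrt (1 + (norm (A x))\<^sup>2))"
      unfolding F_def[symmetric]
    proof (rule Bochner_Integration.integrable_bound)
      show "integrable (lebesgue_on \<Omega>) F" using P(3) by (simp add: F_def[abs_def])
      show "AE x in lebesgue_on \<Omega>. norm ((A x \<bullet> F x) / sqrt (1 + (norm (A x))\<^sup>2)) \<le> norm (F x)"
      proof (intro AE_I2)
        fix x
        have s: "0 < sqrt (1 + (norm (A x))\<^sup>2)" by (simp add: add_pos_nonneg)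
        have "norm (A x) = sqrt ((norm (A x))\<^sup>2)" by simp
        also have "\<dots> \<le> sqrt (1 + (norm (A x))\<^sup>2)" by (rule real_sqrt_le_mono) simp
        finally have "\<bar>A x \<bullet> F x\<bar> \<le> sqrt (1 + (norm (A x))\<^sup>2) * norm (F x)"
          using Cauchy_Schwarz_ineq2[of "A x" "F x"] by (meson mult_right_mono norm_ge_zero order_trans)
        then show "norm ((A x \<bullet> F x) / sqrt (1 + (norm (A x))\<^sup>2)) \<le> norm (F x)"
          using s by (simp add: abs_divide pos_divide_le_eq mult.commute)
      qed
    qed measurable
    show "integrable (lebesgue_on \<Omega>) (\<lambda>x. g x (a x) * picone p (a x + \<epsilon> n) (b x + \<epsilon> n))"
      by (rule assms(7)[OF a(3) P(1)])
    have "(LINT x|lebesgue_on \<Omega>. (A x \<bullet> F x) / sqrt (1 + (norm (A x))\<^sup>2))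
      = (LINT x|lebesgue_on \<Omega>. (A x \<bullet> weak_gradient \<Omega> w x) / sqrt (1 + (norm (A x))\<^sup>2))"
    proof (rule integral_cong_AE)
      show "AE x in lebesgue_on \<Omega>. (A x \<bullet> F x) / sqrt (1 + (norm (A x))\<^sup>2)
          = (A x \<bullet> weak_gradient \<Omega> w x) / sqrt (1 + (norm (A x))\<^sup>2)"
        using weak_gradient_AE_eq[OF \<Omega>(1) P(2)] unfolding w_def[abs_def] F_def
        by eventually_elim simp
    qed measurable
    also have "\<dots> = (LINT x|lebesgue_on \<Omega>. g x (a x) * w x)"
      using a(4) P(1) unfolding weak_solution_def A w_def[abs_def] by blast
    finally show "(LINT x|lebesgue_on \<Omega>. (A x \<bullet> picone_grad p (a x + \<epsilon> n) (b x + \<epsilon> n) (A x) (B x)) / sqrt (1 + (norm (A x))\<^sup>2))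
        = (LINT x|lebesgue_on \<Omega>. g x (a x) * picone p (a x + \<epsilon> n) (b x + \<epsilon> n))"
      by (simp add: F_def w_def)
  qed
  note hu = half[OF Zu(1) pos(1) uW uS Zv(1) pos(2) D_def]
  note hv = half[OF Zv(1) pos(2) vW vS Zu(1) pos(1) E_def]
  \<comment> \<open>The factor 2 arises because each of the two terms of \<open>R\<close> obeys the
    same bound. Integrability comes from that of \<open>g x (u x)\<close> and
    \<open>g x (v x)\<close> multiplied by \<open>u\<close> and by \<open>v\<close>.\<close>
  define b where "b x = 2 * (p * (\<bar>g x (u x)\<bar> + \<bar>g x (v x)\<bar>) * \<bar>u x - v x\<bar>)" for x
  have ib: "integrable (lebesgue_on \<Omega>) b"
  proof -
    have "integrable (lebesgue_on \<Omega>) (\<lambda>x. \<bar>g x (u x) * u x - g x (u x) * v x\<bar> + \<bar>g x (v x) * u x - g x (v x) * v x\<bar>)"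
      by (intro Bochner_Integration.integrable_add integrable_abs Bochner_Integration.integrable_diff
          intu intv uW vW)
    then have "integrable (lebesgue_on \<Omega>) (\<lambda>x. 2 * p * (\<bar>g x (u x) * u x - g x (u x) * v x\<bar> + \<bar>g x (v x) * u x - g x (v x) * v x\<bar>))"
      by (rule integrable_mult_right)
    moreover have "2 * p * (\<bar>g x (u x) * u x - g x (u x) * v x\<bar> + \<bar>g x (v x) * u x - g x (v x) * v x\<bar>) = b x" for x
      unfolding b_def right_diff_distrib[symmetric] abs_mult by (simp add: algebra_simps)
    ultimately show ?thesis by simp
  qed
  \<comment> \<open>By the two equations the difference integrates to 0 for every positive shift,
    although pointwise it is only known to be at least \<open>- b x\<close>. Since
    \<open>Q 0\<close> is nonnegative and \<open>R 0\<close> is nonpositive, a vanishing limit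
    difference makes both zero.\<close>
  have "AE x in lebesgue_on \<Omega>. Q 0 x - R 0 x = 0"
  proof (rule Fatou_squeeze[where W = "\<lambda>n x. Q (\<epsilon> n) x - R (\<epsilon> n) x" and b = b])
    show "integrable (lebesgue_on \<Omega>) (\<lambda>x. Q (\<epsilon> n) x - R (\<epsilon> n) x)" for n
      unfolding Q_def R_def
      by (intro Bochner_Integration.integrable_diff Bochner_Integration.integrable_add hu hv)
    show "(LINT x|lebesgue_on \<Omega>. Q (\<epsilon> n) x - R (\<epsilon> n) x) = 0" for n
      unfolding Q_def R_def using hu[of n] hv[of n] by simp
    show "integrable (lebesgue_on \<Omega>) b" by (rule ib)
    show "AE x in lebesgue_on \<Omega>. 0 \<le> b x" using p by (intro AE_I2) (simp add: b_def)
    show "AE x in lebesgue_on \<Omega>. - b x \<le> Q (\<epsilon> n) x - R (\<epsilon> n) x" for n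
      using pos mono Zu(2) Zv(2)
    proof eventually_elim
      case (elim x)
      have sym: "(g x (v x) * v x powr (1 - p) - g x (u x) * u x powr (1 - p)) * (v x powr p - u x powr p) \<le> 0"
        using elim(3) by (simp add: algebra_simps)
      have "0 \<le> Q (\<epsilon> n) x"
        unfolding Q_def using elim \<epsilon>[of n] by (intro picone_inequality(1)[OF p]) auto
      moreover have "R (\<epsilon> n) x \<le> b x"
        using add_mono[OF picone_source_bound[OF p elim(1,2) \<epsilon>[of n] elim(3)]
            picone_source_bound[OF p elim(2,1) \<epsilon>[of n] sym]]
        unfolding R_def b_def by (simp add: abs_minus_commute add.commute mult.commute mult.left_commute)
      ultimately show ?case by linarith
    qed
    show "AE x in lebesgue_on \<Omega>. (\<lambda>n. Q (\<epsilon> n) x - R (\<epsilon> n) x) \<longlonglongrightarrow> Q 0 x - R 0 x"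
      using pos
    proof eventually_elim
      case (elim x)
      then show ?case
        unfolding Q_def R_def picone_def picone_grad_def divide_inverse
        by (intro tendsto_intros \<epsilon>0) auto
    qed
    show "AE x in lebesgue_on \<Omega>. 0 \<le> Q 0 x - R 0 x"
      using pos mono Zu(2) Zv(2)
    proof eventually_elim
      case (elim x)
      have "0 \<le> Q 0 x"
        unfolding Q_def using elim by (intro picone_inequality(1)[OF p]) auto
      moreover have "R 0 x \<le> 0"
        unfolding R_def using picone_source_limit[OF elim(1,2,3)] by simp
      ultimately show ?case by simp
    qed
  qed
  then have "AE x in lebesgue_on \<Omega>. D x = E x"
    using pos mono Zu(2) Zv(2)
  proof eventually_elim
    case (elim x)
    have "0 \<le> Q 0 x"
      unfolding Q_def using elim by (intro picone_inequality(1)[OF p]) auto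
    moreover have "R 0 x \<le> 0"
      unfolding R_def using picone_source_limit[OF elim(2,3,4)] by simp
    ultimately have "Q 0 x = 0" using elim(1) by linarith
    then show ?case
      unfolding Q_def using elim picone_inequality(2)[OF p elim(2,3,5,6)] by simp
  qed
  then show "AE x in lebesgue_on \<Omega>. u x = v x"
    by (rule approximable_eq_of_grad_eq[OF \<Omega> Zu(1) Zv(1)])
qed

end
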